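(* Let $\Sigma$ be an $m$-dimensional ($m\ge2$) submanifold of a spaceform (with metric $g$ of constant curvature on an open subset of $S^n$) with flat weightless normal bundle and constant gaussian curvature. Then $\Sigma$ is M\"obius-flat and the induced metric has constant curvature.
   Context: Spaceforms. $\mathbb R^{n+1,1}$ has inner product $(\cdot,\cdot)$ of signature $(n+1,1)$; $S^n$ is the set of its null lines; a half $\mathcal L^+$ of the light-cone is fixed. A nonzero $v_\infty\in\mathbb R^{n+1,1}$ defines on the open subset of $S^n$ of null lines not orthogonal to $v_\infty$ a metric $g$ of constant curvature $-(v_\infty,v_\infty)$, induced by the section $\sigma$ of the tautological null line bundle with $(v_\infty,\sigma)=-1$ via $g(X,Y)=(d_X\sigma,d_Y\sigma)$; up to isometry these are the spaceforms. A submanifold $\Sigma$ of the spaceform is regarded as an immersed submanifold of $S^n$, with second fundamental form $\mathrm{II}^g$ (normal-bundle valued). The gaussian (sectional) curvature of a $2$-plane $U\subset T\Sigma$ is $K_U=\langle\mathrm{II}^g(u_1,u_1),\mathrm{II}^g(u_2,u_2)\rangle-|\mathrm{II}^g(u_1,u_2)|^2$ for a $g$-orthonormal basis $u_1,u_2$ of $U$; $\Sigma$ has constant gaussian curvature if $K_U=K^g$ for all $U$ with $K^g$ constant. The weightless normal bundle is the normal bundle rescaled to have weight zero; its flatness is equivalent to flatness of the normal connection of $\mathrm{II}^g$ in the spaceform. M\"obius-flat. An immersion of an $m$-manifold $\Sigma$ in $S^n$ is a null line subbundle $\Lambda\subset\Sigma\times\mathbb R^{n+1,1}$ (oriented by $\mathcal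 L^+$) with $X\mapsto d_X\sigma$ mod $\Lambda$ injective; it induces the conformal class $c$ of the metrics $(d\sigma,d\sigma)$, $\sigma$ positive sections of $\Lambda$. $\Lambda^{(1)}$ is the span of $\sigma,d\sigma$; the weightless normal bundle is $N\Sigma\,\Lambda=\Lambda^\perp/\Lambda^{(1)}$, where $N\Sigma=\mathrm{Hom}(\Lambda,\Lambda^\perp/\Lambda^{(1)})$. For a signature $(m+1,1)$ subbundle $V\supset\Lambda^{(1)}$ (enveloped sphere congruence), $V^\perp\cong N\Sigma\,\Lambda$; the connection $\nabla$ on $N\Sigma\,\Lambda$ is the $V^\perp$-component of $d$ on $V^\perp$ (independent of $V$), and $\mathrm{II}^V_XY\,\sigma=-(d_Xd_Y\sigma)^\perp$. $V_\Sigma$ is the unique $V$ with $\mathrm{II}^V$ $c$-tracefree; $\mathrm{II}^0=\mathrm{II}^{V_\Sigma}$; $\mathbb S^0$ is the transpose of $\mathrm{II}^0$. For $m=2$: for a positive section $\sigma$ of $\Lambda$, let $D$, $K$ be the Levi-Civita connection and Gauss curvature of $(d\sigma,d\sigma)$; the $V_\Sigma$-component of the tracefree part of $D\,d\sigma$ is $-r_0\otimes\sigma$; $r=r_0+\frac12K(d\sigma,d\sigma)$ and $C^\Sigma_{X,Y}=(D_Xr)(Y,\cdot)-(D_Yr)(X,\cdot)$ (independent of $\sigma$). A commuting Cotton--York potential is a section $q$ of $S^2_0T^*\Sigma$ (symmetric, tracefree) with $(D_Xq)(Y,\cdot)-(D_Yq)(X,\cdot)=C^\Sigma_{X,Y}$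 and $q(X,\mathbb S^0_YU)=q(Y,\mathbb S^0_XU)$ for all tangent $X,Y$, normal $U$. A submanifold with $m\ge2$ is M\"obius-flat if $\nabla$ is flat and either $m\ge3$ and $c$ is conformally flat, or $m=2$ and it admits a commuting Cotton--York potential. *)

theory Defs
  imports "HOL-Analysis.Analysis"
begin

section \<open>Smooth maps and manifolds\<close>

abbreviation dd :: "('a::real_normed_vector \<Rightarrow> 'b::real_normed_vector) \<Rightarrow> 'a \<Rightarrow> 'a \<Rightarrow> 'b"
  where "dd F x X \<equiv> frechet_derivative F (at x) X"

text \<open>Intended for open subsets of finite-dimensional spaces.\<close>
primrec Ck_on :: "nat \<Rightarrow> 'a::real_normed_vector set \<Rightarrow> ('a \<Rightarrow> 'b::real_normed_vector) \<Rightarrow> bool" where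
  "Ck_on 0 S f \<longleftrightarrow> continuous_on S f"
| "Ck_on (Suc k) S f \<longleftrightarrow> f differentiable_on S \<and> (\<forall>v. Ck_on k S (\<lambda>x. dd f x v))"

definition smooth_on :: "'a::real_normed_vector set \<Rightarrow> ('a \<Rightarrow> 'b::real_normed_vector) \<Rightarrow> bool"
  where "smooth_on S f \<longleftrightarrow> (\<forall>k. Ck_on k S f)"

text \<open>
  A smooth \<open>m\<close>-manifold is a Hausdorff, second countable space (the whole type \<open>'p\<close>, by its type
  classes) with an atlas, given by local parametrizations \<open>\<psi> : D \<rightarrow> 'p\<close>, i.e. inverses of charts,
  on open sets \<open>D\<close> of \<open>\<real>\<^sup>m\<close>, \<open>m = CARD('m)\<close>. Tangent vectors at \<open>\<psi> x\<close> are given by their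
  coordinates \<open>X :: real ^ 'm\<close>; in formulas involving derivatives of tangent vectors these are
  extended to constant, hence commuting, coordinate fields.
\<close>
type_synonym ('p, 'm) param = "(real ^ 'm) set \<times> (real ^ 'm \<Rightarrow> 'p)"

definition smooth_atlas :: "('p::{t2_space, second_countable_topology}, 'm::finite) param set \<Rightarrow> bool"
  where "smooth_atlas A \<longleftrightarrow>
    (\<forall>(D, \<psi>)\<in>A. open D \<and> open (\<psi> ` D) \<and> homeomorphism D (\<psi> ` D) \<psi> (inv_into D \<psi>)) \<and>
    (\<Union>(D, \<psi>)\<in>A. \<psi> ` D) = UNIV \<and>
    (\<forall>(D, \<psi>)\<in>A. \<forall>(D', \<psi>')\<in>A. smooth_on (D \<inter> \<psi> -` (\<psi>' ` D')) (inv_into D' \<psi>' \<circ> \<psi>))"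

definition smooth_map_on ::
    "('p, 'm::finite) param set \<Rightarrow> 'p set \<Rightarrow> ('p \<Rightarrow> 'v::real_normed_vector) \<Rightarrow> bool"
  where "smooth_map_on A U f \<longleftrightarrow> (\<forall>(D, \<psi>)\<in>A. smooth_on (D \<inter> \<psi> -` U) (f \<circ> \<psi>))"

text \<open>Smooth rank \<open>k\<close> subbundles of the trivial bundle with fibre \<open>'v\<close>.\<close>
definition smooth_subbundle ::
    "('p::topological_space, 'm::finite) param set \<Rightarrow> nat \<Rightarrow> ('p \<Rightarrow> 'v::euclidean_space set) \<Rightarrow> bool"
  where "smooth_subbundle A k V \<longleftrightarrow>
    (\<forall>p. \<exists>U F. open U \<and> p \<in> U \<and> (\<forall>i<k. smooth_map_on A U (F i)) \<and>
       (\<forall>q\<in>U. V q = span ((\<lambda>i. F i q) ` {..<k}) \<and> dim (V q) = k))"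

text \<open>
  A section of \<open>S\<^sup>2T\<^sup>*\<Sigma>\<close>: its components \<open>q (D, \<psi>) x X Y\<close> in every parametrization of the atlas,
  related by the tensor transformation law.
\<close>
definition symmetric_2tensor ::
    "('p, 'm::finite) param set \<Rightarrow>
     (('p, 'm) param \<Rightarrow> real ^ 'm \<Rightarrow> real ^ 'm \<Rightarrow> real ^ 'm \<Rightarrow> real) \<Rightarrow> bool"
  where "symmetric_2tensor A q \<longleftrightarrow>
    (\<forall>(D, \<psi>)\<in>A.
       (\<forall>x\<in>D. bilinear (q (D, \<psi>) x) \<and> (\<forall>X Y. q (D, \<psi>) x X Y = q (D, \<psi>) x Y X)) \<and>
       (\<forall>X Y. smooth_on D (\<lambda>x. q (D, \<psi>) x X Y)) \<and>
       (\<forall>(D', \<psi>')\<in>A. \<forall>x\<in>D. \<forall>x'\<in>D'. \<psi> x = \<psi>' x' \<longrightarrow>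
          (\<forall>X Y. q (D, \<psi>) x X Y =
             q (D', \<psi>') x' (dd (inv_into D' \<psi>' \<circ> \<psi>) x X) (dd (inv_into D' \<psi>' \<circ> \<psi>) x Y))))"

section \<open>Riemannian geometry in coordinates\<close>

text \<open>A metric is given as \<open>h x X Y\<close>. Christoffel map \<open>D\<^sub>X Y\<close> of constant fields, by Koszul's formula.\<close>
definition christoffel ::
    "(real ^ 'm \<Rightarrow> real ^ 'm \<Rightarrow> real ^ 'm \<Rightarrow> real) \<Rightarrow> real ^ 'm \<Rightarrow> real ^ 'm \<Rightarrow> real ^ 'm \<Rightarrow> real ^ 'm::finite"
  where "christoffel h x X Y =
    (THE W. \<forall>Z. 2 * h x W Z =
       dd (\<lambda>y. h y Y Z) x X + dd (\<lambda>y. h y X Z) x Y - dd (\<lambda>y. h y X Y) x Z)"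

text \<open>\<open>(D\<^sub>X r)(Y, Z)\<close> for a bilinear form \<open>r\<close>, and \<open>(D df)(X, Y)\<close> for a vector valued function \<open>f\<close>.\<close>
definition cov_bilin ::
    "(real ^ 'm \<Rightarrow> real ^ 'm \<Rightarrow> real ^ 'm \<Rightarrow> real) \<Rightarrow> (real ^ 'm \<Rightarrow> real ^ 'm \<Rightarrow> real ^ 'm \<Rightarrow> real) \<Rightarrow>
     real ^ 'm \<Rightarrow> real ^ 'm \<Rightarrow> real ^ 'm \<Rightarrow> real ^ 'm::finite \<Rightarrow> real"
  where "cov_bilin h r x X Y Z =
    dd (\<lambda>y. r y Y Z) x X - r x (christoffel h x X Y) Z - r x Y (christoffel h x X Z)"

definition cov_hessian ::
    "(real ^ 'm \<Rightarrow> real ^ 'm \<Rightarrow> real ^ 'm \<Rightarrow> real) \<Rightarrow> (real ^ 'm \<Rightarrow> 'v::real_normed_vector) \<Rightarrow>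
     real ^ 'm \<Rightarrow> real ^ 'm \<Rightarrow> real ^ 'm::finite \<Rightarrow> 'v"
  where "cov_hessian h f x X Y = dd (\<lambda>y. dd f y Y) x X - dd f x (christoffel h x X Y)"

text \<open>\<open>R(X, Y)Z = D\<^sub>X D\<^sub>Y Z - D\<^sub>Y D\<^sub>X Z\<close> for constant fields.\<close>
definition riemann ::
    "(real ^ 'm \<Rightarrow> real ^ 'm \<Rightarrow> real ^ 'm \<Rightarrow> real) \<Rightarrow>
     real ^ 'm \<Rightarrow> real ^ 'm \<Rightarrow> real ^ 'm \<Rightarrow> real ^ 'm \<Rightarrow> real ^ 'm::finite"
  where "riemann h x X Y Z =
    dd (\<lambda>y. christoffel h y Y Z) x X + christoffel h x X (christoffel h x Y Z)
    - dd (\<lambda>y. christoffel h y X Z) x Y - christoffel h x Y (christoffel h x X Z)"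

definition sectional_curv ::
    "(real ^ 'm \<Rightarrow> real ^ 'm \<Rightarrow> real ^ 'm \<Rightarrow> real) \<Rightarrow> real ^ 'm \<Rightarrow> real ^ 'm \<Rightarrow> real ^ 'm::finite \<Rightarrow> real"
  where "sectional_curv h x X Y =
    h x (riemann h x X Y Y) X / (h x X X * h x Y Y - (h x X Y)\<^sup>2)"

text \<open>For \<open>m = 2\<close>: the sectional curvature of the only tangent plane.\<close>
definition gauss_curv ::
    "(real ^ 'm \<Rightarrow> real ^ 'm \<Rightarrow> real ^ 'm \<Rightarrow> real) \<Rightarrow> real ^ 'm::finite \<Rightarrow> real"
  where "gauss_curv h x =
    (THE k. \<forall>X Y. X \<noteq> Y \<and> independent {X, Y} \<longrightarrow> sectional_curv h x X Y = k)"

text \<open>\<open>h\<^sup>i\<^sup>j B\<^sub>i\<^sub>j\<close>, for an inner product \<open>h\<close> and a vector valued bilinear form \<open>B\<close>.\<close>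
definition mtrace ::
    "(real ^ 'm \<Rightarrow> real ^ 'm \<Rightarrow> real) \<Rightarrow> (real ^ 'm \<Rightarrow> real ^ 'm \<Rightarrow> 'v) \<Rightarrow> 'v::real_vector"
  where "mtrace h (B :: real ^ 'm::finite \<Rightarrow> _) =
    (\<Sum>i\<in>UNIV. \<Sum>j\<in>UNIV.
       (matrix_inv (\<chi> k l. h (axis k 1) (axis l 1)) $ i $ j) *\<^sub>R B (axis i 1) (axis j 1))"

definition tracefree_part ::
    "(real ^ 'm \<Rightarrow> real ^ 'm \<Rightarrow> real) \<Rightarrow> (real ^ 'm \<Rightarrow> real ^ 'm \<Rightarrow> 'v) \<Rightarrow>
     real ^ 'm \<Rightarrow> real ^ 'm::finite \<Rightarrow> 'v::real_vector"
  where "tracefree_part h B X Y = B X Y - (h X Y / real CARD('m)) *\<^sub>R mtrace h B"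

section \<open>The conformal sphere\<close>

text \<open>\<open>\<real>\<^sup>n\<^sup>+\<^sup>1\<^sup>,\<^sup>1\<close> is \<open>'e \<times> real\<close> with \<open>DIM('e) = n + 1\<close>.\<close>
definition lor :: "'e::euclidean_space \<times> real \<Rightarrow> 'e \<times> real \<Rightarrow> real"
  where "lor v w = fst v \<bullet> fst w - snd v * snd w"

definition lorth :: "('e::euclidean_space \<times> real) set \<Rightarrow> ('e \<times> real) set"
  where "lorth W = {v. \<forall>w\<in>W. lor v w = 0}"

text \<open>Component in \<open>W\<close> of the decomposition \<open>W \<oplus> W\<^sup>\<bottom>\<close>, for nondegenerate \<open>W\<close>.\<close>
definition lproj :: "('e::euclidean_space \<times> real) set \<Rightarrow> 'e \<times> real \<Rightarrow> 'e \<times> real"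
  where "lproj W v = (THE w. w \<in> W \<and> v - w \<in> lorth W)"

definition has_signature :: "('e::euclidean_space \<times> real) set \<Rightarrow> nat \<Rightarrow> nat \<Rightarrow> bool"
  where "has_signature W a b \<longleftrightarrow>
    (\<exists>P N. subspace P \<and> subspace N \<and> dim P = a \<and> dim N = b \<and>
       (\<forall>v\<in>P. v \<noteq> 0 \<longrightarrow> lor v v > 0) \<and> (\<forall>v\<in>N. v \<noteq> 0 \<longrightarrow> lor v v < 0) \<and>
       (\<forall>v\<in>P. \<forall>w\<in>N. lor v w = 0) \<and> W = {v + w |v w. v \<in> P \<and> w \<in> N})"

definition light_cone_half :: "('e::euclidean_space \<times> real) set"
  where "light_cone_half = {v. lor v v = 0 \<and> snd v > 0}"

definition conformal_sphere :: "('e::euclidean_space \<times> real) set set"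
  where "conformal_sphere = {span {v} |v. v \<noteq> 0 \<and> lor v v = 0}"

definition positive_section ::
    "('p, 'm::finite) param set \<Rightarrow> ('p \<Rightarrow> ('e::euclidean_space \<times> real) set) \<Rightarrow> 'p set \<Rightarrow>
     ('p \<Rightarrow> 'e \<times> real) \<Rightarrow> bool"
  where "positive_section A \<Lambda> U \<sigma> \<longleftrightarrow>
    smooth_map_on A U \<sigma> \<and> (\<forall>p\<in>U. \<sigma> p \<in> \<Lambda> p \<inter> light_cone_half)"

text \<open>
  A null line subbundle, being oriented by the half light-cone, has global positive sections
  (normalize the last coordinate to be 1). Conversely a positive section makes \<open>\<Lambda>\<close> a smooth
  subbundle. Injectivity of \<open>X \<mapsto> d\<^sub>X \<sigma>\<close> mod \<open>\<Lambda>\<close> does not depend on \<open>\<sigma>\<close>.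
\<close>
definition sphere_immersion ::
    "('p, 'm::finite) param set \<Rightarrow> ('p \<Rightarrow> ('e::euclidean_space \<times> real) set) \<Rightarrow> bool"
  where "sphere_immersion A \<Lambda> \<longleftrightarrow>
    (\<forall>p. \<Lambda> p \<in> conformal_sphere) \<and>
    (\<exists>\<sigma>. positive_section A \<Lambda> UNIV \<sigma> \<and>
       (\<forall>(D, \<psi>)\<in>A. \<forall>x\<in>D. \<forall>X. dd (\<sigma> \<circ> \<psi>) x X \<in> \<Lambda> (\<psi> x) \<longrightarrow> X = 0))"

text \<open>The metric \<open>(d\<sigma>, d\<sigma>)\<close>, for the coordinate expression \<open>s = \<sigma> \<circ> \<psi>\<close> of a section.\<close>
definition lift_metric ::
    "(real ^ 'm \<Rightarrow> 'e::euclidean_space \<times> real) \<Rightarrow> real ^ 'm \<Rightarrow> real ^ 'm \<Rightarrow> real ^ 'm::finite \<Rightarrow> real"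
  where "lift_metric s x X Y = lor (dd s x X) (dd s x Y)"

text \<open>The metrics \<open>(d\<sigma>, d\<sigma>)\<close> of local positive sections \<open>\<sigma>\<close> are all the local metrics of \<open>c\<close>.\<close>
definition conformally_flat ::
    "('p::topological_space, 'm::finite) param set \<Rightarrow> ('p \<Rightarrow> ('e::euclidean_space \<times> real) set) \<Rightarrow> bool"
  where "conformally_flat A \<Lambda> \<longleftrightarrow>
    (\<forall>p. \<exists>U \<sigma>. open U \<and> p \<in> U \<and> positive_section A \<Lambda> U \<sigma> \<and>
       (\<forall>(D, \<psi>)\<in>A. \<forall>x\<in>D \<inter> \<psi> -` U. \<forall>X Y Z. riemann (lift_metric (\<sigma> \<circ> \<psi>)) x X Y Z = 0))"

section \<open>Enveloped sphere congruences and Moebius-flatness\<close>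

text \<open>\<open>\<Lambda>\<^sup>(\<^sup>1\<^sup>)\<close>\<close>
definition osculating ::
    "('p, 'm::finite) param set \<Rightarrow> ('p \<Rightarrow> ('e::euclidean_space \<times> real) set) \<Rightarrow> 'p \<Rightarrow> ('e \<times> real) set"
  where "osculating A \<Lambda> p =
    span (\<Lambda> p \<union> {dd (\<sigma> \<circ> \<psi>) x X |\<sigma> D \<psi> x X.
      positive_section A \<Lambda> UNIV \<sigma> \<and> (D, \<psi>) \<in> A \<and> x \<in> D \<and> \<psi> x = p})"

definition sphere_congruence ::
    "('p::topological_space, 'm::finite) param set \<Rightarrow> ('p \<Rightarrow> ('e::euclidean_space \<times> real) set) \<Rightarrow>
     ('p \<Rightarrow> ('e \<times> real) set) \<Rightarrow> bool"
  where "sphere_congruence A \<Lambda> V \<longleftrightarrow>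
    smooth_subbundle A (CARD('m) + 2) V \<and>
    (\<forall>p. has_signature (V p) (CARD('m) + 1) 1 \<and> osculating A \<Lambda> p \<subseteq> V p)"

text \<open>The connection on \<open>V\<^sup>\<bottom>\<close>, for the coordinate expression \<open>\<xi>\<close> of a section.\<close>
definition normal_nabla ::
    "('p \<Rightarrow> ('e::euclidean_space \<times> real) set) \<Rightarrow> (real ^ 'm \<Rightarrow> 'p) \<Rightarrow>
     (real ^ 'm \<Rightarrow> 'e \<times> real) \<Rightarrow> real ^ 'm::finite \<Rightarrow> real ^ 'm \<Rightarrow> 'e \<times> real"
  where "normal_nabla V \<psi> \<xi> X x = lproj (lorth (V (\<psi> x))) (dd \<xi> x X)"

definition normal_nabla_flat ::
    "('p, 'm::finite) param set \<Rightarrow> ('p \<Rightarrow> ('e::euclidean_space \<times> real) set) \<Rightarrow> bool"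
  where "normal_nabla_flat A V \<longleftrightarrow>
    (\<forall>(D, \<psi>)\<in>A. \<forall>U \<xi>. open U \<and> U \<subseteq> D \<and> smooth_on U \<xi> \<and> (\<forall>y\<in>U. \<xi> y \<in> lorth (V (\<psi> y))) \<longrightarrow>
       (\<forall>x\<in>U. \<forall>X Y. normal_nabla V \<psi> (normal_nabla V \<psi> \<xi> Y) X x =
                     normal_nabla V \<psi> (normal_nabla V \<psi> \<xi> X) Y x))"

text \<open>
  \<open>\<Lambda>\<^sup>\<bottom> / \<Lambda>\<^sup>(\<^sup>1\<^sup>)\<close> is identified with \<open>V\<^sup>\<bottom>\<close>; under this identification the connection does not depend
  on \<open>V\<close>.
\<close>
definition weightless_normal_flat ::
    "('p::topological_space, 'm::finite) param set \<Rightarrow> ('p \<Rightarrow> ('e::euclidean_space \<times> real) set) \<Rightarrow> bool"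
  where "weightless_normal_flat A \<Lambda> \<longleftrightarrow>
    (\<forall>V. sphere_congruence A \<Lambda> V \<longrightarrow> normal_nabla_flat A V)"

text \<open>
  \<open>II\<^sup>V\<^sub>X Y \<sigma>\<close> at \<open>x\<close>, for \<open>W = V (\<psi> x)\<close> and \<open>s = \<sigma> \<circ> \<psi>\<close>. As \<open>d\<sigma>\<close> is \<open>V\<close>-valued, the extension of
  \<open>Y\<close> is irrelevant.
\<close>
definition sff ::
    "('e::euclidean_space \<times> real) set \<Rightarrow> (real ^ 'm \<Rightarrow> 'e \<times> real) \<Rightarrow>
     real ^ 'm \<Rightarrow> real ^ 'm \<Rightarrow> real ^ 'm::finite \<Rightarrow> 'e \<times> real"
  where "sff W s x X Y = - lproj (lorth W) (dd (\<lambda>y. dd s y Y) x X)"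

definition central_sphere_congruence ::
    "('p::topological_space, 'm::finite) param set \<Rightarrow> ('p \<Rightarrow> ('e::euclidean_space \<times> real) set) \<Rightarrow>
     'p \<Rightarrow> ('e \<times> real) set"
  where "central_sphere_congruence A \<Lambda> =
    (THE V. sphere_congruence A \<Lambda> V \<and>
       (\<forall>\<sigma>. positive_section A \<Lambda> UNIV \<sigma> \<longrightarrow>
          (\<forall>(D, \<psi>)\<in>A. \<forall>x\<in>D.
             mtrace (lift_metric (\<sigma> \<circ> \<psi>) x) (sff (V (\<psi> x)) (\<sigma> \<circ> \<psi>) x) = 0)))"

text \<open>
  \<open>S\<^sub>Y U\<close>, where the normal vector \<open>U\<close> is given by \<open>u = U \<sigma>\<close> in \<open>W\<^sup>\<bottom>\<close>. Both sides of the equation scale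
  by the square of the factor when \<open>\<sigma>\<close> is rescaled with \<open>U\<close> fixed.
\<close>
definition sff_transpose ::
    "('e::euclidean_space \<times> real) set \<Rightarrow> (real ^ 'm \<Rightarrow> 'e \<times> real) \<Rightarrow>
     real ^ 'm \<Rightarrow> real ^ 'm \<Rightarrow> 'e \<times> real \<Rightarrow> real ^ 'm::finite"
  where "sff_transpose W s x Y u =
    (THE Z. \<forall>X. lift_metric s x Z X = lor u (sff W s x Y X))"

text \<open>\<open>r\<^sub>0\<close>, \<open>r\<close> and \<open>C\<close> in coordinates, where \<open>V\<close> is already composed with the parametrization.\<close>
definition r_zero ::
    "(real ^ 'm \<Rightarrow> ('e::euclidean_space \<times> real) set) \<Rightarrow> (real ^ 'm \<Rightarrow> 'e \<times> real) \<Rightarrow>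
     real ^ 'm \<Rightarrow> real ^ 'm \<Rightarrow> real ^ 'm::finite \<Rightarrow> real"
  where "r_zero V s x X Y =
    (THE t. lproj (V x) (tracefree_part (lift_metric s x) (cov_hessian (lift_metric s) s x) X Y)
            = - (t *\<^sub>R s x))"

definition r_tensor ::
    "(real ^ 'm \<Rightarrow> ('e::euclidean_space \<times> real) set) \<Rightarrow> (real ^ 'm \<Rightarrow> 'e \<times> real) \<Rightarrow>
     real ^ 'm \<Rightarrow> real ^ 'm \<Rightarrow> real ^ 'm::finite \<Rightarrow> real"
  where "r_tensor V s x X Y =
    r_zero V s x X Y + gauss_curv (lift_metric s) x / 2 * lift_metric s x X Y"

definition cotton_york ::
    "(real ^ 'm \<Rightarrow> ('e::euclidean_space \<times> real) set) \<Rightarrow> (real ^ 'm \<Rightarrow> 'e \<times> real) \<Rightarrow>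
     real ^ 'm \<Rightarrow> real ^ 'm \<Rightarrow> real ^ 'm \<Rightarrow> real ^ 'm::finite \<Rightarrow> real"
  where "cotton_york V s x X Y Z =
    cov_bilin (lift_metric s) (r_tensor V s) x X Y Z
    - cov_bilin (lift_metric s) (r_tensor V s) x Y X Z"

text \<open>All conditions below are independent of the positive section \<open>\<sigma>\<close>.\<close>
definition commuting_cy_potential ::
    "('p::topological_space, 'm::finite) param set \<Rightarrow> ('p \<Rightarrow> ('e::euclidean_space \<times> real) set) \<Rightarrow>
     (('p, 'm) param \<Rightarrow> real ^ 'm \<Rightarrow> real ^ 'm \<Rightarrow> real ^ 'm \<Rightarrow> real) \<Rightarrow> bool"
  where "commuting_cy_potential A \<Lambda> q \<longleftrightarrow>
    symmetric_2tensor A q \<and>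
    (\<forall>\<sigma>. positive_section A \<Lambda> UNIV \<sigma> \<longrightarrow>
      (\<forall>(D, \<psi>)\<in>A. \<forall>x\<in>D.
        let s = \<sigma> \<circ> \<psi>; h = lift_metric s; V = central_sphere_congruence A \<Lambda> \<circ> \<psi> in
        mtrace (h x) (q (D, \<psi>) x) = 0 \<and>
        (\<forall>X Y Z. cov_bilin h (q (D, \<psi>)) x X Y Z - cov_bilin h (q (D, \<psi>)) x Y X Z
                 = cotton_york V s x X Y Z) \<and>
        (\<forall>X Y. \<forall>u\<in>lorth (V x).
           q (D, \<psi>) x X (sff_transpose (V x) s x Y u) = q (D, \<psi>) x Y (sff_transpose (V x) s x X u))))"

definition moebius_flat ::
    "('p::topological_space, 'm::finite) param set \<Rightarrow> ('p \<Rightarrow> ('e::euclidean_space \<times> real) set) \<Rightarrow> bool"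
  where "moebius_flat A \<Lambda> \<longleftrightarrow>
    weightless_normal_flat A \<Lambda> \<and>
    (CARD('m) \<ge> 3 \<and> conformally_flat A \<Lambda> \<or>
     CARD('m) = 2 \<and> (\<exists>q. commuting_cy_potential A \<Lambda> q))"

section \<open>Submanifolds of spaceforms\<close>

definition in_spaceform ::
    "'e::euclidean_space \<times> real \<Rightarrow> ('p \<Rightarrow> ('e \<times> real) set) \<Rightarrow> bool"
  where "in_spaceform v \<Lambda> \<longleftrightarrow> v \<noteq> 0 \<and> (\<forall>p. \<exists>w\<in>\<Lambda> p. lor v w \<noteq> 0)"

text \<open>
  The section of \<open>\<Lambda>\<close> with \<open>(v, \<sigma>) = -1\<close>, which takes values in the other half of the light-cone
  where \<open>v\<close> has positive inner product with positive sections.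
\<close>
definition spaceform_lift ::
    "'e::euclidean_space \<times> real \<Rightarrow> ('p \<Rightarrow> ('e \<times> real) set) \<Rightarrow> 'p \<Rightarrow> 'e \<times> real"
  where "spaceform_lift v \<Lambda> p = (THE w. w \<in> \<Lambda> p \<and> lor v w = -1)"

text \<open>
  The spaceform is isometric, by \<open>\<sigma>\<close>, to the submanifold \<open>{z. (z, z) = 0, (v, z) = -1}\<close> of
  \<open>\<real>\<^sup>n\<^sup>+\<^sup>1\<^sup>,\<^sup>1\<close> with the induced metric. Its tangent space at \<open>z\<close> is \<open>{z, v}\<^sup>\<bottom>\<close>, and its Levi-Civita
  connection (here along \<open>s = \<sigma> \<circ> \<psi>\<close>, applied to a tangent field \<open>w\<close>) is the tangential component
  of \<open>d\<close>.
\<close>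
definition spaceform_tangent :: "'e::euclidean_space \<times> real \<Rightarrow> 'e \<times> real \<Rightarrow> ('e \<times> real) set"
  where "spaceform_tangent v z = lorth {z, v}"

definition spaceform_nabla ::
    "'e::euclidean_space \<times> real \<Rightarrow> (real ^ 'm \<Rightarrow> 'e \<times> real) \<Rightarrow>
     (real ^ 'm \<Rightarrow> 'e \<times> real) \<Rightarrow> real ^ 'm::finite \<Rightarrow> real ^ 'm \<Rightarrow> 'e \<times> real"
  where "spaceform_nabla v s w X x = lproj (spaceform_tangent v (s x)) (dd w x X)"

definition spaceform_normal ::
    "'e::euclidean_space \<times> real \<Rightarrow> (real ^ 'm \<Rightarrow> 'e \<times> real) \<Rightarrow> real ^ 'm::finite \<Rightarrow> ('e \<times> real) set"
  where "spaceform_normal v s x = spaceform_tangent v (s x) \<inter> lorth (range (dd s x))"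

definition spaceform_sff ::
    "'e::euclidean_space \<times> real \<Rightarrow> (real ^ 'm \<Rightarrow> 'e \<times> real) \<Rightarrow>
     real ^ 'm \<Rightarrow> real ^ 'm \<Rightarrow> real ^ 'm::finite \<Rightarrow> 'e \<times> real"
  where "spaceform_sff v s x X Y =
    lproj (spaceform_normal v s x) (spaceform_nabla v s (\<lambda>y. dd s y Y) X x)"

text \<open>The extrinsic quantity \<open>K\<^sub>U\<close> is constant; it differs from the sectional curvature of the
  induced metric by the curvature of the spaceform.\<close>
definition constant_gaussian_curvature ::
    "('p, 'm::finite) param set \<Rightarrow> 'e::euclidean_space \<times> real \<Rightarrow> ('p \<Rightarrow> ('e \<times> real) set) \<Rightarrow> real \<Rightarrow> bool"
  where "constant_gaussian_curvature A v \<Lambda> K \<longleftrightarrow>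
    (\<forall>(D, \<psi>)\<in>A. \<forall>x\<in>D. \<forall>X Y.
      let s = spaceform_lift v \<Lambda> \<circ> \<psi>; h = lift_metric s; B = spaceform_sff v s x in
      h x X X = 1 \<and> h x Y Y = 1 \<and> h x X Y = 0 \<longrightarrow>
      lor (B X X) (B Y Y) - lor (B X Y) (B X Y) = K)"

definition induced_metric_constant_curvature ::
    "('p, 'm::finite) param set \<Rightarrow> 'e::euclidean_space \<times> real \<Rightarrow> ('p \<Rightarrow> ('e \<times> real) set) \<Rightarrow> real \<Rightarrow> bool"
  where "induced_metric_constant_curvature A v \<Lambda> k \<longleftrightarrow>
    (\<forall>(D, \<psi>)\<in>A. \<forall>x\<in>D. \<forall>X Y. X \<noteq> Y \<and> independent {X, Y} \<longrightarrow>
      sectional_curv (lift_metric (spaceform_lift v \<Lambda> \<circ> \<psi>)) x X Y = k)"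

end

theory Submission
  imports Defs
begin

text \<open>
  Let \<open>\<sigma>\<close> be the lift of the submanifold with \<open>(v, \<sigma>) = -1\<close> and \<open>h = (d\<sigma>, d\<sigma>)\<close>. Since \<open>\<sigma>\<close> maps into a
  pseudo-euclidean space, the curvature of \<open>h\<close> is given by the Gauss equation in terms of
  \<open>H = D d\<sigma>\<close>, and \<open>H = II + h (v + (v, v) \<sigma>)\<close>. Hence \<open>h\<close> has constant curvature \<open>k = K - (v, v)\<close>.

  If \<open>m \<ge> 3\<close>, a flat metric in the conformal class is obtained by solving the overdetermined linear
  system \<open>D d\<psi> = -k \<psi> h\<close>, which is integrable because \<open>h\<close> has constant curvature.

  If \<open>m = 2\<close>, the potential is \<open>q = (v, II\<^sup>0) = - (n, b)\<close>, where \<open>n\<close> is the normal part of \<open>v\<close> with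
  respect to the central sphere congruence and \<open>b\<close> that of \<open>D d\<sigma>\<close>. It commutes with the shape
  operators by the Ricci equation. For an arbitrary lift \<open>s\<close>, with \<open>\<phi> = - (v, s)\<close> and Levi-Civita
  connection and norm those of \<open>(ds, ds)\<close>, one finds
  \<open>r - q = (k + |d\<phi>|\<^sup>2) / (2 \<phi>\<^sup>2) (ds, ds) - D d\<phi> / \<phi>\<close>, and this is a Codazzi tensor because
  \<open>\<phi>\<^sup>-\<^sup>2 (ds, ds)\<close> has constant curvature \<open>k\<close>.
\<close>

section \<open>Calculus of smooth maps\<close>

text \<open>Curvature is read off \<open>cov_hessian (lift_metric s) s\<close>: the ambient space is
  flat, so third derivatives of the lift cancel by symmetry and only products of this form survive.
  It transforms simply under change of chart and of lift, so the curvature of a changed lift is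
  recomputed from it. For m >= 3 the conformal factor is that of stereographic projection: for k = 1
  one may think of cos(r)/2 as solution of the linear system and of cos(r)/2 + 1/2 as factor, which
  is the origin of the constants 1/2 and k/4. For m = 2 the tensor r - q is what the conformal
  transformation law of the Schouten tensor makes of k/2 times the metric of curvature k; this
  explains its form and why it is Codazzi. A potential is tested in all positive lifts, whereas the
  lift with (v, \<sigma>) = -1 may lie in the negative half of the light cone. Hence q is formed
  from that one lift and then compared with an arbitrary positive one, of which it is a rescaling of
  either sign; the sign \<epsilon> for m >= 3 has the same origin.\<close>

lemma dd_eqI: "(f has_derivative f') (at x) \<Longrightarrow> dd f x X = f' X"
  using frechet_derivative_at by metis

text \<open>The derivative is a choice from the set of all derivatives at the point, and this set
  depends only on the germ of the map; so the choices agree, also at points where the set is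
  empty.\<close>

lemma dd_cong_open:
  assumes "open S" "x \<in> S" "\<And>y. y \<in> S \<Longrightarrow> f y = g y"
  shows "dd f x = dd g x"
proof -
  have "(f has_derivative f') (at x) \<longleftrightarrow> (g has_derivative f') (at x)" for f'
    using has_derivative_transform_within_open[OF _ assms(1,2)] assms(3) by metis
  then show ?thesis by (simp add: frechet_derivative_def)
qed

lemma Ck_on_cong:
  assumes "open S" "\<And>x. x \<in> S \<Longrightarrow> f x = g x" "Ck_on k S f"
  shows "Ck_on k S g"
  using assms(2,3)
proof (induction k arbitrary: f g)
  case 0 then show ?case by (simp cong: continuous_on_cong)
next
  case (Suc k)
  have "g differentiable_on S"
    unfolding differentiable_on_eq_differentiable_at[OF assms(1)]
  proof
    fix x assume x: "x \<in> S"
    then have "(f has_derivative dd f x) (at x)"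
      using Suc.prems(2) assms(1) by (simp add: differentiable_on_eq_differentiable_at frechet_derivative_works)
    then have "(g has_derivative dd f x) (at x)"
      by (rule has_derivative_transform_within_open[OF _ assms(1) x]) (use Suc.prems(1) in simp)
    then show "g differentiable at x" unfolding differentiable_def by blast
  qed
  moreover have "Ck_on k S (\<lambda>x. dd g x v)" for v
  proof (rule Suc.IH[of "\<lambda>x. dd f x v"])
    show "dd f x v = dd g x v" if "x \<in> S" for x
      using dd_cong_open[OF assms(1) that, of f g] Suc.prems(1) by simp
    show "Ck_on k S (\<lambda>x. dd f x v)" using Suc.prems(2) by simp
  qed
  ultimately show ?case by simp
qed

lemma Ck_on_Suc: "Ck_on (Suc k) S f \<Longrightarrow> Ck_on k S f"
proof (induction k arbitrary: f)
  case 0 then show ?case by (simp add: differentiable_imp_continuous_on)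
next
  case (Suc k)
  have "Ck_on k S (\<lambda>x. dd f x v)" for v
    by (rule Suc.IH) (use Suc.prems in simp)
  then show ?case using Suc.prems by simp
qed

lemma Ck_on_subset: "S \<subseteq> T \<Longrightarrow> Ck_on k T f \<Longrightarrow> Ck_on k S f"
  by (induction k arbitrary: f) (auto intro: continuous_on_subset differentiable_on_subset)

text \<open>Lets an induction supply its own formula \<open>f'\<close> in place of the chosen
  \<open>dd f\<close>. Products, composites and inverses are treated this way, so that only the
  formula has to be shown regular of lower order.\<close>

lemma Ck_on_SucI:
  assumes "open S" "\<And>x. x \<in> S \<Longrightarrow> (f has_derivative f' x) (at x)" "\<And>v. Ck_on k S (\<lambda>x. f' x v)"
  shows "Ck_on (Suc k) S f"
proof -
  have "f differentiable_on S"
    using assms(1,2) by (auto simp: differentiable_on_eq_differentiable_at differentiable_def)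
  moreover have "Ck_on k S (\<lambda>x. dd f x v)" for v
    by (rule Ck_on_cong[OF assms(1) _ assms(3)[of v]]) (metis assms(2) dd_eqI)
  ultimately show ?thesis by simp
qed

lemma Ck_on_Suc_has_derivative:
  assumes "open S" "Ck_on (Suc k) S f" "x \<in> S"
  shows "(f has_derivative dd f x) (at x)"
  using assms by (simp add: differentiable_on_eq_differentiable_at frechet_derivative_works)

lemma Ck_on_const: "open S \<Longrightarrow> Ck_on k S (\<lambda>x. c)"
proof (induction k arbitrary: c)
  case (Suc k)
  show ?case by (rule Ck_on_SucI[OF Suc.prems has_derivative_const]) (use Suc in simp)
qed auto

lemma Ck_on_bounded_linear_compose:
  assumes "open S" "bounded_linear L"
  shows "Ck_on k S f \<Longrightarrow> Ck_on k S (\<lambda>x. L (f x))"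
proof (induction k arbitrary: f)
  case 0 then show ?case
    using assms(2) by (simp add: bounded_linear.continuous_on)
next
  case (Suc k)
  show ?case
    by (rule Ck_on_SucI[OF assms(1), where f' = "\<lambda>x v. L (dd f x v)"])
      (use Suc assms Ck_on_Suc_has_derivative[OF assms(1) Suc.prems] in
        \<open>auto intro: bounded_linear.has_derivative\<close>)
qed

lemma Ck_on_add:
  assumes "open S"
  shows "Ck_on k S f \<Longrightarrow> Ck_on k S g \<Longrightarrow> Ck_on k S (\<lambda>x. f x + g x)"
proof (induction k arbitrary: f g)
  case 0 then show ?case by (simp add: continuous_on_add)
next
  case (Suc k)
  show ?case
    by (rule Ck_on_SucI[OF assms(1), where f' = "\<lambda>x v. dd f x v + dd g x v"])
      (use Suc Ck_on_Suc_has_derivative[OF assms(1) Suc.prems(1)]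
          Ck_on_Suc_has_derivative[OF assms(1) Suc.prems(2)] in \<open>auto intro!: has_derivative_add\<close>)
qed

lemma Ck_on_bilinear:
  assumes "open S" "bounded_bilinear B"
  shows "Ck_on k S f \<Longrightarrow> Ck_on k S g \<Longrightarrow> Ck_on k S (\<lambda>x. B (f x) (g x))"
proof (induction k arbitrary: f g)
  case 0 then show ?case using assms(2) by (simp add: bounded_bilinear.continuous_on)
next
  case (Suc k)
  note d = Ck_on_Suc_has_derivative[OF assms(1)]
  show ?case
  proof (rule Ck_on_SucI[OF assms(1)])
    show "((\<lambda>x. B (f x) (g x)) has_derivative (\<lambda>v. B (f x) (dd g x v) + B (dd f x v) (g x))) (at x)"
      if "x \<in> S" for x
      by (rule bounded_bilinear.FDERIV[OF assms(2)]) (use d Suc.prems that in auto)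
    show "Ck_on k S (\<lambda>x. B (f x) (dd g x v) + B (dd f x v) (g x))" for v
      using Suc.prems Ck_on_Suc[OF Suc.prems(1)] Ck_on_Suc[OF Suc.prems(2)]
      by (intro Ck_on_add[OF assms(1)] Suc.IH) auto
  qed
qed

lemma Ck_on_sum:
  assumes "open S" "\<And>i. i \<in> I \<Longrightarrow> Ck_on k S (f i)"
  shows "Ck_on k S (\<lambda>x. \<Sum>i\<in>I. f i x)"
  using assms(2)
  by (induction I rule: infinite_finite_induct) (auto intro: Ck_on_const Ck_on_add assms(1))

text \<open>\<open>Ck_on\<close> controls derivatives in fixed directions only, while the chain rule
  differentiates \<open>g\<close> in the moving direction \<open>dd f x v\<close>. Expanding that
  direction in \<open>Basis\<close> leaves a finite sum of products with fixed directions; hence the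
  Euclidean middle space.\<close>

lemma Ck_on_compose:
  fixes f :: "'a::real_normed_vector \<Rightarrow> 'b::euclidean_space"
  assumes "open S" "open T" "\<And>x. x \<in> S \<Longrightarrow> f x \<in> T"
  shows "Ck_on k S f \<Longrightarrow> Ck_on k T g \<Longrightarrow> Ck_on k S (\<lambda>x. g (f x))"
proof (induction k arbitrary: g)
  case 0
  then have "continuous_on (f ` S) g" "continuous_on S f"
    using assms(3) by (auto elim: continuous_on_subset)
  then show ?case using continuous_on_compose2 by fastforce
next
  case (Suc k)
  have df: "(f has_derivative dd f x) (at x)" if "x \<in> S" for x
    using Ck_on_Suc_has_derivative[OF assms(1)] Suc.prems that by blast
  have dg: "(g has_derivative dd g x) (at x)" if "x \<in> T" for x
    using Ck_on_Suc_has_derivative[OF assms(2)] Suc.prems that by blast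
  show ?case
  proof (rule Ck_on_SucI[OF assms(1)])
    show "((\<lambda>x. g (f x)) has_derivative (\<lambda>v. \<Sum>b\<in>Basis. (dd f x v \<bullet> b) *\<^sub>R dd g (f x) b)) (at x)"
      if x: "x \<in> S" for x
    proof -
      have "((\<lambda>x. g (f x)) has_derivative (\<lambda>v. dd g (f x) (dd f x v))) (at x)"
        using has_derivative_compose[OF df[OF x] dg[OF assms(3)[OF x]]] .
      moreover have "dd g (f x) (dd f x v) = (\<Sum>b\<in>Basis. (dd f x v \<bullet> b) *\<^sub>R dd g (f x) b)" for v
      proof -
        have l: "linear (dd g (f x))" using has_derivative_linear[OF dg[OF assms(3)[OF x]]] .
        have "dd g (f x) (dd f x v) = dd g (f x) (\<Sum>b\<in>Basis. (dd f x v \<bullet> b) *\<^sub>R b)"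
          by (simp only: euclidean_representation)
        then show ?thesis by (simp add: linear_sum[OF l] linear_cmul[OF l])
      qed
      ultimately show ?thesis by simp
    qed
    show "Ck_on k S (\<lambda>x. \<Sum>b\<in>Basis. (dd f x v \<bullet> b) *\<^sub>R dd g (f x) b)" for v
    proof (intro Ck_on_sum[OF assms(1)] Ck_on_bilinear[OF assms(1) bounded_bilinear_scaleR])
      fix b :: 'b
      show "Ck_on k S (\<lambda>x. dd f x v \<bullet> b)"
        using Suc.prems by (intro Ck_on_bounded_linear_compose[OF assms(1) bounded_linear_inner_left]) auto
      show "Ck_on k S (\<lambda>x. dd g (f x) b)"
        using Ck_on_Suc[OF Suc.prems(1)] Suc.prems(2) by (intro Suc.IH) auto
    qed
  qed
qed

lemma Ck_on_inverse:
  fixes f :: "'a::real_normed_vector \<Rightarrow> real"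
  assumes "open S" "\<And>x. x \<in> S \<Longrightarrow> f x \<noteq> 0"
  shows "Ck_on k S f \<Longrightarrow> Ck_on k S (\<lambda>x. inverse (f x))"
proof (induction k)
  case 0 then show ?case using assms(2) by (simp add: continuous_on_inverse)
next
  case (Suc k)
  note mult = Ck_on_bilinear[OF assms(1) bounded_bilinear_mult]
  show ?case
  proof (rule Ck_on_SucI[OF assms(1)])
    show "((\<lambda>x. inverse (f x)) has_derivative (\<lambda>v. (-1) * (inverse (f x) * (dd f x v * inverse (f x))))) (at x)"
      if x: "x \<in> S" for x
      using Deriv.has_derivative_inverse[OF assms(2)[OF x] Ck_on_Suc_has_derivative[OF assms(1) Suc.prems x]]
      by (simp add: mult.assoc)
    show "Ck_on k S (\<lambda>x. (-1) * (inverse (f x) * (dd f x v * inverse (f x))))" for v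
      using Suc.prems Ck_on_Suc[OF Suc.prems] by (intro mult Ck_on_const[OF assms(1)] Suc.IH) auto
  qed
qed

lemma smooth_on_has_derivative: "open S \<Longrightarrow> smooth_on S f \<Longrightarrow> x \<in> S \<Longrightarrow> (f has_derivative dd f x) (at x)"
  using Ck_on_Suc_has_derivative unfolding smooth_on_def by blast

lemma smooth_on_dd: "smooth_on S f \<Longrightarrow> smooth_on S (\<lambda>x. dd f x v)"
  unfolding smooth_on_def using Ck_on.simps(2) by blast

lemma smooth_on_continuous: "smooth_on S f \<Longrightarrow> continuous_on S f"
  unfolding smooth_on_def using Ck_on.simps(1) by blast

lemma smooth_on_subset: "S \<subseteq> T \<Longrightarrow> smooth_on T f \<Longrightarrow> smooth_on S f"
  unfolding smooth_on_def using Ck_on_subset by blast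

lemma smooth_on_cong: "open S \<Longrightarrow> (\<And>x. x \<in> S \<Longrightarrow> f x = g x) \<Longrightarrow> smooth_on S f \<Longrightarrow> smooth_on S g"
  unfolding smooth_on_def using Ck_on_cong by blast

named_theorems smooth_intros

lemma smooth_on_const [smooth_intros]: "open S \<Longrightarrow> smooth_on S (\<lambda>x. c)"
  by (simp add: smooth_on_def Ck_on_const)

lemma smooth_on_bounded_linear:
  "open S \<Longrightarrow> bounded_linear L \<Longrightarrow> smooth_on S f \<Longrightarrow> smooth_on S (\<lambda>x. L (f x))"
  by (simp add: smooth_on_def Ck_on_bounded_linear_compose)

lemma smooth_on_bilinear:
  "open S \<Longrightarrow> bounded_bilinear B \<Longrightarrow> smooth_on S f \<Longrightarrow> smooth_on S g \<Longrightarrow> smooth_on S (\<lambda>x. B (f x) (g x))"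
  by (simp add: smooth_on_def Ck_on_bilinear)

lemma smooth_on_add [smooth_intros]:
  "open S \<Longrightarrow> smooth_on S f \<Longrightarrow> smooth_on S g \<Longrightarrow> smooth_on S (\<lambda>x. f x + g x)"
  by (simp add: smooth_on_def Ck_on_add)

lemma smooth_on_scaleR [smooth_intros]:
  "open S \<Longrightarrow> smooth_on S f \<Longrightarrow> smooth_on S g \<Longrightarrow> smooth_on S (\<lambda>x. f x *\<^sub>R g x)"
  by (rule smooth_on_bilinear[OF _ bounded_bilinear_scaleR])

lemma smooth_on_mult [smooth_intros]:
  fixes f g :: "'a::real_normed_vector \<Rightarrow> real"
  shows "open S \<Longrightarrow> smooth_on S f \<Longrightarrow> smooth_on S g \<Longrightarrow> smooth_on S (\<lambda>x. f x * g x)"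
  by (rule smooth_on_bilinear[OF _ bounded_bilinear_mult])

lemma smooth_on_minus [smooth_intros]: "open S \<Longrightarrow> smooth_on S f \<Longrightarrow> smooth_on S (\<lambda>x. - f x)"
  by (rule smooth_on_bounded_linear[OF _ bounded_linear_minus[OF bounded_linear_ident]])

lemma smooth_on_diff [smooth_intros]:
  "open S \<Longrightarrow> smooth_on S f \<Longrightarrow> smooth_on S g \<Longrightarrow> smooth_on S (\<lambda>x. f x - g x)"
  using smooth_on_add[of S f "\<lambda>x. - g x"] smooth_on_minus[of S g] by simp

lemma smooth_on_sum [smooth_intros]:
  "open S \<Longrightarrow> (\<And>i. i \<in> I \<Longrightarrow> smooth_on S (f i)) \<Longrightarrow> smooth_on S (\<lambda>x. \<Sum>i\<in>I. f i x)"
  by (simp add: smooth_on_def Ck_on_sum)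

lemma smooth_on_prod [smooth_intros]:
  fixes f :: "'i \<Rightarrow> 'a::real_normed_vector \<Rightarrow> real"
  shows "open S \<Longrightarrow> (\<And>i. i \<in> I \<Longrightarrow> smooth_on S (f i)) \<Longrightarrow> smooth_on S (\<lambda>x. \<Prod>i\<in>I. f i x)"
  by (induction I rule: infinite_finite_induct) (auto intro: smooth_intros)

lemma smooth_on_inverse [smooth_intros]:
  fixes f :: "'a::real_normed_vector \<Rightarrow> real"
  shows "open S \<Longrightarrow> smooth_on S f \<Longrightarrow> (\<And>x. x \<in> S \<Longrightarrow> f x \<noteq> 0) \<Longrightarrow> smooth_on S (\<lambda>x. inverse (f x))"
  by (simp add: smooth_on_def Ck_on_inverse)

lemma smooth_on_divide [smooth_intros]:
  fixes f g :: "'a::real_normed_vector \<Rightarrow> real"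
  shows "open S \<Longrightarrow> smooth_on S f \<Longrightarrow> smooth_on S g \<Longrightarrow> (\<And>x. x \<in> S \<Longrightarrow> g x \<noteq> 0) \<Longrightarrow> smooth_on S (\<lambda>x. f x / g x)"
  by (simp add: divide_inverse smooth_on_mult smooth_on_inverse)

lemma smooth_on_compose:
  fixes f :: "'a::real_normed_vector \<Rightarrow> 'b::euclidean_space"
  shows "open S \<Longrightarrow> open T \<Longrightarrow> (\<And>x. x \<in> S \<Longrightarrow> f x \<in> T) \<Longrightarrow> smooth_on S f \<Longrightarrow> smooth_on T g \<Longrightarrow>
    smooth_on S (\<lambda>x. g (f x))"
  unfolding smooth_on_def using Ck_on_compose by blast

section \<open>Symmetry of second derivatives\<close>

lemma line_has_real_derivative:
  fixes g :: "'a::real_normed_vector \<Rightarrow> real"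
  assumes "(g has_derivative g') (at (p + u *\<^sub>R X))"
  shows "((\<lambda>u. g (p + u *\<^sub>R X)) has_real_derivative g' X) (at u)"
proof -
  have "((\<lambda>u. p + u *\<^sub>R X) has_derivative (\<lambda>h. h *\<^sub>R X)) (at u)"
    by (auto intro!: derivative_eq_intros)
  from has_derivative_compose[OF this assms]
  show ?thesis using has_derivative_linear[OF assms]
    by (simp add: has_field_derivative_def linear_cmul mult.commute[of _ "g' X"])
qed

text \<open>Two mean value theorems: along \<open>X\<close> for the difference of \<open>g\<close>
  across the edge \<open>Y\<close>, then along \<open>Y\<close> for \<open>dd g _ X\<close>. The
  second difference is symmetric in \<open>X\<close> and \<open>Y\<close>, which
  \<open>clairaut_real\<close> exploits by applying this twice.\<close>

lemma second_difference_mvt: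
  fixes g :: "'a::real_normed_vector \<Rightarrow> real"
  assumes S: "open S" "smooth_on S g" and a: "0 < a"
    and mem: "\<And>u v. \<lbrakk>0 \<le> u; u \<le> a; 0 \<le> v; v \<le> a\<rbrakk> \<Longrightarrow> x + u *\<^sub>R X + v *\<^sub>R Y \<in> S"
  obtains u v where "0 < u" "u < a" "0 < v" "v < a"
    "g (x + a *\<^sub>R X + a *\<^sub>R Y) - g (x + a *\<^sub>R X) - g (x + a *\<^sub>R Y) + g x
      = a\<^sup>2 * dd (\<lambda>y. dd g y X) (x + u *\<^sub>R X + v *\<^sub>R Y) Y"
proof -
  note d = smooth_on_has_derivative[OF S] and d2 = smooth_on_has_derivative[OF S(1) smooth_on_dd[OF S(2), of X]]
  have "\<exists>u. 0 < u \<and> u < a \<and>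
    (g ((x + a *\<^sub>R Y) + a *\<^sub>R X) - g (x + a *\<^sub>R X)) - (g ((x + a *\<^sub>R Y) + 0 *\<^sub>R X) - g (x + 0 *\<^sub>R X))
      = (a - 0) * (dd g ((x + a *\<^sub>R Y) + u *\<^sub>R X) X - dd g (x + u *\<^sub>R X) X)"
  proof (rule MVT2[OF a])
    fix u assume u: "0 \<le> u" "u \<le> a"
    have "x + a *\<^sub>R Y + u *\<^sub>R X \<in> S" "x + u *\<^sub>R X \<in> S"
      using mem[of u a] mem[of u 0] u a by (auto simp: algebra_simps)
    then show "((\<lambda>u. g ((x + a *\<^sub>R Y) + u *\<^sub>R X) - g (x + u *\<^sub>R X)) has_real_derivative
      dd g ((x + a *\<^sub>R Y) + u *\<^sub>R X) X - dd g (x + u *\<^sub>R X) X) (at u)"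
      by (intro DERIV_diff line_has_real_derivative d)
  qed
  then obtain u where u: "0 < u" "u < a"
    and 1: "g (x + a *\<^sub>R X + a *\<^sub>R Y) - g (x + a *\<^sub>R X) - g (x + a *\<^sub>R Y) + g x
      = a * (dd g (x + u *\<^sub>R X + a *\<^sub>R Y) X - dd g (x + u *\<^sub>R X) X)"
    by (auto simp: algebra_simps)
  have "\<exists>v. 0 < v \<and> v < a \<and> dd g ((x + u *\<^sub>R X) + a *\<^sub>R Y) X - dd g ((x + u *\<^sub>R X) + 0 *\<^sub>R Y) X
      = (a - 0) * dd (\<lambda>y. dd g y X) ((x + u *\<^sub>R X) + v *\<^sub>R Y) Y"
  proof (rule MVT2[OF a])
    fix v assume v: "0 \<le> v" "v \<le> a"
    show "((\<lambda>v. dd g ((x + u *\<^sub>R X) + v *\<^sub>R Y) X) has_real_derivative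
      dd (\<lambda>y. dd g y X) ((x + u *\<^sub>R X) + v *\<^sub>R Y) Y) (at v)"
      using mem[of u v] u v by (intro line_has_real_derivative d2) auto
  qed
  then obtain v where v: "0 < v" "v < a" "dd g (x + u *\<^sub>R X + a *\<^sub>R Y) X - dd g (x + u *\<^sub>R X) X
      = a * dd (\<lambda>y. dd g y X) (x + u *\<^sub>R X + v *\<^sub>R Y) Y" by auto
  show ?thesis by (rule that[OF u v(1,2)]) (simp add: 1 v(3) power2_eq_square)
qed

lemma clairaut_real:
  fixes g :: "'a::real_normed_vector \<Rightarrow> real"
  assumes S: "open S" "smooth_on S g" "x \<in> S"
  shows "dd (\<lambda>y. dd g y Y) x X = dd (\<lambda>y. dd g y X) x Y"
proof (rule ccontr)
  define P where "P y = dd (\<lambda>y. dd g y X) y Y" for y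
  define Q where "Q y = dd (\<lambda>y. dd g y Y) y X" for y
  assume "\<not> ?thesis"
  then have e: "\<bar>P x - Q x\<bar> / 2 > 0" unfolding P_def Q_def by auto
  have "continuous_on S P" "continuous_on S Q" unfolding P_def Q_def
    by (intro smooth_on_continuous smooth_on_dd S)+
  then have "isCont P x" "isCont Q x" using S continuous_on_eq_continuous_at by blast+
  then obtain d1 d2 where d12: "d1 > 0" "\<forall>y. dist y x < d1 \<longrightarrow> dist (P y) (P x) < \<bar>P x - Q x\<bar> / 2"
    "d2 > 0" "\<forall>y. dist y x < d2 \<longrightarrow> dist (Q y) (Q x) < \<bar>P x - Q x\<bar> / 2"
    using e unfolding continuous_at_eps_delta by blast
  obtain d0 where d0: "d0 > 0" "ball x d0 \<subseteq> S" using S openE by blast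
  define d where "d = min d0 (min d1 d2)"
  \<comment> \<open>Keeps the whole parallelogram spanned by the scaled \<open>X\<close> and
    \<open>Y\<close> within \<open>d / 2\<close> of \<open>x\<close>; the summand 1 covers the case
    that both vectors vanish.\<close>
  define a where "a = d / (2 * (norm X + norm Y + 1))"
  have n: "norm X + norm Y + 1 > 0" by (smt (verit) norm_ge_zero)
  have dpos: "d > 0" using d12 d0 unfolding d_def by auto
  then have a: "a > 0" unfolding a_def using n by simp
  have near: "dist (x + u *\<^sub>R X + v *\<^sub>R Y) x < d" if "0 \<le> u" "u \<le> a" "0 \<le> v" "v \<le> a" for u v
  proof -
    have "dist (x + u *\<^sub>R X + v *\<^sub>R Y) x = norm (u *\<^sub>R X + v *\<^sub>R Y)" by (simp add: dist_norm)
    also have "\<dots> \<le> u * norm X + v * norm Y" using that norm_triangle_ineq[of "u *\<^sub>R X" "v *\<^sub>R Y"] by simp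
    also have "\<dots> \<le> a * norm X + a * norm Y" using that by (intro add_mono mult_right_mono) auto
    also have "\<dots> \<le> a * (norm X + norm Y + 1)" using a by (simp add: algebra_simps)
    also have "\<dots> = d / 2" unfolding a_def using n by (simp add: divide_simps)
    finally show ?thesis using dpos by simp
  qed
  have mem: "x + u *\<^sub>R X + v *\<^sub>R Y \<in> S" if "0 \<le> u" "u \<le> a" "0 \<le> v" "v \<le> a" for u v
    using near[OF that] d0 unfolding d_def by (auto simp: dist_commute subset_iff)
  have mem': "x + u *\<^sub>R Y + v *\<^sub>R X \<in> S" if "0 \<le> u" "u \<le> a" "0 \<le> v" "v \<le> a" for u v
    using mem[OF that(3,4,1,2)] by (simp add: algebra_simps)
  obtain u v where uv: "0 < u" "u < a" "0 < v" "v < a"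
    "g (x + a *\<^sub>R X + a *\<^sub>R Y) - g (x + a *\<^sub>R X) - g (x + a *\<^sub>R Y) + g x = a\<^sup>2 * P (x + u *\<^sub>R X + v *\<^sub>R Y)"
    unfolding P_def by (rule second_difference_mvt[OF S(1,2) a mem])
  obtain u' v' where uv': "0 < u'" "u' < a" "0 < v'" "v' < a"
    "g (x + a *\<^sub>R Y + a *\<^sub>R X) - g (x + a *\<^sub>R Y) - g (x + a *\<^sub>R X) + g x = a\<^sup>2 * Q (x + u' *\<^sub>R Y + v' *\<^sub>R X)"
    unfolding Q_def by (rule second_difference_mvt[OF S(1,2) a mem'])
  have "a\<^sup>2 * P (x + u *\<^sub>R X + v *\<^sub>R Y) = a\<^sup>2 * Q (x + v' *\<^sub>R X + u' *\<^sub>R Y)"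
    using uv(5) uv'(5) by (simp add: algebra_simps)
  then have "P (x + u *\<^sub>R X + v *\<^sub>R Y) = Q (x + v' *\<^sub>R X + u' *\<^sub>R Y)" using a by simp
  moreover have "dist (P (x + u *\<^sub>R X + v *\<^sub>R Y)) (P x) < \<bar>P x - Q x\<bar> / 2"
    "dist (Q (x + v' *\<^sub>R X + u' *\<^sub>R Y)) (Q x) < \<bar>P x - Q x\<bar> / 2"
    using near[of u v] near[of v' u'] uv uv' d12 unfolding d_def by auto
  ultimately show False by (simp add: dist_real_def abs_if split: if_splits)
qed

lemma clairaut:
  fixes f :: "'a::real_normed_vector \<Rightarrow> 'b::euclidean_space"
  assumes S: "open S" "smooth_on S f" "x \<in> S"
  shows "dd (\<lambda>y. dd f y Y) x X = dd (\<lambda>y. dd f y X) x Y"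
proof (rule euclidean_eqI)
  fix b :: 'b assume "b \<in> Basis"
  have inn: "dd (\<lambda>y. F y \<bullet> b) z Z = dd F z Z \<bullet> b" if "smooth_on S F" "z \<in> S" for F :: "'a \<Rightarrow> 'b" and z Z
    by (rule dd_eqI) (use smooth_on_has_derivative[OF S(1) that] in \<open>auto intro!: derivative_eq_intros\<close>)
  have "dd (\<lambda>y. dd (\<lambda>y. f y \<bullet> b) y Y) x X = dd (\<lambda>y. dd (\<lambda>y. f y \<bullet> b) y X) x Y" for X Y
    by (intro clairaut_real[OF S(1) _ S(3)] smooth_on_bounded_linear[OF S(1) bounded_linear_inner_left] S)
  moreover have "dd (\<lambda>y. dd (\<lambda>y. f y \<bullet> b) y Y) x X = dd (\<lambda>y. dd f y Y) x X \<bullet> b" for X Y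
  proof -
    have "dd (\<lambda>y. dd (\<lambda>y. f y \<bullet> b) y Y) x X = dd (\<lambda>y. dd f y Y \<bullet> b) x X"
      by (subst dd_cong_open[OF S(1,3)]) (auto simp: inn S)
    then show ?thesis using inn[OF smooth_on_dd[OF S(2)] S(3)] by simp
  qed
  ultimately show "dd (\<lambda>y. dd f y Y) x X \<bullet> b = dd (\<lambda>y. dd f y X) x Y \<bullet> b" by metis
qed

subsection \<open>Derivatives along vector fields\<close>

abbreviation d2 :: "('a::real_normed_vector \<Rightarrow> 'b::real_normed_vector) \<Rightarrow> 'a \<Rightarrow> 'a \<Rightarrow> 'a \<Rightarrow> 'b"
  where "d2 f x X Y \<equiv> dd (\<lambda>y. dd f y Y) x X"

lemma smooth_on_linear_dd: "open S \<Longrightarrow> smooth_on S f \<Longrightarrow> x \<in> S \<Longrightarrow> linear (dd f x)"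
  using smooth_on_has_derivative has_derivative_linear by blast

lemma linear_vec_expansion:
  fixes l :: "real ^ 'm::finite \<Rightarrow> 'v::real_vector"
  assumes "linear l"
  shows "l X = (\<Sum>i\<in>UNIV. (X $ i) *\<^sub>R l (axis i 1))"
proof -
  have "X = (\<Sum>i\<in>UNIV. (X $ i) *\<^sub>R axis i 1)"
    by (simp add: vec_eq_iff axis_def if_distrib cong: if_cong)
  then have "l X = l (\<Sum>i\<in>UNIV. (X $ i) *\<^sub>R axis i 1)" by simp
  then show ?thesis using assms by (simp add: linear_sum linear_cmul)
qed

lemma d2_linear2:
  assumes "open S" "smooth_on S f" "x \<in> S"
  shows "linear (d2 f x X)"
proof
  note d = smooth_on_has_derivative[OF assms(1) smooth_on_dd[OF assms(2)] assms(3)]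
  note l = smooth_on_linear_dd[OF assms(1,2)]
  show "d2 f x X (Y + Z) = d2 f x X Y + d2 f x X Z" for Y Z
  proof -
    have "d2 f x X (Y + Z) = dd (\<lambda>y. dd f y Y + dd f y Z) x X"
      by (subst dd_cong_open[OF assms(1,3)]) (auto simp: linear_add l)
    also have "\<dots> = d2 f x X Y + d2 f x X Z"
      by (rule dd_eqI) (intro has_derivative_add d)
    finally show ?thesis .
  qed
  show "d2 f x X (c *\<^sub>R Y) = c *\<^sub>R d2 f x X Y" for c Y
  proof -
    have "d2 f x X (c *\<^sub>R Y) = dd (\<lambda>y. c *\<^sub>R dd f y Y) x X"
      by (subst dd_cong_open[OF assms(1,3)]) (auto simp: linear_cmul l)
    also have "\<dots> = c *\<^sub>R d2 f x X Y"
      by (rule dd_eqI) (intro has_derivative_scaleR_right d)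
    finally show ?thesis .
  qed
qed

lemma d2_linear1:
  assumes "open S" "smooth_on S f" "x \<in> S"
  shows "linear (\<lambda>X. d2 f x X Y)"
  using smooth_on_linear_dd[OF assms(1) smooth_on_dd[OF assms(2)] assms(3)] .

lemma d2_bilinear: "open S \<Longrightarrow> smooth_on S f \<Longrightarrow> x \<in> S \<Longrightarrow> bilinear (d2 f x)"
  unfolding bilinear_def using d2_linear1 d2_linear2 by metis

text \<open>Product rule for a derivative along a moving direction: one term from moving the base
  point, one from the change of the direction. Coordinates are used because \<open>dd f\<close> is
  known to be differentiable only for each fixed direction.\<close>

lemma has_derivative_dd_field:
  fixes f :: "real ^ 'm::finite \<Rightarrow> 'v::real_normed_vector"
  assumes "open S" "smooth_on S f" "x \<in> S" "(W has_derivative W') (at x)"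
  shows "((\<lambda>y. dd f y (W y)) has_derivative (\<lambda>X. d2 f x X (W x) + dd f x (W' X))) (at x)"
proof -
  note d = smooth_on_has_derivative[OF assms(1) smooth_on_dd[OF assms(2)] assms(3)]
  have "((\<lambda>y. \<Sum>i\<in>UNIV. (W y $ i) *\<^sub>R dd f y (axis i 1)) has_derivative
    (\<lambda>X. \<Sum>i\<in>UNIV. (W x $ i) *\<^sub>R d2 f x X (axis i 1) + (W' X $ i) *\<^sub>R dd f x (axis i 1))) (at x)"
    by (intro has_derivative_sum has_derivative_scaleR d
        bounded_linear.has_derivative[OF bounded_linear_vec_nth assms(4)])
  moreover have "(\<Sum>i\<in>UNIV. (W x $ i) *\<^sub>R d2 f x X (axis i 1) + (W' X $ i) *\<^sub>R dd f x (axis i 1))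
    = d2 f x X (W x) + dd f x (W' X)" for X
    using linear_vec_expansion[OF d2_linear2[OF assms(1-3), of X], of "W x"]
      linear_vec_expansion[OF smooth_on_linear_dd[OF assms(1-3)], of "W' X"]
    by (simp add: sum.distrib)
  ultimately have "((\<lambda>y. \<Sum>i\<in>UNIV. (W y $ i) *\<^sub>R dd f y (axis i 1)) has_derivative
    (\<lambda>X. d2 f x X (W x) + dd f x (W' X))) (at x)" by simp
  then show ?thesis
    by (rule has_derivative_transform_within_open[OF _ assms(1,3)])
      (use linear_vec_expansion[OF smooth_on_linear_dd[OF assms(1,2)]] in \<open>rule sym\<close>)
qed

lemma smooth_on_vec_nth: "open S \<Longrightarrow> smooth_on S f \<Longrightarrow> smooth_on S (\<lambda>x. f x $ i)"
  by (rule smooth_on_bounded_linear[OF _ bounded_linear_vec_nth])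

lemma smooth_on_vec:
  fixes f :: "'a::real_normed_vector \<Rightarrow> real ^ 'm::finite"
  assumes "open S" "\<And>i. smooth_on S (\<lambda>x. f x $ i)"
  shows "smooth_on S f"
proof (rule smooth_on_cong[OF assms(1)])
  show "smooth_on S (\<lambda>x. \<Sum>i\<in>UNIV. (f x $ i) *\<^sub>R axis i (1::real))"
    using assms by (intro smooth_on_sum smooth_on_scaleR smooth_on_const)
qed (simp add: vec_eq_iff axis_def if_distrib cong: if_cong)

lemma smooth_on_linear_field:
  fixes l :: "'a::real_normed_vector \<Rightarrow> real ^ 'm::finite \<Rightarrow> 'v::real_normed_vector"
  assumes "open S" "\<And>x. x \<in> S \<Longrightarrow> linear (l x)" "\<And>X. smooth_on S (\<lambda>x. l x X)" "smooth_on S W"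
  shows "smooth_on S (\<lambda>x. l x (W x))"
proof (rule smooth_on_cong[OF assms(1)])
  show "smooth_on S (\<lambda>x. \<Sum>i\<in>UNIV. (W x $ i) *\<^sub>R l x (axis i 1))"
    using assms by (intro smooth_intros smooth_on_vec_nth)
qed (use linear_vec_expansion[OF assms(2)] in \<open>rule sym\<close>)

lemma smooth_on_dd_field [smooth_intros]:
  fixes f :: "real ^ 'm::finite \<Rightarrow> 'v::real_normed_vector"
  assumes "open S" "smooth_on S f" "smooth_on S W"
  shows "smooth_on S (\<lambda>y. dd f y (W y))"
  by (rule smooth_on_linear_field[OF assms(1) smooth_on_linear_dd smooth_on_dd]) (use assms in auto)

subsection \<open>Inner products on \<open>\<real>\<^sup>m\<close>\<close>

definition pos_form :: "(real ^ 'm::finite \<Rightarrow> real ^ 'm \<Rightarrow> real) \<Rightarrow> bool"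
  where "pos_form h \<longleftrightarrow> bilinear h \<and> (\<forall>X Y. h X Y = h Y X) \<and> (\<forall>X. X \<noteq> 0 \<longrightarrow> h X X > 0)"

text \<open>Index raising with respect to an inner product. Christoffel maps, gradients and shape
  operators are all of this kind.\<close>

definition raise :: "(real ^ 'm::finite \<Rightarrow> real ^ 'm \<Rightarrow> real) \<Rightarrow> (real ^ 'm \<Rightarrow> real) \<Rightarrow> real ^ 'm"
  where "raise h l = (THE W. \<forall>Z. h W Z = l Z)"

lemma pos_formD:
  assumes "pos_form h"
  shows "bilinear h" "h X Y = h Y X" "X \<noteq> 0 \<Longrightarrow> h X X > 0" "linear (h X)" "linear (\<lambda>X. h X Y)"
  using assms unfolding pos_form_def bilinear_def by auto

lemma pos_form_eqI:
  assumes "pos_form h" "\<And>Z. h W Z = h W' Z"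
  shows "W = W'"
proof (rule ccontr)
  assume "W \<noteq> W'"
  then have "h (W - W') (W - W') > 0" using pos_formD(3)[OF assms(1)] by simp
  moreover have "h (W - W') (W - W') = 0"
    using assms(2)[of "W - W'"] linear_diff[OF pos_formD(5)[OF assms(1), of "W - W'"], of W W'] by simp
  ultimately show False by simp
qed

text \<open>A vector in the kernel of the Gram matrix is \<open>h\<close>-orthogonal to every
  coordinate vector, hence to itself.\<close>

lemma det_gram_nonzero:
  fixes h :: "real ^ 'm::finite \<Rightarrow> real ^ 'm \<Rightarrow> real"
  assumes "pos_form h"
  shows "det (\<chi> i j. h (axis i 1) (axis j 1)) \<noteq> 0"
    and "((\<chi> i j. h (axis i 1) (axis j 1)) *v W) $ k = h W (axis k 1)"
proof -
  have 1: "((\<chi> i j. h (axis i 1) (axis j 1)) *v W) $ k = h W (axis k 1)" for W k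
  proof -
    have "h W (axis k 1) = (\<Sum>i\<in>UNIV. (W $ i) * h (axis i 1) (axis k 1))"
      using linear_vec_expansion[OF pos_formD(5)[OF assms, of "axis k 1"], of W] by simp
    then show ?thesis using pos_formD(2)[OF assms]
      by (simp add: matrix_vector_mult_def mult.commute)
  qed
  then show "((\<chi> i j. h (axis i 1) (axis j 1)) *v W) $ k = h W (axis k 1)" .
  have "W = 0" if "(\<chi> i j. h (axis i 1) (axis j 1)) *v W = 0" for W
  proof (rule pos_form_eqI[OF assms])
    fix Z
    have "h W (axis k 1) = 0" for k using 1[of W k] that by simp
    then have "h W Z = 0" using linear_vec_expansion[OF pos_formD(4)[OF assms, of W], of Z] by simp
    then show "h W Z = h 0 Z" using linear_0[OF pos_formD(5)[OF assms]] by simp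
  qed
  then have "invertible (\<chi> i j. h (axis i 1) (axis j 1))"
    using invertible_left_inverse matrix_left_invertible_ker by blast
  then show "det (\<chi> i j. h (axis i 1) (axis j 1)) \<noteq> 0" using invertible_det_nz by blast
qed

lemma raise_unique:
  assumes "pos_form h" "\<And>Z. h W Z = l Z"
  shows "raise h l = W"
  unfolding raise_def using assms pos_form_eqI[OF assms(1)] by (intro the_equality) auto

text \<open>Cramer's rule gives existence and at the same time a rational formula in the entries of
  \<open>h\<close> and \<open>l\<close>; the latter makes \<open>raise\<close> depend smoothly on
  parameters.\<close>

lemma raise_cramer:
  fixes h :: "real ^ 'm::finite \<Rightarrow> real ^ 'm \<Rightarrow> real"
  assumes h: "pos_form h" and l: "linear l"
  shows "h (raise h l) Z = l Z"
    and "raise h l $ k = det (\<chi> i j. if j = k then l (axis i 1) else h (axis i 1) (axis j 1)) /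
      det (\<chi> i j. h (axis i 1) (axis j 1))"
proof -
  let ?G = "\<chi> i j. h (axis i 1) (axis j 1)"
  define W where "W = (\<chi> k. det (\<chi> i j. if j = k then l (axis i 1) else h (axis i 1) (axis j 1)) / det ?G)"
  have "?G *v W = (\<chi> i. l (axis i 1))"
    using cramer[OF det_gram_nonzero(1)[OF h], of W "\<chi> i. l (axis i 1)"] unfolding W_def by (simp cong: if_cong)
  then have "h W (axis k 1) = l (axis k 1)" for k
    using det_gram_nonzero(2)[OF h, of W k] by simp
  then have hW: "h W Z = l Z" for Z
    using linear_vec_expansion[OF pos_formD(4)[OF h, of W], of Z] linear_vec_expansion[OF l, of Z] by simp
  then have "raise h l = W" by (rule raise_unique[OF h])
  then show "h (raise h l) Z = l Z"
    "raise h l $ k = det (\<chi> i j. if j = k then l (axis i 1) else h (axis i 1) (axis j 1)) / det ?G"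
    using hW by (simp_all add: W_def)
qed

lemma smooth_on_det:
  fixes M :: "'a::real_normed_vector \<Rightarrow> real ^ 'm::finite ^ 'm"
  assumes "open S" "\<And>i j. smooth_on S (\<lambda>x. M x $ i $ j)"
  shows "smooth_on S (\<lambda>x. det (M x))"
  unfolding det_def using assms by (intro smooth_on_sum smooth_on_mult smooth_on_const smooth_on_prod) auto

lemma smooth_on_raise [smooth_intros]:
  fixes h :: "'a::real_normed_vector \<Rightarrow> real ^ 'm::finite \<Rightarrow> real ^ 'm \<Rightarrow> real"
  assumes S: "open S" and h: "\<And>x. x \<in> S \<Longrightarrow> pos_form (h x)" "\<And>X Y. smooth_on S (\<lambda>x. h x X Y)"
    and l: "\<And>x. x \<in> S \<Longrightarrow> linear (l x)" "\<And>X. smooth_on S (\<lambda>x. l x X)"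
  shows "smooth_on S (\<lambda>x. raise (h x) (l x))"
proof (rule smooth_on_vec[OF S])
  fix k
  show "smooth_on S (\<lambda>x. raise (h x) (l x) $ k)"
  proof (rule smooth_on_cong[OF S])
    show "smooth_on S (\<lambda>x. det (\<chi> i j. if j = k then l x (axis i 1) else h x (axis i 1) (axis j 1)) /
      det (\<chi> i j. h x (axis i 1) (axis j 1)))"
    proof (intro smooth_on_divide smooth_on_det S)
      show "smooth_on S (\<lambda>x. (\<chi> i j. if j = k then l x (axis i 1) else h x (axis i 1) (axis j 1)) $ i $ j)" for i j
        by (cases "j = k") (simp_all add: h l)
    qed (use h det_gram_nonzero in auto)
  qed (use raise_cramer(2)[OF h(1) l(1)] in \<open>rule sym\<close>)
qed

section \<open>Linear total differential equations\<close>

lemma norm_linear_Basis_le: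
  fixes l :: "'a::euclidean_space \<Rightarrow> 'v::real_normed_vector"
  assumes "linear l" "\<And>b. b \<in> Basis \<Longrightarrow> norm (l b) \<le> C"
  shows "norm (l x) \<le> real DIM('a) * C * norm x"
proof -
  have "norm (l x) = norm (\<Sum>b\<in>Basis. (x \<bullet> b) *\<^sub>R l b)"
    using linear_sum[OF assms(1)] linear_cmul[OF assms(1)]
    by (metis (no_types, lifting) euclidean_representation sum.cong)
  also have "\<dots> \<le> (\<Sum>b\<in>(Basis::'a set). norm x * C)"
    by (rule sum_norm_le) (auto intro!: mult_mono assms(2) Basis_le_norm)
  finally show ?thesis by (simp add: mult.commute mult.left_commute)
qed

lemma smooth_on_bounded_basis:
  fixes f :: "'a::euclidean_space \<Rightarrow> 'v::real_normed_vector"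
  assumes "smooth_on S f" "compact T" "T \<subseteq> S"
  obtains C where "C \<ge> 0" "\<And>x b. x \<in> T \<Longrightarrow> b \<in> Basis \<Longrightarrow> norm (dd f x b) \<le> C"
proof -
  have "\<exists>c. \<forall>x\<in>T. norm (dd f x b) \<le> c" for b
  proof -
    have "continuous_on T (\<lambda>x. dd f x b)"
      using smooth_on_continuous[OF smooth_on_dd[OF assms(1)]] assms(3) continuous_on_subset by blast
    from compact_imp_bounded[OF compact_continuous_image[OF this assms(2)]]
    show ?thesis unfolding bounded_iff by auto
  qed
  then obtain c where c: "\<And>x b. x \<in> T \<Longrightarrow> norm (dd f x b) \<le> c b" by metis
  show ?thesis
  proof (rule that)
    show "0 \<le> (\<Sum>b\<in>Basis. \<bar>c b\<bar>)" by (simp add: sum_nonneg)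
    show "norm (dd f x b) \<le> (\<Sum>b\<in>Basis. \<bar>c b\<bar>)" if "x \<in> T" "b \<in> Basis" for x b
    proof -
      have "norm (dd f x b) \<le> \<bar>c b\<bar>" using c[OF that(1), of b] by linarith
      also have "\<dots> \<le> (\<Sum>b\<in>Basis. \<bar>c b\<bar>)" by (rule member_le_sum) (use that in auto)
      finally show ?thesis .
    qed
  qed
qed

lemma smooth_on_lipschitz:
  fixes f :: "'a::euclidean_space \<Rightarrow> 'v::real_normed_vector"
  assumes "open S" "smooth_on S f" "compact T" "convex T" "T \<subseteq> S"
  obtains L where "L \<ge> 0" "\<And>x y. x \<in> T \<Longrightarrow> y \<in> T \<Longrightarrow> norm (f y - f x) \<le> L * norm (y - x)"
proof -
  obtain C where C: "C \<ge> 0" "\<And>x b. x \<in> T \<Longrightarrow> b \<in> Basis \<Longrightarrow> norm (dd f x b) \<le> C"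
    using smooth_on_bounded_basis[OF assms(2,3,5)] by metis
  have d: "(f has_derivative dd f x) (at x within T)" if "x \<in> T" for x
    using smooth_on_has_derivative[OF assms(1,2)] that assms(5) has_derivative_at_withinI by blast
  have "norm (f y - f x) \<le> (DIM('a) * C) * norm (y - x)" if "x \<in> T" "y \<in> T" for x y
  proof (rule differentiable_bound[OF assms(4) d])
    show "onorm (dd f z) \<le> DIM('a) * C" if "z \<in> T" for z
      by (rule onorm_le, rule norm_linear_Basis_le) (use C that has_derivative_linear[OF d] in auto)
  qed (use that in auto)
  then show ?thesis using that C(1) by (metis mult_nonneg_nonneg of_nat_0_le_iff)
qed

text \<open>The derivative is Lipschitz in each basis direction, and the mean value inequality for
  the linearization along a segment turns this into a remainder of second order with one constant
  for all of \<open>T\<close>.\<close>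

lemma smooth_on_taylor:
  fixes f :: "'a::euclidean_space \<Rightarrow> 'v::real_normed_vector"
  assumes "open S" "smooth_on S f" "compact T" "convex T" "T \<subseteq> S"
  obtains L where "L \<ge> 0"
    "\<And>x y. x \<in> T \<Longrightarrow> y \<in> T \<Longrightarrow> norm (f y - f x - dd f x (y - x)) \<le> L * (norm (y - x))\<^sup>2"
proof -
  have "\<exists>L\<ge>0. \<forall>x\<in>T. \<forall>y\<in>T. norm (dd f y b - dd f x b) \<le> L * norm (y - x)" for b
    using smooth_on_lipschitz[OF assms(1) smooth_on_dd[OF assms(2)] assms(3-5)] by metis
  then obtain K where K: "\<And>b. K b \<ge> 0"
    "\<And>b x y. x \<in> T \<Longrightarrow> y \<in> T \<Longrightarrow> norm (dd f y b - dd f x b) \<le> K b * norm (y - x)" by metis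
  define K' where "K' = (\<Sum>b\<in>(Basis::'a set). K b)"
  have K': "norm (dd f y b - dd f x b) \<le> K' * norm (y - x)" if "x \<in> T" "y \<in> T" "b \<in> Basis" for x y b
  proof -
    have "K b \<le> K'" unfolding K'_def by (rule member_le_sum) (use that K in auto)
    then show ?thesis using K(2)[OF that(1,2), of b] by (meson mult_right_mono norm_ge_zero order_trans)
  qed
  have d: "(f has_derivative dd f x) (at x)" if "x \<in> T" for x
    using smooth_on_has_derivative[OF assms(1,2)] that assms(5) by blast
  have "norm (f y - f x - dd f x (y - x)) \<le> (DIM('a) * K') * (norm (y - x))\<^sup>2" if xy: "x \<in> T" "y \<in> T" for x y
  proof -
    have seg: "closed_segment x y \<subseteq> T" using xy assms(4) by (simp add: closed_segment_subset)
    have "norm (f y - f x - dd f x (y - x)) \<le> norm (y - x) * (DIM('a) * (K' * norm (y - x)))"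
    proof (rule differentiable_bound_linearization[where S = "closed_segment x y"])
      show "x + t *\<^sub>R (y - x) \<in> closed_segment x y" if "t \<in> {0..1}" for t
        using that by (auto simp: closed_segment_def algebra_simps intro!: exI[of _ t])
      show "(f has_derivative dd f z) (at z within closed_segment x y)" if "z \<in> closed_segment x y" for z
        using d seg that has_derivative_at_withinI by blast
      show "onorm (dd f z - dd f x) \<le> DIM('a) * (K' * norm (y - x))" if z: "z \<in> closed_segment x y" for z
      proof (rule onorm_le)
        fix h
        have zx: "norm (z - x) \<le> norm (y - x)" using segment_bound(1)[OF z] .
        have "0 \<le> K'" unfolding K'_def using K by (simp add: sum_nonneg)
        have lin: "linear (\<lambda>h. dd f z h - dd f x h)"
          using d z seg xy by (intro linear_compose_sub has_derivative_linear) auto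
        have "norm (dd f z b - dd f x b) \<le> K' * norm (y - x)" if "b \<in> Basis" for b
          using K'[of x z b] z seg xy that zx \<open>0 \<le> K'\<close>
          by (meson mult_left_mono order_trans subsetD)
        from norm_linear_Basis_le[OF lin this]
        show "norm ((dd f z - dd f x) h) \<le> DIM('a) * (K' * norm (y - x)) * norm h" by simp
      qed
    qed auto
    then show ?thesis by (simp add: power2_eq_square algebra_simps)
  qed
  moreover have "DIM('a) * K' \<ge> 0" unfolding K'_def using K by (simp add: sum_nonneg)
  ultimately show ?thesis using that by blast
qed

text \<open>The equations along all rays are solved at once, as a single fixed point among bounded
  continuous functions, so that continuity in the direction of the ray is part of the solution. The
  contraction factor is bounded by \<open>M * r\<close>, hence by 1/2.\<close>

lemma radial_transport:
  fixes A :: "'a::euclidean_space \<Rightarrow> ('a \<Rightarrow>\<^sub>L ('b::euclidean_space \<Rightarrow>\<^sub>L 'b))"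
  assumes r: "r > 0" and cont: "continuous_on (cball x0 r) A"
    and M: "\<And>x. x \<in> cball x0 r \<Longrightarrow> norm (A x) \<le> M" "M * r \<le> 1 / 2"
  obtains \<Phi> where "continuous_on (cball x0 r) \<Phi>" "\<Phi> x0 = c"
    "\<And>z t. norm z \<le> r \<Longrightarrow> t \<in> {0..1} \<Longrightarrow>
      ((\<lambda>t. \<Phi> (x0 + t *\<^sub>R z)) has_vector_derivative
        A (x0 + t *\<^sub>R z) z (\<Phi> (x0 + t *\<^sub>R z))) (at t within {0..1})"
proof -
  \<comment> \<open>Retraction of displacements to the closed ball. It extends the fixed point
    problem to functions on the whole space and changes nothing on
    \<open>cball x0 r\<close>.\<close>
  define \<rho> where "\<rho> x = closest_point (cball 0 r) (x - x0)" for x :: 'a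
  have \<rho>: "norm (\<rho> x) \<le> r" for x
    using closest_point_in_set[of "cball 0 r" "x - x0"] r unfolding \<rho>_def by simp
  have \<rho>_id: "\<rho> (x0 + z) = z" if "norm z \<le> r" for z
    unfolding \<rho>_def using that by (simp add: closest_point_self)
  have cont_\<rho>: "continuous_on UNIV \<rho>"
  proof -
    have "continuous_on UNIV (closest_point (cball (0::'a) r))"
      by (rule continuous_on_closest_point) (use r in auto)
    then show ?thesis unfolding \<rho>_def
      by (rule continuous_on_compose2) (auto intro!: continuous_intros)
  qed
  have in_ball: "x0 + t *\<^sub>R z \<in> cball x0 r" if "norm z \<le> r" "t \<in> {0..1}" for t :: real and z
  proof -
    have "t * norm z \<le> 1 * r" using that by (intro mult_mono) auto
    then show ?thesis using that by (simp add: dist_norm)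
  qed
  define F where "F f x t = A (x0 + t *\<^sub>R \<rho> x) (\<rho> x) (f (x0 + t *\<^sub>R \<rho> x))" for f :: "'a \<Rightarrow> 'b" and x t
  \<comment> \<open>The integrated transport equation at the end \<open>x\<close> of its ray; the
    values needed inside the ray are values of the same unknown function.\<close>
  define T where "T f x = c + integral (cbox 0 (1::real)) (F f x)" for f x
  have cF: "continuous_on (UNIV \<times> cbox 0 1) (\<lambda>(x, t). F f x t)" if "continuous_on UNIV f" for f
  proof -
    have c1: "continuous_on (UNIV \<times> cbox 0 (1::real)) (\<lambda>p. x0 + snd p *\<^sub>R \<rho> (fst p))"
      by (intro continuous_intros continuous_on_compose2[OF cont_\<rho>]) auto
    have c2: "continuous_on (UNIV \<times> cbox 0 (1::real)) (\<lambda>p. A (x0 + snd p *\<^sub>R \<rho> (fst p)))"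
      by (rule continuous_on_compose2[OF cont c1]) (use in_ball \<rho> in auto)
    have c3: "continuous_on (UNIV \<times> cbox 0 (1::real)) (\<lambda>p. f (x0 + snd p *\<^sub>R \<rho> (fst p)))"
      by (rule continuous_on_compose2[OF that c1]) auto
    have c4: "continuous_on (UNIV \<times> cbox 0 (1::real)) (\<lambda>p. \<rho> (fst p))"
      by (rule continuous_on_compose2[OF cont_\<rho>]) (auto intro: continuous_intros)
    show ?thesis unfolding F_def split_def
      by (intro bounded_bilinear.continuous_on[OF bounded_bilinear_blinfun_apply] c2 c3 c4)
  qed
  have cFx: "continuous_on {0..1} (F f x)" if "continuous_on UNIV f" for f x
  proof -
    have "continuous_on {0..1} (\<lambda>t. case (x, t) of (x, t) \<Rightarrow> F f x t)"
      by (rule continuous_on_compose2[OF cF[OF that]]) (auto intro!: continuous_intros simp: cbox_interval)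
    then show ?thesis by simp
  qed
  have normF: "norm (F f x t) \<le> 1 / 2 * B" if "t \<in> {0..1}" "\<And>y. norm (f y) \<le> B" for f x t B
  proof -
    have a: "norm (A (x0 + t *\<^sub>R \<rho> x)) \<le> M" using M in_ball \<rho> that by blast
    have "norm (F f x t) \<le> norm (A (x0 + t *\<^sub>R \<rho> x)) * norm (\<rho> x) * norm (f (x0 + t *\<^sub>R \<rho> x))"
      unfolding F_def by (meson mult_right_mono norm_blinfun norm_ge_zero order_trans)
    also have "\<dots> \<le> (M * r) * B"
    proof (intro mult_mono)
      show "0 \<le> M" using a norm_ge_zero order_trans by blast
      then show "0 \<le> M * r" using r by simp
    qed (use a \<rho> that(2) in auto)
    also have "\<dots> \<le> 1 / 2 * B"
      using M(2) that(2) by (intro mult_right_mono) (auto intro: order_trans[OF norm_ge_zero])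
    finally show ?thesis .
  qed
  have normI: "norm (integral (cbox 0 1) (F f x)) \<le> 1 / 2 * B"
    if "continuous_on UNIV f" "\<And>y. norm (f y) \<le> B" for f x B
    using integral_bound[of 0 1 "F f x" "1 / 2 * B"] cFx[OF that(1)] normF[OF _ that(2)]
    by (simp add: cbox_interval)
  have Tb: "T f \<in> bcontfun" if f: "f \<in> bcontfun" for f
  proof -
    obtain B where B: "\<And>y. norm (f y) \<le> B" and cf: "continuous_on UNIV f"
      using f unfolding bcontfun_def bounded_iff by auto
    have "continuous_on UNIV (T f)"
      unfolding T_def by (intro continuous_intros integral_continuous_on_param[OF cF[OF cf]])
    moreover have "norm (T f x) \<le> norm c + 1 / 2 * B" for x
      unfolding T_def using norm_triangle_le[of c _] normI[OF cf B, of x]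
      by (smt (verit) norm_triangle_ineq)
    ultimately show ?thesis unfolding bcontfun_def bounded_iff by auto
  qed
  define T' where "T' f = Bcontfun (T (apply_bcontfun f))" for f :: "'a \<Rightarrow>\<^sub>C 'b"
  have T': "apply_bcontfun (T' f) = T (apply_bcontfun f)" for f
    unfolding T'_def by (rule Bcontfun_inverse) (use Tb apply_bcontfun in blast)
  have "dist (T' f) (T' g) \<le> 1 / 2 * dist f g" for f g
  proof (rule dist_bound)
    fix x
    have cf: "continuous_on UNIV (apply_bcontfun f)" "continuous_on UNIV (apply_bcontfun g)" by auto
    have "T' f x - T' g x = integral (cbox 0 1) (\<lambda>t. F f x t - F g x t)"
      unfolding T' T_def using cFx[OF cf(1), of x] cFx[OF cf(2), of x]
      by (simp add: integral_diff integrable_continuous_real cbox_interval)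
    also have "(\<lambda>t. F f x t - F g x t) = F (\<lambda>y. f y - g y) x"
      unfolding F_def by (simp add: blinfun.diff_right)
    also have "norm (integral (cbox 0 1) \<dots>) \<le> 1 / 2 * dist f g"
      by (rule normI) (auto intro!: continuous_intros simp: dist_bounded dist_norm[symmetric])
    finally show "dist (T' f x) (T' g x) \<le> 1 / 2 * dist f g" by (simp add: dist_norm)
  qed
  then obtain \<Phi> where \<Phi>: "T' \<Phi> = \<Phi>"
    using banach_fix_type[of "1/2" T'] by auto
  have c\<Phi>: "continuous_on UNIV (apply_bcontfun \<Phi>)" by auto
  have eq: "\<Phi> x = c + integral {0..1} (F \<Phi> x)" for x
    using T'[of \<Phi>] \<Phi> T_def by (metis cbox_interval)
  show ?thesis
  proof (rule that[of "apply_bcontfun \<Phi>"])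
    show "continuous_on (cball x0 r) (apply_bcontfun \<Phi>)" by auto
    have "F \<Phi> x0 = (\<lambda>t. 0)" unfolding F_def using \<rho>_id[of 0] r by auto
    then show "\<Phi> x0 = c" using eq[of x0] by simp
    fix z :: 'a and t :: real assume z: "norm z \<le> r" and t: "t \<in> {0..1}"
    define G where "G u = A (x0 + u *\<^sub>R z) z (\<Phi> (x0 + u *\<^sub>R z))" for u
    have cG: "continuous_on {0..1} G"
    proof -
      have "G = F \<Phi> (x0 + z)" unfolding G_def F_def using \<rho>_id[OF z] by auto
      then show ?thesis using cFx[OF c\<Phi>] by metis
    qed
    \<comment> \<open>The point with parameter \<tau> is itself the end of a shorter ray;
      substituting \<open>\<tau> * t\<close> for \<open>t\<close> turns its equation into one along
      the original ray.\<close>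
    have "\<Phi> (x0 + \<tau> *\<^sub>R z) = c + integral {0..\<tau>} G" if \<tau>: "\<tau> \<in> {0..1}" for \<tau>
    proof -
      have n: "norm (\<tau> *\<^sub>R z) \<le> r" using in_ball[OF z \<tau>] by (simp add: dist_norm)
      have "F \<Phi> (x0 + \<tau> *\<^sub>R z) = (\<lambda>t. \<tau> *\<^sub>R G (\<tau> * t))"
        unfolding F_def G_def using \<rho>_id[OF n] by (auto simp: blinfun.scaleR_right blinfun.scaleR_left mult.commute)
      moreover have "((\<lambda>t. \<tau> *\<^sub>R G (\<tau> * t)) has_integral integral {\<tau> * 0..\<tau> * 1} G) {0..1}"
      proof (rule has_integral_substitution[where c = 0 and d = 1])
        show "(*) \<tau> ` {0..1} \<subseteq> {0..1}" using \<tau> by (auto simp: mult_le_one)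
        show "((*) \<tau> has_field_derivative \<tau>) (at x within {0..1})" for x
          by (auto intro!: derivative_eq_intros)
      qed (use \<tau> cG in auto)
      ultimately have "integral {0..1} (F \<Phi> (x0 + \<tau> *\<^sub>R z)) = integral {0..\<tau>} G"
        by (metis integral_unique mult_zero_right mult_1_right)
      then show ?thesis using eq[of "x0 + \<tau> *\<^sub>R z"] by metis
    qed
    moreover have "((\<lambda>\<tau>. c + integral {0..\<tau>} G) has_vector_derivative G t) (at t within {0..1})"
      using integral_has_vector_derivative[OF cG t] by (auto intro!: derivative_eq_intros)
    ultimately show "((\<lambda>t. \<Phi> (x0 + t *\<^sub>R z)) has_vector_derivative
        A (x0 + t *\<^sub>R z) z (\<Phi> (x0 + t *\<^sub>R z))) (at t within {0..1})"
      unfolding G_def[symmetric] by (metis (no_types, lifting) has_vector_derivative_transform t)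
  qed
qed

text \<open>Plays the part of Gronwall's inequality. Where the norm is largest on the unit interval,
  the mean value inequality bounds it by half of itself plus \<open>C\<close>, and the half is
  absorbed.\<close>

lemma contraction_bound:
  fixes E :: "real \<Rightarrow> 'b::real_normed_vector"
  assumes d: "\<And>t. t \<in> {0..1} \<Longrightarrow> (E has_vector_derivative E' t) (at t within {0..1})"
    and E0: "E 0 = 0" and b: "\<And>t. t \<in> {0..1} \<Longrightarrow> norm (E' t) \<le> 1 / 2 * norm (E t) + C"
    and t: "t \<in> {0..1}"
  shows "norm (E t) \<le> 2 * C"
proof -
  have "continuous_on {0..1} E"
    using d has_vector_derivative_continuous continuous_on_eq_continuous_within by blast
  then have "continuous_on {0..1} (\<lambda>t. norm (E t))" by (intro continuous_intros)
  then obtain s where s: "s \<in> {0..1}" "\<And>t. t \<in> {0..1} \<Longrightarrow> norm (E t) \<le> norm (E s)"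
    using continuous_attains_sup[of "{0..1}" "\<lambda>t. norm (E t)"] by auto
  have nn: "0 \<le> 1 / 2 * norm (E s) + C"
    using b[OF s(1)] order_trans[OF norm_ge_zero] by blast
  have "norm (E s - E 0) \<le> (1 / 2 * norm (E s) + C) * norm (s - 0)"
  proof (rule differentiable_bound[where S = "{0..1}" and f' = "\<lambda>t h. h *\<^sub>R E' t"])
    show "(E has_derivative (\<lambda>h. h *\<^sub>R E' t)) (at t within {0..1})" if "t \<in> {0..1}" for t
      using d[OF that] by (simp add: has_vector_derivative_def)
    show "onorm (\<lambda>h. h *\<^sub>R E' t) \<le> 1 / 2 * norm (E s) + C" if "t \<in> {0..1}" for t
      using b[OF that] s(2)[OF that] by (intro onorm_le) (auto simp: mult.commute intro!: mult_left_mono)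
  qed (use s in auto)
  also have "\<dots> \<le> (1 / 2 * norm (E s) + C) * 1"
    using s(1) nn by (intro mult_left_mono) auto
  finally show ?thesis using E0 s(2)[OF t] by simp
qed

text \<open>Parallel transport along the rays from \<open>x\<^sub>0\<close> yields the solution: flatness makes the defect
  \<open>E t = \<Phi> (t (z + X)) - \<Phi> (t z) - t A(X) \<Phi> (t z)\<close> satisfy \<open>E' = A(z) E + O(|X|\<^sup>2)\<close>.\<close>
lemma flat_connection_parallel_section:
  fixes A :: "'a::euclidean_space \<Rightarrow> ('a \<Rightarrow>\<^sub>L ('b::euclidean_space \<Rightarrow>\<^sub>L 'b))"
  assumes S: "open S" "x0 \<in> S" and smooth: "smooth_on S A"
    and flat: "\<And>x X Y v. x \<in> S \<Longrightarrow>
      dd A x X Y v + A x Y (A x X v) = dd A x Y X v + A x X (A x Y v)"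
  obtains r \<Phi> where "r > 0" "ball x0 r \<subseteq> S" "\<Phi> x0 = c"
    "\<And>x. x \<in> ball x0 r \<Longrightarrow> (\<Phi> has_derivative (\<lambda>X. A x X (\<Phi> x))) (at x)"
proof -
  obtain r0 where r0: "r0 > 0" "cball x0 r0 \<subseteq> S" using S open_contains_cball by blast
  have cA: "continuous_on (cball x0 r0) A"
    using smooth_on_continuous[OF smooth] r0(2) continuous_on_subset by blast
  obtain M0 where M0: "\<And>x. x \<in> cball x0 r0 \<Longrightarrow> norm (A x) \<le> M0"
    using compact_imp_bounded[OF compact_continuous_image[OF cA compact_cball]]
    unfolding bounded_iff by blast
  define M where "M = max M0 1"
  define r where "r = min r0 (1 / (2 * M))"
  have r: "r > 0" "r \<le> r0" unfolding r_def M_def using r0(1) by auto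
  have "M * r \<le> M * (1 / (2 * M))" unfolding r_def M_def by (intro mult_left_mono) auto
  then have Mr: "M * r \<le> 1 / 2" unfolding M_def by simp
  have sub: "cball x0 r \<subseteq> cball x0 r0" using r by auto
  have M: "norm (A x) \<le> M" if "x \<in> cball x0 r" for x using M0 sub that unfolding M_def by fastforce
  have M0': "M \<ge> 1" unfolding M_def by simp
  obtain \<Phi> where \<Phi>: "continuous_on (cball x0 r) \<Phi>" "\<Phi> x0 = c"
    "\<And>z t. norm z \<le> r \<Longrightarrow> t \<in> {0..1} \<Longrightarrow>
      ((\<lambda>t. \<Phi> (x0 + t *\<^sub>R z)) has_vector_derivative
        A (x0 + t *\<^sub>R z) z (\<Phi> (x0 + t *\<^sub>R z))) (at t within {0..1})"
    by (rule radial_transport[OF r(1) continuous_on_subset[OF cA sub] M Mr, where c = c], assumption, rule that)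
  obtain P0 where P0: "\<And>x. x \<in> cball x0 r \<Longrightarrow> norm (\<Phi> x) \<le> P0"
    using compact_imp_bounded[OF compact_continuous_image[OF \<Phi>(1) compact_cball]]
    unfolding bounded_iff by blast
  have P: "P0 \<ge> 0" using P0[of x0] r(1) by (auto intro: order_trans[OF norm_ge_zero])
  have conv: "compact (cball x0 r)" "convex (cball x0 r)" "cball x0 r \<subseteq> S" using sub r0 by auto
  obtain L where L: "L \<ge> 0" "\<And>x y. x \<in> cball x0 r \<Longrightarrow> y \<in> cball x0 r \<Longrightarrow> norm (A y - A x) \<le> L * norm (y - x)"
    by (rule smooth_on_lipschitz[OF S(1) smooth conv]) (rule that)
  obtain Q where Q: "Q \<ge> 0" "\<And>x y. x \<in> cball x0 r \<Longrightarrow> y \<in> cball x0 r \<Longrightarrow>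
      norm (A y - A x - dd A x (y - x)) \<le> Q * (norm (y - x))\<^sup>2"
    by (rule smooth_on_taylor[OF S(1) smooth conv]) (rule that)
  have dA: "(A has_derivative dd A x) (at x)" if "x \<in> cball x0 r" for x
    using smooth_on_has_derivative[OF S(1) smooth] that conv(3) by blast
  have in_ball: "x0 + t *\<^sub>R z \<in> cball x0 r" if "norm z \<le> r" "t \<in> {0..1}" for t :: real and z
  proof -
    have "t * norm z \<le> 1 * r" using that by (intro mult_mono) auto
    then show ?thesis using that by (simp add: dist_norm)
  qed
  have nb: "norm (blinfun_apply (blinfun_apply B u) w) \<le> a * b * e"
    if "norm B \<le> a" "norm u \<le> b" "norm w \<le> e" for B :: "'a \<Rightarrow>\<^sub>L ('b \<Rightarrow>\<^sub>L 'b)" and u w a b e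
  proof -
    have "norm (B u w) \<le> norm B * norm u * norm w"
      by (meson mult_right_mono norm_blinfun norm_ge_zero order_trans)
    also have "\<dots> \<le> a * b * e" using that
      by (intro mult_mono) (auto intro: order_trans[OF norm_ge_zero] mult_nonneg_nonneg)
    finally show ?thesis .
  qed
  define C1 where "C1 = 2 * (L * r * P0 + M * P0)"
  define C2 where "C2 = 2 * (Q * r * P0 + L * r * C1 + L * P0 + M * C1)"
  have C1: "C1 \<ge> 0" unfolding C1_def using L(1) r P M0' by simp
  have key: "norm (\<Phi> (x0 + (z + X)) - \<Phi> (x0 + z) - A (x0 + z) X (\<Phi> (x0 + z))) \<le> C2 * (norm X)\<^sup>2"
    if z: "norm z \<le> r" "norm (z + X) \<le> r" for z X
  proof -
    let ?p = "\<lambda>t. x0 + t *\<^sub>R z" and ?q = "\<lambda>t. x0 + t *\<^sub>R (z + X)"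
    have pb: "?p t \<in> cball x0 r" "?q t \<in> cball x0 r" if "t \<in> {0..1}" for t
      using in_ball that z by auto
    have pq: "?q t - ?p t = t *\<^sub>R X" for t by (simp add: algebra_simps)
    have tX: "norm (t *\<^sub>R X) \<le> norm X" if "t \<in> {0..1}" for t
      using that by (auto intro: mult_left_le_one_le)
    have AL: "norm (A (?q t) - A (?p t)) \<le> L * norm X" if "t \<in> {0..1}" for t
      using L(2)[of "?p t" "?q t"] pb[OF that] pq tX[OF that] L(1) by (metis mult_left_mono order_trans)
    \<comment> \<open>Neighbouring rays carry nearby values: the first order estimate that makes the
      mixed terms in the defect quadratic.\<close>
    have lip: "norm (\<Phi> (?q t) - \<Phi> (?p t)) \<le> C1 * norm X" if t: "t \<in> {0..1}" for t
    proof -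
      have "norm (\<Phi> (?q t) - \<Phi> (?p t)) \<le> 2 * ((L * r * P0 + M * P0) * norm X)"
      proof (rule contraction_bound[OF has_vector_derivative_diff[OF \<Phi>(3)[OF z(2)] \<Phi>(3)[OF z(1)]] _ _ t])
        fix t :: real assume t: "t \<in> {0..1}"
        have "A (?q t) (z + X) (\<Phi> (?q t)) - A (?p t) z (\<Phi> (?p t))
          = A (?p t) z (\<Phi> (?q t) - \<Phi> (?p t)) + ((A (?q t) - A (?p t)) z (\<Phi> (?q t)) + A (?q t) X (\<Phi> (?q t)))"
          by (simp add: blinfun.add_right blinfun.add_left blinfun.diff_right blinfun.diff_left algebra_simps)
        also have "norm \<dots> \<le> M * r * norm (\<Phi> (?q t) - \<Phi> (?p t)) + ((L * norm X) * r * P0 + M * norm X * P0)"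
          using pb[OF t] z AL[OF t] M P0 by (intro norm_triangle_mono nb) auto
        also have "\<dots> \<le> 1 / 2 * norm (\<Phi> (?q t) - \<Phi> (?p t)) + (L * r * P0 + M * P0) * norm X"
          using mult_right_mono[OF Mr norm_ge_zero[of "\<Phi> (?q t) - \<Phi> (?p t)"]] by (simp add: algebra_simps)
        finally show "norm (A (?q t) (z + X) (\<Phi> (?q t)) - A (?p t) z (\<Phi> (?p t)))
          \<le> 1 / 2 * norm (\<Phi> (?q t) - \<Phi> (?p t)) + (L * r * P0 + M * P0) * norm X" .
      qed auto
      then show ?thesis unfolding C1_def by (simp only: mult.assoc)
    qed
    define E where "E t = \<Phi> (?q t) - \<Phi> (?p t) - t *\<^sub>R A (?p t) X (\<Phi> (?p t))" for t
    have "norm (E 1) \<le> 2 * ((Q * r * P0 + L * r * C1 + L * P0 + M * C1) * (norm X)\<^sup>2)"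
    proof (rule contraction_bound)
      fix t :: real assume t: "t \<in> {0..1}"
      have dp: "((\<lambda>t. A (?p t)) has_vector_derivative dd A (?p t) z) (at t within {0..1})"
      proof -
        have 1: "(?p has_derivative (\<lambda>h. h *\<^sub>R z)) (at t within {0..1})"
          by (auto intro!: derivative_eq_intros)
        have "linear (dd A (?p t))" using dA[OF pb(1)[OF t]] has_derivative_linear by blast
        then show ?thesis using has_derivative_compose[OF 1 dA[OF pb(1)[OF t]]]
          unfolding has_vector_derivative_def by (simp add: linear_cmul)
      qed
      have 2: "((\<lambda>t. A (?p t) X) has_vector_derivative dd A (?p t) z X) (at t within {0..1})"
        using bounded_linear.has_vector_derivative[OF bounded_linear_blinfun_apply dp]
        by (simp add: blinfun.bounded_linear_left bounded_linear.has_vector_derivative[OF blinfun.bounded_linear_left dp])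
      have 3: "((\<lambda>t. A (?p t) X (\<Phi> (?p t))) has_vector_derivative
          (A (?p t) X (A (?p t) z (\<Phi> (?p t))) + dd A (?p t) z X (\<Phi> (?p t)))) (at t within {0..1})"
        by (rule bounded_bilinear.has_vector_derivative[OF bounded_bilinear_blinfun_apply 2 \<Phi>(3)[OF z(1) t]])
      have 4: "((\<lambda>t. t *\<^sub>R A (?p t) X (\<Phi> (?p t))) has_vector_derivative
          (t *\<^sub>R (A (?p t) X (A (?p t) z (\<Phi> (?p t))) + dd A (?p t) z X (\<Phi> (?p t)))
            + 1 *\<^sub>R A (?p t) X (\<Phi> (?p t)))) (at t within {0..1})"
        by (rule has_vector_derivative_scaleR[OF _ 3]) (auto intro!: derivative_eq_intros)
      show "(E has_vector_derivative
        (A (?q t) (z + X) (\<Phi> (?q t)) - A (?p t) z (\<Phi> (?p t))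
          - (t *\<^sub>R (A (?p t) X (A (?p t) z (\<Phi> (?p t))) + dd A (?p t) z X (\<Phi> (?p t)))
            + 1 *\<^sub>R A (?p t) X (\<Phi> (?p t))))) (at t within {0..1})"
        unfolding E_def by (intro has_vector_derivative_diff \<Phi>(3) 4 z t)
      \<comment> \<open>Flatness enters here. It puts \<open>z\<close> outermost, so that one term
        joins \<open>A (?p t) z (E t)\<close> and the other becomes the linear Taylor term of
        \<open>A\<close> between the two rays.\<close>
      have fl: "A (?p t) X (A (?p t) z (\<Phi> (?p t))) + dd A (?p t) z X (\<Phi> (?p t))
         = A (?p t) z (A (?p t) X (\<Phi> (?p t))) + dd A (?p t) X z (\<Phi> (?p t))"
        using flat[of "?p t" z X "\<Phi> (?p t)"] pb(1)[OF t] conv(3) by (auto simp: algebra_simps)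
      have ddt: "dd A (?p t) (?q t - ?p t) = t *\<^sub>R dd A (?p t) X"
        unfolding pq using dA[OF pb(1)[OF t]] has_derivative_linear linear_cmul by blast
      \<comment> \<open>Beyond the term linear in \<open>E t\<close>, what remains is of second
        order in \<open>X\<close>: a Taylor remainder of \<open>A\<close> and three products of two
        first order factors.\<close>
      have "A (?q t) (z + X) (\<Phi> (?q t)) - A (?p t) z (\<Phi> (?p t))
          - (t *\<^sub>R (A (?p t) X (A (?p t) z (\<Phi> (?p t))) + dd A (?p t) z X (\<Phi> (?p t)))
            + 1 *\<^sub>R A (?p t) X (\<Phi> (?p t)))
        = A (?p t) z (E t) + (((A (?q t) - A (?p t) - dd A (?p t) (?q t - ?p t)) z (\<Phi> (?p t))
          + (A (?q t) - A (?p t)) z (\<Phi> (?q t) - \<Phi> (?p t)))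
          + ((A (?q t) - A (?p t)) X (\<Phi> (?q t)) + A (?p t) X (\<Phi> (?q t) - \<Phi> (?p t))))"
        unfolding fl ddt unfolding E_def
        by (simp add: blinfun.add_right blinfun.add_left blinfun.diff_right blinfun.diff_left
            blinfun.scaleR_right blinfun.scaleR_left algebra_simps)
      also have "norm \<dots> \<le> M * r * norm (E t) + (((Q * (norm X)\<^sup>2) * r * P0 + (L * norm X) * r * (C1 * norm X))
          + ((L * norm X) * norm X * P0 + M * norm X * (C1 * norm X)))"
      proof (intro norm_triangle_mono nb)
        have "norm (A (?q t) - A (?p t) - dd A (?p t) (?q t - ?p t)) \<le> Q * (norm (t *\<^sub>R X))\<^sup>2"
          using Q(2)[OF pb[OF t]] pq by metis
        also have "\<dots> \<le> Q * (norm X)\<^sup>2" using Q(1) tX[OF t] by (intro mult_left_mono power_mono) auto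
        finally show "norm (A (?q t) - A (?p t) - dd A (?p t) (?q t - ?p t)) \<le> Q * (norm X)\<^sup>2" .
      qed (use pb[OF t] z AL[OF t] M P0 lip[OF t] in auto)
      also have "\<dots> \<le> 1 / 2 * norm (E t) + (Q * r * P0 + L * r * C1 + L * P0 + M * C1) * (norm X)\<^sup>2"
        using mult_right_mono[OF Mr norm_ge_zero[of "E t"]] by (simp add: algebra_simps power2_eq_square)
      finally show "norm (A (?q t) (z + X) (\<Phi> (?q t)) - A (?p t) z (\<Phi> (?p t))
          - (t *\<^sub>R (A (?p t) X (A (?p t) z (\<Phi> (?p t))) + dd A (?p t) z X (\<Phi> (?p t)))
            + 1 *\<^sub>R A (?p t) X (\<Phi> (?p t)))) \<le> 1 / 2 * norm (E t) + (Q * r * P0 + L * r * C1 + L * P0 + M * C1) * (norm X)\<^sup>2" .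
    qed (auto simp: E_def)
    then show ?thesis unfolding E_def C2_def by (simp only: mult.assoc scaleR_one)
  qed
  show ?thesis
  proof (rule that[of r \<Phi>])
    show "ball x0 r \<subseteq> S" using conv(3) by auto
    fix x assume x: "x \<in> ball x0 r"
    have C2: "C2 \<ge> 0" unfolding C2_def using Q(1) r P L(1) C1 M0' by simp
    show "(\<Phi> has_derivative (\<lambda>X. A x X (\<Phi> x))) (at x)"
      unfolding has_derivative_at_alt
    proof (intro conjI allI impI)
      show "bounded_linear (\<lambda>X. A x X (\<Phi> x))"
        using bounded_linear_compose[OF blinfun.bounded_linear_left blinfun.bounded_linear_right] .
      fix e :: real assume e: "e > 0"
      \<comment> \<open>The first entry keeps \<open>y\<close> in the ball where \<open>key\<close>
        applies; the second turns the quadratic bound into \<open>e * norm (y - x)\<close>, with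
        \<open>C2 + 1\<close> to allow for \<open>C2 = 0\<close>.\<close>
      define d where "d = min (r - dist x0 x) (e / (C2 + 1))"
      have d: "d > 0" using x e C2 unfolding d_def by simp
      have "norm (\<Phi> y - \<Phi> x - A x (y - x) (\<Phi> x)) \<le> e * norm (y - x)" if y: "norm (y - x) < d" for y
      proof -
        have "norm (\<Phi> (x0 + ((x - x0) + (y - x))) - \<Phi> (x0 + (x - x0)) - A (x0 + (x - x0)) (y - x) (\<Phi> (x0 + (x - x0))))
          \<le> C2 * (norm (y - x))\<^sup>2"
        proof (rule key)
          show "norm (x - x0) \<le> r" using x by (simp add: dist_norm norm_minus_commute)
          show "norm ((x - x0) + (y - x)) \<le> r"
            using y norm_triangle_ineq[of "x - x0" "y - x"] unfolding d_def
            by (simp add: dist_norm norm_minus_commute)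
        qed
        moreover have "C2 * norm (y - x) \<le> e"
        proof -
          have "C2 * norm (y - x) \<le> (C2 + 1) * (e / (C2 + 1))"
            using y C2 unfolding d_def by (intro mult_mono) auto
          then show ?thesis using C2 by simp
        qed
        then have "C2 * (norm (y - x))\<^sup>2 \<le> e * norm (y - x)"
          by (simp add: power2_eq_square mult.assoc[symmetric] mult_right_mono)
        ultimately show ?thesis by simp
      qed
      then show "\<exists>d>0. \<forall>y. norm (y - x) < d \<longrightarrow> norm (\<Phi> y - \<Phi> x - A x (y - x) (\<Phi> x)) \<le> e * norm (y - x)"
        using d by blast
    qed
  qed (use r \<Phi> in auto)
qed

section \<open>Lorentzian linear algebra\<close>

lemma bounded_bilinear_lor: "bounded_bilinear (lor :: 'e::euclidean_space \<times> real \<Rightarrow> _)"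
proof
  show "\<exists>K. \<forall>a b :: 'e \<times> real. norm (lor a b) \<le> norm a * norm b * K"
  proof (intro exI allI)
    fix a b :: "'e \<times> real"
    have "\<bar>fst a \<bullet> fst b\<bar> \<le> norm a * norm b"
      using Cauchy_Schwarz_ineq2[of "fst a" "fst b"] norm_fst_le[of "fst a" "snd a"] norm_fst_le[of "fst b" "snd b"]
      unfolding prod.collapse by (meson mult_mono norm_ge_zero order_trans)
    moreover have "\<bar>snd a * snd b\<bar> \<le> norm a * norm b"
      using norm_snd_le[of "snd a" "fst a"] norm_snd_le[of "snd b" "fst b"] by (simp add: abs_mult mult_mono)
    ultimately show "norm (lor a b) \<le> norm a * norm b * 2" by (simp add: lor_def abs_if split: if_splits)
  qed
qed (auto simp: lor_def algebra_simps inner_add_left inner_add_right)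

interpretation lor: bounded_bilinear lor by (rule bounded_bilinear_lor)

lemma lor_commute: "lor a b = lor b a"
  by (simp add: lor_def inner_commute mult.commute)

lemmas lor_simps = lor.add_left lor.add_right lor.diff_left lor.diff_right lor.minus_left lor.minus_right
  lor.scaleR_left lor.scaleR_right lor.zero_left lor.zero_right

lemma smooth_on_lor [smooth_intros]:
  "open S \<Longrightarrow> smooth_on S f \<Longrightarrow> smooth_on S g \<Longrightarrow> smooth_on S (\<lambda>x. lor (f x) (g x))"
  by (rule smooth_on_bilinear[OF _ bounded_bilinear_lor])

lemma lor_nondegenerate:
  assumes "\<And>w. lor d w = 0"
  shows "d = 0"
proof -
  have "lor d (fst d, - snd d) = fst d \<bullet> fst d + snd d * snd d" by (simp add: lor_def)
  then have "fst d \<bullet> fst d + snd d * snd d = 0" using assms by simp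
  moreover have "fst d \<bullet> fst d \<ge> 0" "snd d * snd d \<ge> 0" by auto
  ultimately have "fst d \<bullet> fst d = 0" "snd d * snd d = 0" by linarith+
  then show ?thesis by (simp add: prod_eq_iff)
qed

text \<open>Subtracting the multiple of \<open>n\<close> that removes the last coordinate leaves the
  square of \<open>u\<close> unchanged, and on vectors with last coordinate 0 the form is Euclidean.
  This makes the induced metric of an immersed null line bundle definite.\<close>

lemma lor_orthogonal_to_null:
  assumes n: "lor n n = 0" "n \<noteq> 0" and u: "lor u n = 0"
  shows "lor u u \<ge> 0" and "lor u u = 0 \<Longrightarrow> \<exists>c. u = c *\<^sub>R n"
proof -
  have sn: "snd n \<noteq> 0"
  proof
    assume "snd n = 0"
    then have "fst n = 0" using n(1) by (simp add: lor_def)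
    with \<open>snd n = 0\<close> n(2) show False by (simp add: prod_eq_iff)
  qed
  define c where "c = snd u / snd n"
  have "lor (u - c *\<^sub>R n) (u - c *\<^sub>R n) = lor u u"
    using n(1) u lor_commute[of n u] by (simp add: lor_simps)
  moreover have "snd (u - c *\<^sub>R n) = 0" unfolding c_def using sn by simp
  ultimately have *: "lor u u = fst (u - c *\<^sub>R n) \<bullet> fst (u - c *\<^sub>R n)" by (simp add: lor_def)
  then show "lor u u \<ge> 0" by simp
  show "\<exists>c. u = c *\<^sub>R n" if "lor u u = 0"
  proof
    have "fst (u - c *\<^sub>R n) = 0" using * that by simp
    with \<open>snd (u - c *\<^sub>R n) = 0\<close> have "u - c *\<^sub>R n = 0" by (simp add: prod_eq_iff)
    then show "u = c *\<^sub>R n" by simp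
  qed
qed

lemma lorthI: "(\<And>w. w \<in> W \<Longrightarrow> lor v w = 0) \<Longrightarrow> v \<in> lorth W" by (simp add: lorth_def)
lemma lorthD: "v \<in> lorth W \<Longrightarrow> w \<in> W \<Longrightarrow> lor v w = 0" by (simp add: lorth_def)

lemma subspace_lorth: "subspace (lorth W)"
  unfolding subspace_def lorth_def by (simp add: lor_simps)

text \<open>By \<open>split\<close> the space and its orthogonal space together span everything, so
  a vector lying in both is orthogonal to all vectors and vanishes. This gives the uniqueness that
  \<open>lproj\<close> relies on.\<close>

lemma lproj_eqI:
  assumes "subspace W" and split: "\<And>u. \<exists>a\<in>W. u - a \<in> lorth W" and "w \<in> W" "v - w \<in> lorth W"
  shows "lproj W v = w"
  unfolding lproj_def
proof (rule the_equality)
  fix w' assume w': "w' \<in> W \<and> v - w' \<in> lorth W"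
  define d where "d = w' - w"
  have d: "d \<in> W" using w' assms subspace_diff unfolding d_def by blast
  have "(v - w) - (v - w') \<in> lorth W" using w' assms(4) subspace_diff[OF subspace_lorth] by blast
  then have d': "d \<in> lorth W" unfolding d_def by simp
  have "lor d u = 0" for u
  proof -
    obtain a where a: "a \<in> W" "u - a \<in> lorth W" using split by blast
    have "lor d u = lor d a + lor (u - a) d" by (simp add: lor_simps lor_commute)
    then show ?thesis using lorthD[OF d' a(1)] lorthD[OF a(2) d] by simp
  qed
  then have "d = 0" by (rule lor_nondegenerate)
  then show "w' = w" unfolding d_def by simp
qed (use assms in auto)

section \<open>Second order geometry of maps into Lorentz space\<close>

lemmas bilinear_simps = bilinear_ladd bilinear_radd bilinear_lmul bilinear_rmul bilinear_lneg bilinear_rneg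
  bilinear_lzero bilinear_rzero bilinear_lsub bilinear_rsub

locale pos_map =
  fixes D :: "(real ^ 'm::finite) set" and s :: "real ^ 'm \<Rightarrow> 'e::euclidean_space \<times> real"
  assumes open_D: "open D" and smooth: "smooth_on D s"
    and pos: "x \<in> D \<Longrightarrow> X \<noteq> 0 \<Longrightarrow> lift_metric s x X X > 0"
begin

abbreviation h where "h \<equiv> lift_metric s"
abbreviation \<Gamma> where "\<Gamma> \<equiv> christoffel (lift_metric s)"
abbreviation H where "H \<equiv> cov_hessian (lift_metric s) s"

lemmas ds = smooth_on_has_derivative[OF open_D smooth]
lemmas d2s = smooth_on_has_derivative[OF open_D smooth_on_dd[OF smooth]]
lemmas lin_ds = smooth_on_linear_dd[OF open_D smooth]
lemmas bilin_d2s = d2_bilinear[OF open_D smooth]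
lemmas d2s_sym = clairaut[OF open_D smooth]

lemma pos_form_h: "x \<in> D \<Longrightarrow> pos_form (h x)"
  using pos[of x] unfolding pos_form_def bilinear_def lift_metric_def
  by (auto intro!: linearI lor_commute simp: linear_add[OF lin_ds] linear_cmul[OF lin_ds] lor_simps)

lemma smooth_h: "smooth_on D (\<lambda>x. h x X Y)"
  unfolding lift_metric_def by (intro smooth_intros open_D smooth_on_dd smooth)

lemma h_fields_has_derivative:
  assumes x: "x \<in> D" and U: "(U has_derivative U') (at x)" and W: "(W has_derivative W') (at x)"
  shows "((\<lambda>y. h y (U y) (W y)) has_derivative
    (\<lambda>X. lor (dd s x (U x)) (d2 s x X (W x) + dd s x (W' X)) +
      lor (d2 s x X (U x) + dd s x (U' X)) (dd s x (W x)))) (at x)"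
  unfolding lift_metric_def
  by (intro lor.FDERIV has_derivative_dd_field[OF open_D smooth x] U W)

lemma dd_h: "x \<in> D \<Longrightarrow> dd (\<lambda>y. h y Y Z) x X = lor (dd s x Y) (d2 s x X Z) + lor (d2 s x X Y) (dd s x Z)"
  unfolding lift_metric_def by (rule dd_eqI) (intro lor.FDERIV d2s)

text \<open>In Koszul's formula the symmetry of second derivatives cancels all but two equal terms,
  so the Christoffel map is the tangential part of the flat second derivative of
  \<open>s\<close>.\<close>

lemma christoffel_raise:
  assumes x: "x \<in> D"
  shows "\<Gamma> x X Y = raise (h x) (\<lambda>Z. lor (d2 s x X Y) (dd s x Z))"
proof -
  have "dd (\<lambda>y. h y Y Z) x X + dd (\<lambda>y. h y X Z) x Y - dd (\<lambda>y. h y X Y) x Z =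
    2 * lor (d2 s x X Y) (dd s x Z)" for Z
    using x d2s_sym[OF x, of Y X] d2s_sym[OF x, of Z X] d2s_sym[OF x, of Z Y]
    by (simp add: dd_h lor_commute)
  then show ?thesis unfolding christoffel_def raise_def by simp
qed

lemma linear_lor_ds: "x \<in> D \<Longrightarrow> linear (\<lambda>Z. lor u (dd s x Z))"
  using lin_ds by (intro linearI) (auto simp: linear_add linear_cmul lor_simps)

lemma h_christoffel: "x \<in> D \<Longrightarrow> h x (\<Gamma> x X Y) Z = lor (d2 s x X Y) (dd s x Z)"
  using raise_cramer(1)[OF pos_form_h linear_lor_ds] christoffel_raise by metis

lemma smooth_christoffel: "smooth_on D (\<lambda>x. \<Gamma> x X Y)"
proof (rule smooth_on_cong[OF open_D])
  show "smooth_on D (\<lambda>x. raise (h x) (\<lambda>Z. lor (d2 s x X Y) (dd s x Z)))"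
    by (intro smooth_intros open_D pos_form_h smooth_h linear_lor_ds smooth_on_dd smooth)
qed (simp add: christoffel_raise)

lemma christoffel_sym: "x \<in> D \<Longrightarrow> \<Gamma> x X Y = \<Gamma> x Y X"
  by (simp add: christoffel_raise d2s_sym)

lemma bilinear_christoffel:
  assumes x: "x \<in> D"
  shows "bilinear (\<Gamma> x)"
proof -
  note l = linear_add[OF pos_formD(5)[OF pos_form_h[OF x]]] linear_cmul[OF pos_formD(5)[OF pos_form_h[OF x]]]
  have "\<Gamma> x (a + b) Y = \<Gamma> x a Y + \<Gamma> x b Y" "\<Gamma> x Y (a + b) = \<Gamma> x Y a + \<Gamma> x Y b"
    "\<Gamma> x (c *\<^sub>R a) Y = c *\<^sub>R \<Gamma> x a Y" "\<Gamma> x Y (c *\<^sub>R a) = c *\<^sub>R \<Gamma> x Y a" for a b c Y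
    by (auto intro!: pos_form_eqI[OF pos_form_h[OF x]]
        simp: l h_christoffel[OF x] bilinear_simps[OF bilin_d2s[OF x]] lor_simps)
  then show ?thesis unfolding bilinear_def by (auto intro!: linearI)
qed

lemma H_def: "H x X Y = d2 s x X Y - dd s x (\<Gamma> x X Y)"
  unfolding cov_hessian_def ..

lemma H_normal: "x \<in> D \<Longrightarrow> lor (H x X Y) (dd s x Z) = 0"
  using h_christoffel[of x X Y Z] by (simp add: H_def lor_simps lift_metric_def)

lemma H_normal': "x \<in> D \<Longrightarrow> lor (dd s x Z) (H x X Y) = 0"
  using H_normal lor_commute by metis

lemma H_sym: "x \<in> D \<Longrightarrow> H x X Y = H x Y X"
  by (simp add: H_def d2s_sym christoffel_sym)

lemma bilinear_H: "x \<in> D \<Longrightarrow> bilinear (H x)"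
  unfolding H_def bilinear_def
  by (auto intro!: linearI simp: bilinear_simps[OF bilin_d2s] bilinear_simps[OF bilinear_christoffel]
      linear_add[OF lin_ds] linear_cmul[OF lin_ds] algebra_simps)

text \<open>A decomposition of the second derivative into a tangent vector and a vector orthogonal
  to all tangent vectors is unique. New Christoffel maps are found below by exhibiting a candidate
  \<open>U\<close>.\<close>

lemma H_eqI:
  assumes x: "x \<in> D" and E: "\<And>Z. lor (d2 s x X Y - dd s x U) (dd s x Z) = 0"
  shows "\<Gamma> x X Y = U" "H x X Y = d2 s x X Y - dd s x U"
proof -
  show "\<Gamma> x X Y = U"
  proof (rule pos_form_eqI[OF pos_form_h[OF x]])
    show "h x (\<Gamma> x X Y) Z = h x U Z" for Z
      using E[of Z] h_christoffel[OF x, of X Y Z] by (simp add: lor_simps lift_metric_def)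
  qed
  then show "H x X Y = d2 s x X Y - dd s x U" by (simp add: H_def)
qed

text \<open>Differentiates \<open>h_christoffel\<close> in the direction \<open>X\<close>. The third
  derivative of \<open>s\<close> that appears is symmetric in \<open>X\<close> and \<open>Y\<close>
  and will drop out of the curvature.\<close>

lemma christoffel_derivative:
  assumes x: "x \<in> D"
  shows "h x (dd (\<lambda>y. \<Gamma> y Y Z) x X + \<Gamma> x X (\<Gamma> x Y Z)) W =
    lor (d2 (\<lambda>y. dd s y Z) x X Y) (dd s x W) + lor (H x Y Z) (H x X W)"
proof -
  let ?U = "\<lambda>y. \<Gamma> y Y Z"
  have U: "(?U has_derivative dd ?U x) (at x)"
    using smooth_on_has_derivative[OF open_D smooth_christoffel x] .
  have 1: "((\<lambda>y. lor (dd s y (?U y)) (dd s y W)) has_derivative (\<lambda>X. lor (dd s x (?U x)) (d2 s x X W)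
      + lor (d2 s x X (?U x) + dd s x (dd ?U x X)) (dd s x W))) (at x)"
    by (intro lor.FDERIV has_derivative_dd_field[OF open_D smooth x] x U d2s)
  have 2: "((\<lambda>y. lor (d2 s y Y Z) (dd s y W)) has_derivative (\<lambda>X. lor (d2 s x Y Z) (d2 s x X W)
      + lor (d2 (\<lambda>y. dd s y Z) x X Y) (dd s x W))) (at x)"
    by (intro lor.FDERIV d2s x smooth_on_has_derivative[OF open_D] smooth_on_dd smooth)
  have "((\<lambda>y. lor (d2 s y Y Z) (dd s y W)) has_derivative (\<lambda>X. lor (dd s x (?U x)) (d2 s x X W)
      + lor (d2 s x X (?U x) + dd s x (dd ?U x X)) (dd s x W))) (at x)"
    by (rule has_derivative_transform_within_open[OF 1 open_D x])
      (use h_christoffel in \<open>simp add: lift_metric_def\<close>)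
  from fun_cong[OF has_derivative_unique[OF this 2], of X]
  have "lor (dd s x (?U x)) (d2 s x X W) + (lor (d2 s x X (?U x)) (dd s x W) + lor (dd s x (dd ?U x X)) (dd s x W))
    = lor (d2 s x Y Z) (d2 s x X W) + lor (d2 (\<lambda>y. dd s y Z) x X Y) (dd s x W)"
    by (simp add: lor_simps)
  moreover have "lor (H x Y Z) (H x X W) = lor (d2 s x Y Z) (d2 s x X W) - lor (dd s x (?U x)) (d2 s x X W)"
  proof -
    have "lor (H x Y Z) (H x X W) = lor (H x Y Z) (d2 s x X W)"
      using H_normal[OF x, of Y Z "\<Gamma> x X W"] H_def[of x X W] by (simp add: lor_simps)
    then show ?thesis by (simp add: H_def lor_simps)
  qed
  moreover have "h x (dd ?U x X + \<Gamma> x X (?U x)) W = lor (dd s x (dd ?U x X)) (dd s x W) + lor (d2 s x X (?U x)) (dd s x W)"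
    using linear_add[OF pos_formD(5)[OF pos_form_h[OF x]]] h_christoffel[OF x]
    by (simp add: lift_metric_def)
  ultimately show ?thesis by simp
qed

lemma gauss_equation:
  assumes x: "x \<in> D"
  shows "h x (riemann h x X Y Z) W = lor (H x Y Z) (H x X W) - lor (H x X Z) (H x Y W)"
proof -
  note l = linear_add[OF pos_formD(5)[OF pos_form_h[OF x]]] linear_diff[OF pos_formD(5)[OF pos_form_h[OF x]]]
  have "d2 (\<lambda>y. dd s y Z) x X Y = d2 (\<lambda>y. dd s y Z) x Y X"
    by (rule clairaut[OF open_D smooth_on_dd[OF smooth] x])
  then show ?thesis
    using christoffel_derivative[OF x, of Y Z X W] christoffel_derivative[OF x, of X Z Y W]
    by (simp add: riemann_def l algebra_simps)
qed

lemma metric_compatible: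
  assumes x: "x \<in> D" and W: "(W has_derivative W') (at x)"
  shows "((\<lambda>y. h y (W y) (W y)) has_derivative (\<lambda>X. 2 * h x (W' X + \<Gamma> x X (W x)) (W x))) (at x)"
proof -
  have "lor (dd s x (W x)) (d2 s x X (W x) + dd s x (W' X)) + lor (d2 s x X (W x) + dd s x (W' X)) (dd s x (W x))
      = 2 * h x (W' X + \<Gamma> x X (W x)) (W x)" for X
    using linear_add[OF pos_formD(5)[OF pos_form_h[OF x]]] h_christoffel[OF x]
    by (simp add: lift_metric_def lor_simps lor_commute)
  then show ?thesis using h_fields_has_derivative[OF x W W] by simp
qed

end

section \<open>Lifts to the light cone\<close>

lemma null_derivative:
  assumes "open D" "smooth_on D s" and null: "\<And>y. y \<in> D \<Longrightarrow> lor (s y) (s y) = 0" and x: "x \<in> D"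
  shows "lor (dd s x X) (s x) = 0"
proof -
  have 1: "((\<lambda>y. lor (s y) (s y)) has_derivative (\<lambda>X. lor (s x) (dd s x X) + lor (dd s x X) (s x))) (at x)"
    by (intro lor.FDERIV smooth_on_has_derivative[OF assms(1,2)] x)
  have "((\<lambda>y. lor (s y) (s y)) has_derivative (\<lambda>X. 0)) (at x)"
    by (rule has_derivative_transform_within_open[OF has_derivative_const assms(1) x]) (simp add: null)
  from fun_cong[OF has_derivative_unique[OF this 1], of X] show ?thesis by (simp add: lor_commute)
qed

locale null_map = pos_map D s
  for D :: "(real ^ 'm::finite) set" and s :: "real ^ 'm \<Rightarrow> 'e::euclidean_space \<times> real" +
  assumes null: "x \<in> D \<Longrightarrow> lor (s x) (s x) = 0"
begin

lemma ds_s: "x \<in> D \<Longrightarrow> lor (dd s x X) (s x) = 0"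
  by (rule null_derivative[OF open_D smooth null])

lemma s_ds: "x \<in> D \<Longrightarrow> lor (s x) (dd s x X) = 0"
  using ds_s lor_commute by metis

lemma s_d2s: assumes x: "x \<in> D" shows "lor (s x) (d2 s x X Y) = - h x X Y"
proof -
  have 1: "((\<lambda>y. lor (s y) (dd s y Y)) has_derivative (\<lambda>X. lor (s x) (d2 s x X Y) + lor (dd s x X) (dd s x Y))) (at x)"
    by (intro lor.FDERIV ds d2s x)
  have "((\<lambda>y. lor (s y) (dd s y Y)) has_derivative (\<lambda>X. 0)) (at x)"
    by (rule has_derivative_transform_within_open[OF has_derivative_const open_D x]) (simp add: s_ds)
  from fun_cong[OF has_derivative_unique[OF this 1], of X] show ?thesis by (simp add: lift_metric_def)
qed

lemma s_H: "x \<in> D \<Longrightarrow> lor (s x) (H x X Y) = - h x X Y" "x \<in> D \<Longrightarrow> lor (H x X Y) (s x) = - h x X Y"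
  by (simp_all add: H_def lor_simps s_ds s_d2s lor_commute[of _ "s x"])

end

subsection \<open>Conformal change of lift\<close>

lemma rescale_derivatives:
  fixes s :: "'a::real_normed_vector \<Rightarrow> 'v::real_normed_vector"
  assumes D: "open D" "smooth_on D s" "smooth_on D \<phi>" "\<forall>x\<in>D. \<phi> x \<noteq> (0::real)" and x: "x \<in> D"
  shows "dd (\<lambda>y. (1 / \<phi> y) *\<^sub>R s y) x X = (1 / \<phi> x) *\<^sub>R dd s x X - (dd \<phi> x X / (\<phi> x)\<^sup>2) *\<^sub>R s x"
    and "d2 (\<lambda>y. (1 / \<phi> y) *\<^sub>R s y) x X Y = (1 / \<phi> x) *\<^sub>R d2 s x X Y
      - (dd \<phi> x X / (\<phi> x)\<^sup>2) *\<^sub>R dd s x Y - (dd \<phi> x Y / (\<phi> x)\<^sup>2) *\<^sub>R dd s x X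
      - (d2 \<phi> x X Y / (\<phi> x)\<^sup>2 - 2 * dd \<phi> x X * dd \<phi> x Y / (\<phi> x)^3) *\<^sub>R s x"
proof -
  note d = smooth_on_has_derivative[OF D(1)]
  have 1: "dd (\<lambda>y. (1 / \<phi> y) *\<^sub>R s y) x X = (1 / \<phi> x) *\<^sub>R dd s x X - (dd \<phi> x X / (\<phi> x)\<^sup>2) *\<^sub>R s x" if x: "x \<in> D" for x X
    by (rule dd_eqI) (use d[OF D(2) x] d[OF D(3) x] bspec[OF D(4) x] in
      \<open>auto intro!: derivative_eq_intros simp: power2_eq_square divide_simps\<close>)
  then show "dd (\<lambda>y. (1 / \<phi> y) *\<^sub>R s y) x X = (1 / \<phi> x) *\<^sub>R dd s x X - (dd \<phi> x X / (\<phi> x)\<^sup>2) *\<^sub>R s x" using x .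
  have "d2 (\<lambda>y. (1 / \<phi> y) *\<^sub>R s y) x X Y = dd (\<lambda>y. (1 / \<phi> y) *\<^sub>R dd s y Y - (dd \<phi> y Y / (\<phi> y)\<^sup>2) *\<^sub>R s y) x X"
    by (subst dd_cong_open[OF D(1) x]) (auto simp: 1)
  also have "\<dots> = ((1 / \<phi> x) *\<^sub>R d2 s x X Y - (dd \<phi> x X / (\<phi> x)\<^sup>2) *\<^sub>R dd s x Y)
     - ((dd \<phi> x Y / (\<phi> x)\<^sup>2) *\<^sub>R dd s x X + (d2 \<phi> x X Y / (\<phi> x)\<^sup>2 - 2 * dd \<phi> x X * dd \<phi> x Y / (\<phi> x)^3) *\<^sub>R s x)"
  proof (rule dd_eqI, rule has_derivative_diff)
    note n = bspec[OF D(4) x]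
    have a: "((\<lambda>y. 1 / \<phi> y) has_derivative (\<lambda>X. - (dd \<phi> x X / (\<phi> x)\<^sup>2))) (at x)"
      using d[OF D(3) x] n by (auto intro!: derivative_eq_intros simp: power2_eq_square)
    have "((\<lambda>y. (1 / \<phi> y) *\<^sub>R dd s y Y) has_derivative
      (\<lambda>X. (1 / \<phi> x) *\<^sub>R d2 s x X Y + (- (dd \<phi> x X / (\<phi> x)\<^sup>2)) *\<^sub>R dd s x Y)) (at x)"
      by (intro has_derivative_scaleR a d[OF smooth_on_dd[OF D(2)] x])
    then show "((\<lambda>y. (1 / \<phi> y) *\<^sub>R dd s y Y) has_derivative
      (\<lambda>X. (1 / \<phi> x) *\<^sub>R d2 s x X Y - (dd \<phi> x X / (\<phi> x)\<^sup>2) *\<^sub>R dd s x Y)) (at x)" by simp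
    have b: "((\<lambda>y. dd \<phi> y Y / (\<phi> y)\<^sup>2) has_derivative (\<lambda>X. d2 \<phi> x X Y / (\<phi> x)\<^sup>2 - 2 * dd \<phi> x X * dd \<phi> x Y / (\<phi> x)^3)) (at x)"
      using d[OF D(3) x] d[OF smooth_on_dd[OF D(3)] x, of Y] n
      by (auto intro!: derivative_eq_intros simp: fun_eq_iff power2_eq_square power3_eq_cube field_simps)
    show "((\<lambda>y. (dd \<phi> y Y / (\<phi> y)\<^sup>2) *\<^sub>R s y) has_derivative (\<lambda>X. (dd \<phi> x Y / (\<phi> x)\<^sup>2) *\<^sub>R dd s x X
      + (d2 \<phi> x X Y / (\<phi> x)\<^sup>2 - 2 * dd \<phi> x X * dd \<phi> x Y / (\<phi> x)^3) *\<^sub>R s x)) (at x)"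
      by (intro has_derivative_scaleR b d[OF D(2) x])
  qed
  finally show "d2 (\<lambda>y. (1 / \<phi> y) *\<^sub>R s y) x X Y = (1 / \<phi> x) *\<^sub>R d2 s x X Y
      - (dd \<phi> x X / (\<phi> x)\<^sup>2) *\<^sub>R dd s x Y - (dd \<phi> x Y / (\<phi> x)\<^sup>2) *\<^sub>R dd s x X
      - (d2 \<phi> x X Y / (\<phi> x)\<^sup>2 - 2 * dd \<phi> x X * dd \<phi> x Y / (\<phi> x)^3) *\<^sub>R s x" by simp
qed

locale conformal_change = null_map D s
  for D :: "(real ^ 'm::finite) set" and s :: "real ^ 'm \<Rightarrow> 'e::euclidean_space \<times> real" +
  fixes \<phi> :: "real ^ 'm \<Rightarrow> real"
  assumes smooth_\<phi>: "smooth_on D \<phi>" and \<phi>_nz: "x \<in> D \<Longrightarrow> \<phi> x \<noteq> 0"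
begin

abbreviation t where "t \<equiv> \<lambda>y. (1 / \<phi> y) *\<^sub>R s y"
abbreviation grad where "grad x \<equiv> raise (h x) (dd \<phi> x)"
abbreviation hess where "hess \<equiv> cov_hessian (lift_metric s) \<phi>"

lemmas d\<phi> = smooth_on_has_derivative[OF open_D smooth_\<phi>]
lemmas lin_d\<phi> = smooth_on_linear_dd[OF open_D smooth_\<phi>]

lemma smooth_t: "smooth_on D t"
  using smooth_\<phi> \<phi>_nz by (intro smooth_intros open_D smooth)

lemma \<phi>_nz_ball: "\<forall>x\<in>D. \<phi> x \<noteq> 0" using \<phi>_nz by blast

lemmas t_derivatives = rescale_derivatives[OF open_D smooth smooth_\<phi> \<phi>_nz_ball]

lemma h_t: "x \<in> D \<Longrightarrow> lift_metric t x X Y = h x X Y / (\<phi> x)\<^sup>2"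
  by (simp add: lift_metric_def t_derivatives lor_simps null s_ds ds_s power2_eq_square)

sublocale t: null_map D t
proof
  show "lor (t x) (t x) = 0" if "x \<in> D" for x using null[OF that] by (simp add: lor_simps)
qed (use open_D smooth_t pos h_t \<phi>_nz in auto)

lemma h_grad: "x \<in> D \<Longrightarrow> h x (grad x) Z = dd \<phi> x Z"
  by (rule raise_cramer(1)[OF pos_form_h lin_d\<phi>])

lemma smooth_grad: "smooth_on D grad"
  by (intro smooth_intros open_D pos_form_h smooth_h lin_d\<phi> smooth_on_dd smooth_\<phi>)

text \<open>The component along \<open>s\<close> of the hessian of the rescaled lift, see
  \<open>H_t\<close>; it carries the second derivatives of the conformal factor.\<close>

definition e where "e x X Y = - hess x X Y / (\<phi> x)\<^sup>2 + h x X Y * h x (grad x) (grad x) / (\<phi> x)^3"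

lemma H_t:
  assumes x: "x \<in> D"
  shows "t.H x X Y = (1 / \<phi> x) *\<^sub>R H x X Y - (h x X Y / (\<phi> x)\<^sup>2) *\<^sub>R dd s x (grad x) + e x X Y *\<^sub>R s x"
proof -
  note n = \<phi>_nz[OF x]
  note ll = linear_add[OF lin_ds[OF x]] linear_diff[OF lin_ds[OF x]] linear_cmul[OF lin_ds[OF x]]
    linear_add[OF lin_d\<phi>[OF x]] linear_diff[OF lin_d\<phi>[OF x]] linear_cmul[OF lin_d\<phi>[OF x]]
  \<comment> \<open>The classical Christoffel map of \<open>h / \<phi>\<^sup>2\<close>, that is of
    exp(2f) h with f = - log |\<phi>|.\<close>
  define U where "U = \<Gamma> x X Y - (1 / \<phi> x) *\<^sub>R (dd \<phi> x X *\<^sub>R Y + dd \<phi> x Y *\<^sub>R X - h x X Y *\<^sub>R grad x)"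
  let ?R = "(1 / \<phi> x) *\<^sub>R H x X Y - (h x X Y / (\<phi> x)\<^sup>2) *\<^sub>R dd s x (grad x) + e x X Y *\<^sub>R s x"
  have g: "dd \<phi> x (grad x) = h x (grad x) (grad x)" using h_grad[OF x] by simp
  have eq: "d2 t x X Y - dd t x U = ?R"
  proof -
    have p2: "(d2 \<phi> x X Y / (\<phi> x)\<^sup>2 - 2 * dd \<phi> x X * dd \<phi> x Y / (\<phi> x)^3) - dd \<phi> x U / (\<phi> x)\<^sup>2 = - e x X Y"
      unfolding U_def e_def cov_hessian_def using n
      by (simp add: ll g power2_eq_square power3_eq_cube field_simps)
    have "d2 t x X Y - dd t x U = (1 / \<phi> x) *\<^sub>R d2 s x X Y
      - (dd \<phi> x X / (\<phi> x)\<^sup>2) *\<^sub>R dd s x Y - (dd \<phi> x Y / (\<phi> x)\<^sup>2) *\<^sub>R dd s x X - (1 / \<phi> x) *\<^sub>R dd s x U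
      - ((d2 \<phi> x X Y / (\<phi> x)\<^sup>2 - 2 * dd \<phi> x X * dd \<phi> x Y / (\<phi> x)^3) - dd \<phi> x U / (\<phi> x)\<^sup>2) *\<^sub>R s x"
      by (simp add: t_derivatives x algebra_simps)
    also have "\<dots> = ?R"
      unfolding p2 unfolding U_def H_def using n
      by (simp add: ll algebra_simps power2_eq_square)
    finally show ?thesis .
  qed
  show ?thesis
    unfolding eq[symmetric]
  proof (rule t.H_eqI(2)[OF x])
    have hn: "lor (dd s x (grad x)) (dd s x Z) = dd \<phi> x Z" for Z
      using h_grad[OF x, of Z] by (simp add: lift_metric_def)
    show "lor (d2 t x X Y - dd t x U) (dd t x Z) = 0" for Z
      unfolding eq using n
      by (simp add: t_derivatives(1)[OF x] lor_simps H_normal[OF x] s_H[OF x] s_ds[OF x] hn null[OF x] ds_s[OF x] power2_eq_square field_simps)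
  qed
qed

text \<open>\<open>s\<close> is null and orthogonal to \<open>ds\<close>, and the hessian is
  orthogonal to \<open>ds\<close> and pairs with \<open>s\<close> to \<open>- h\<close>. So besides
  the old product only the square of the gradient term and the cross terms with \<open>e\<close>
  survive.\<close>

lemma gauss_t:
  assumes x: "x \<in> D"
  shows "lor (t.H x Y Z) (t.H x X W) = lor (H x Y Z) (H x X W) / (\<phi> x)\<^sup>2
    + h x Y Z * h x X W * h x (grad x) (grad x) / (\<phi> x)^4
    - (h x Y Z * e x X W + e x Y Z * h x X W) / \<phi> x"
proof -
  have "lor (dd s x (grad x)) (dd s x (grad x)) = h x (grad x) (grad x)" by (simp add: lift_metric_def)
  then show ?thesis
    unfolding H_t[OF x] using \<phi>_nz[OF x]
    by (simp add: lor_simps H_normal[OF x] H_normal'[OF x] s_H[OF x] s_ds[OF x] null[OF x] ds_s[OF x] power2_eq_square power4_eq_xxxx field_simps)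
qed

end

section \<open>Constant curvature\<close>

text \<open>An algebraic curvature tensor is determined by its sectional values: polarizing
  \<open>sec\<close> yields antisymmetry also in the middle pair, so the three terms of the Bianchi
  identity coincide and 3 T = 0.\<close>

lemma curvature_like_zero:
  fixes T :: "'a::real_vector \<Rightarrow> 'a \<Rightarrow> 'a \<Rightarrow> 'a \<Rightarrow> real"
  assumes add: "\<And>X X' Y Z W. T (X + X') Y Z W = T X Y Z W + T X' Y Z W"
    and anti: "\<And>X Y Z W. T X Y Z W = - T Y X Z W" "\<And>X Y Z W. T X Y Z W = - T X Y W Z"
    and pair: "\<And>X Y Z W. T X Y Z W = T Z W X Y"
    and bianchi: "\<And>X Y Z W. T X Y Z W + T Y Z X W + T Z X Y W = 0"
    and sec: "\<And>X Y. T X Y Y X = 0"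
  shows "T X Y Z W = 0"
proof -
  have add4: "T X Y Z (W + W') = T X Y Z W + T X Y Z W'" for X Y Z W W'
    using add[of W W' Z X Y] pair anti by (metis minus_add_distrib)
  have add2: "T X (Y + Y') Z W = T X Y Z W + T X Y' Z W" for X Y Y' Z W
    using add[of Y Y' X Z W] anti(1)[of X] by (metis minus_add_distrib)
  have add3: "T X Y (Z + Z') W = T X Y Z W + T X Y Z' W" for X Y Z Z' W
    using add4[of X Y W Z Z'] anti(2)[of X Y _ W] by (metis minus_add_distrib)
  have 1: "T X Y Y W = 0" for X Y W
  proof -
    have "T (X + W) Y Y (X + W) = 0" by (rule sec)
    then have "T X Y Y W + T W Y Y X = 0" using sec[of X Y] sec[of W Y] by (simp add: add add4)
    moreover have "T W Y Y X = T X Y Y W" using pair[of W Y Y X] anti(1)[of Y X W Y] anti(2)[of X Y W Y] by simp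
    ultimately show ?thesis by simp
  qed
  have 2: "T X Y Z W = - T X Z Y W" for X Y Z W
  proof -
    have "T X (Y + Z) (Y + Z) W = 0" by (rule 1)
    then show ?thesis using 1[of X Y W] 1[of X Z W] by (simp add: add2 add3)
  qed
  have "T Y Z X W = T X Y Z W" using 2[of Y Z X W] anti(1)[of Y X Z W] by simp
  moreover have "T Z X Y W = T X Y Z W" using anti(1)[of Z X Y W] 2[of X Z Y W] by simp
  ultimately show ?thesis using bianchi[of X Y Z W] by simp
qed

text \<open>The Gauss expression of a symmetric form minus its constant curvature model is an
  algebraic curvature tensor, so its sectional values decide. Scaling and Gram-Schmidt reduce these
  to the orthonormal pairs covered by \<open>k\<close>.\<close>

lemma gauss_form_constant:
  fixes H :: "real ^ 'm::finite \<Rightarrow> real ^ 'm \<Rightarrow> 'e::euclidean_space \<times> real"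
  assumes H: "bilinear H" "\<And>X Y. H X Y = H Y X" and h: "pos_form h"
    and k: "\<And>X Y. h X X = 1 \<Longrightarrow> h Y Y = 1 \<Longrightarrow> h X Y = 0 \<Longrightarrow> lor (H X X) (H Y Y) - lor (H X Y) (H X Y) = k"
  shows "lor (H Y Z) (H X W) - lor (H X Z) (H Y W) = k * (h Y Z * h X W - h X Z * h Y W)"
proof -
  note hs = bilinear_simps[OF pos_formD(1)[OF h]] and Hs = bilinear_simps[OF H(1)] and hsym = pos_formD(2)[OF h]
  define T where "T X Y Z W = lor (H Y Z) (H X W) - lor (H X Z) (H Y W) - k * (h Y Z * h X W - h X Z * h Y W)"
    for X Y Z W
  have unit: "\<exists>E a. h E E = 1 \<and> X = a *\<^sub>R E" if "X \<noteq> 0" for X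
  proof (intro exI conjI)
    let ?n = "sqrt (h X X)"
    have n: "?n > 0" "?n * ?n = h X X" using pos_formD(3)[OF h that] by auto
    show "h ((1 / ?n) *\<^sub>R X) ((1 / ?n) *\<^sub>R X) = 1" using n by (simp add: hs)
    show "X = ?n *\<^sub>R ((1 / ?n) *\<^sub>R X)" using n by simp
  qed
  have sec: "T X Y Y X = 0" for X Y
  proof (cases "X = 0")
    case True then show ?thesis unfolding T_def by (simp add: hs Hs lor_simps)
  next
    case False
    then obtain E a where E: "h E E = 1" "X = a *\<^sub>R E" using unit by blast
    define b where "b = h E Y"
    define Y' where "Y' = Y - b *\<^sub>R E"
    have Y: "Y = b *\<^sub>R E + Y'" and EY: "h E Y' = 0" unfolding Y'_def b_def using E by (simp_all add: hs)
    show ?thesis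
    proof (cases "Y' = 0")
      case True
      then show ?thesis unfolding T_def E(2) Y using H(2) by (simp add: hs Hs lor_simps)
    next
      case False
      then obtain F c where F: "h F F = 1" "Y' = c *\<^sub>R F" using unit by blast
      show ?thesis
      \<comment> \<open>\<open>unit\<close> does not state that its factor is nonzero, but
        orthogonality of \<open>E\<close> and \<open>Y'\<close> passes to \<open>E\<close> and
        \<open>F\<close> only for such a factor.\<close>
      proof (cases "c = 0")
        case True
        then show ?thesis unfolding T_def E(2) Y F(2) using H(2) by (simp add: hs Hs lor_simps)
      next
        case False
        then have EF: "h E F = 0" "h F E = 0" using EY F hsym[of F E] by (simp_all add: hs)
        have kEF: "lor (H E E) (H F F) = k + lor (H E F) (H E F)" using k[OF E(1) F(1) EF(1)] by simp
        show ?thesis unfolding T_def E(2) Y F(2)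
          by (simp add: hs Hs lor_simps EF E(1) F(1) H(2)[of F E] lor_commute[of "H F F" "H E E"] kEF algebra_simps
              lor_commute[of "H E F" "H E E"] lor_commute[of "H F F" "H E F"])
      qed
    qed
  qed
  have "T X Y Z W = 0"
  proof (rule curvature_like_zero[of T, OF _ _ _ _ _ sec])
    show "T (X + X') Y Z W = T X Y Z W + T X' Y Z W" for X X' Y Z W
      unfolding T_def by (simp add: hs Hs lor_simps algebra_simps)
    show "T X Y Z W = - T Y X Z W" for X Y Z W unfolding T_def by (simp add: algebra_simps)
    show "T X Y Z W = - T X Y W Z" for X Y Z W
      unfolding T_def by (simp add: lor_commute[of "H Y W"] lor_commute[of "H X W"] algebra_simps)
    show "T X Y Z W = T Z W X Y" for X Y Z W
      unfolding T_def by (simp add: H(2)[of W] H(2)[of Z] hsym[of W] hsym[of Z] lor_commute[of "H X W"] algebra_simps)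
    show "T X Y Z W + T Y Z X W + T Z X Y W = 0" for X Y Z W
      unfolding T_def by (simp add: H(2)[of Y X] H(2)[of Z X] H(2)[of Z Y] hsym[of Y X] hsym[of Z X] hsym[of Z Y] algebra_simps)
  qed
  then show ?thesis unfolding T_def by simp
qed

context null_map begin

lemma riemann_eq:
  assumes x: "x \<in> D"
    and curv: "\<And>X Y Z W. lor (H x Y Z) (H x X W) - lor (H x X Z) (H x Y W) =
      k * (h x Y Z * h x X W - h x X Z * h x Y W)"
  shows "riemann h x X Y Z = k *\<^sub>R (h x Y Z *\<^sub>R X - h x X Z *\<^sub>R Y)"
proof (rule pos_form_eqI[OF pos_form_h[OF x]])
  show "h x (riemann h x X Y Z) W = h x (k *\<^sub>R (h x Y Z *\<^sub>R X - h x X Z *\<^sub>R Y)) W" for W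
    unfolding gauss_equation[OF x] curv
    by (simp add: bilinear_simps[OF pos_formD(1)[OF pos_form_h[OF x]]])
qed

lemma sectional_curv_eq:
  assumes x: "x \<in> D"
    and curv: "\<And>X Y Z W. lor (H x Y Z) (H x X W) - lor (H x X Z) (H x Y W) =
      k * (h x Y Z * h x X W - h x X Z * h x Y W)"
    and "X \<noteq> Y" "independent {X, Y}"
  shows "sectional_curv h x X Y = k"
proof -
  note hs = bilinear_simps[OF pos_formD(1)[OF pos_form_h[OF x]]] and hsym = pos_formD(2)[OF pos_form_h[OF x]]
  have X: "X \<noteq> 0" using assms(4) dependent_zero by auto
  have XX: "h x X X > 0" using pos[OF x X] .
  \<comment> \<open>The Gram-Schmidt residue of \<open>Y\<close>; its square times
    \<open>h x X X\<close> is the denominator of the sectional curvature, which is therefore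
    positive.\<close>
  define Z where "Z = Y - (h x X Y / h x X X) *\<^sub>R X"
  have "Z \<noteq> 0"
  proof
    assume "Z = 0"
    then have "Y = (h x X Y / h x X X) *\<^sub>R X" unfolding Z_def by simp
    then have "Y \<in> span {X}" by (metis span_base span_mul insertI1)
    then show False using assms(3,4) by (simp add: independent_insert insert_commute[of X Y])
  qed
  then have "h x Z Z > 0" using pos[OF x] by blast
  moreover have "h x Z Z = h x Y Y - (h x X Y)\<^sup>2 / h x X X"
    unfolding Z_def using XX hsym[of Y X] by (simp add: hs power2_eq_square field_simps)
  ultimately have "h x X X * h x Y Y - (h x X Y)\<^sup>2 > 0" using XX by (simp add: field_simps)
  moreover have "h x (riemann h x X Y Y) X = k * (h x X X * h x Y Y - (h x X Y)\<^sup>2)"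
    unfolding riemann_eq[OF x curv] using hsym[of Y X] by (simp add: hs power2_eq_square algebra_simps)
  ultimately show ?thesis unfolding sectional_curv_def by simp
qed

end

section \<open>The second fundamental form in a spaceform\<close>

locale spaceform_map = null_map D s
  for D :: "(real ^ 'm::finite) set" and s :: "real ^ 'm \<Rightarrow> 'e::euclidean_space \<times> real" +
  fixes v :: "'e \<times> real"
  assumes v_s: "x \<in> D \<Longrightarrow> lor v (s x) = -1"
begin

lemma v_ds: assumes x: "x \<in> D" shows "lor v (dd s x X) = 0"
proof -
  have 1: "((\<lambda>y. lor v (s y)) has_derivative (\<lambda>X. lor v (dd s x X))) (at x)"
    by (rule bounded_linear.has_derivative[OF lor.bounded_linear_right ds[OF x]])
  have "((\<lambda>y. lor v (s y)) has_derivative (\<lambda>X. 0)) (at x)"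
    by (rule has_derivative_transform_within_open[OF has_derivative_const open_D x]) (simp add: v_s)
  from fun_cong[OF has_derivative_unique[OF this 1], of X] show ?thesis by simp
qed

lemma v_d2s: assumes x: "x \<in> D" shows "lor v (d2 s x X Y) = 0"
proof -
  have 1: "((\<lambda>y. lor v (dd s y Y)) has_derivative (\<lambda>X. lor v (d2 s x X Y))) (at x)"
    by (rule bounded_linear.has_derivative[OF lor.bounded_linear_right d2s[OF x]])
  have "((\<lambda>y. lor v (dd s y Y)) has_derivative (\<lambda>X. 0)) (at x)"
    by (rule has_derivative_transform_within_open[OF has_derivative_const open_D x]) (simp add: v_ds)
  from fun_cong[OF has_derivative_unique[OF this 1], of X] show ?thesis by simp
qed

lemma v_H: "x \<in> D \<Longrightarrow> lor v (H x X Y) = 0" "x \<in> D \<Longrightarrow> lor (H x X Y) v = 0"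
  using lor_commute[of "H x X Y" v] by (simp_all add: H_def lor_simps v_ds v_d2s)

text \<open>The vector v + (v, v) s pairs to 0 with v and to -1 with s, while the hessian pairs to 0
  with v and to -h with s. Their combination is thus tangent to the spaceform, and it is already
  orthogonal to \<open>ds\<close>.\<close>

lemma spaceform_sff_eq:
  assumes x: "x \<in> D"
  shows "spaceform_sff v s x X Y = H x X Y - h x X Y *\<^sub>R (v + lor v v *\<^sub>R s x)"
proof -
  have s_v: "lor (s x) v = -1" using v_s[OF x] lor_commute by metis
  note simps = lor_simps v_s[OF x] s_v null[OF x] v_d2s[OF x] v_ds[OF x] s_ds[OF x] s_d2s[OF x]
    lor_commute[of "d2 s x X Y"] lor_commute[of "dd s x _" "s x"]
  define T where "T = spaceform_tangent v (s x)"
  have T: "u \<in> T \<longleftrightarrow> lor u v = 0 \<and> lor u (s x) = 0" for u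
    unfolding T_def spaceform_tangent_def lorth_def by auto
  define N where "N = spaceform_normal v s x"
  have N: "u \<in> N \<longleftrightarrow> lor u v = 0 \<and> lor u (s x) = 0 \<and> (\<forall>Z. lor u (dd s x Z) = 0)" for u
    unfolding N_def spaceform_normal_def using T unfolding T_def lorth_def by auto
  have sT: "subspace T" unfolding T_def spaceform_tangent_def by (rule subspace_lorth)
  have sN: "subspace N" unfolding subspace_def by (simp add: Ball_def N lor_simps)
  \<comment> \<open>Projection onto the orthogonal space of \<open>s x\<close> and \<open>v\<close>.
    The coefficients invert their Gram matrix, which has entries 0, -1, -1 and
    \<open>lor v v\<close>.\<close>
  define p where "p u = u - ((- lor u (s x)) * lor v v - lor u v) *\<^sub>R s x - (- lor u (s x)) *\<^sub>R v" for u
  have p: "p u \<in> T" "u - p u \<in> lorth T" for u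
    unfolding p_def T by (auto simp: simps lorth_def T lor_commute[of _ "_ :: 'e \<times> real"])
  have 1: "spaceform_nabla v s (\<lambda>y. dd s y Y) X x = d2 s x X Y - h x X Y *\<^sub>R (v + lor v v *\<^sub>R s x)"
    unfolding spaceform_nabla_def T_def[symmetric]
  proof (rule lproj_eqI[OF sT])
    show "\<exists>a\<in>T. u - a \<in> lorth T" for u using p by blast
    have "p (d2 s x X Y) = d2 s x X Y - h x X Y *\<^sub>R (v + lor v v *\<^sub>R s x)"
      unfolding p_def by (simp add: simps algebra_simps)
    then show "d2 s x X Y - h x X Y *\<^sub>R (v + lor v v *\<^sub>R s x) \<in> T"
      "d2 s x X Y - (d2 s x X Y - h x X Y *\<^sub>R (v + lor v v *\<^sub>R s x)) \<in> lorth T" using p by metis+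
  qed
  have dN: "dd s x Z \<in> lorth N" for Z
  proof (rule lorthI)
    fix u assume "u \<in> N"
    then have "lor u (dd s x Z) = 0" using N by blast
    then show "lor (dd s x Z) u = 0" by (simp add: lor_commute)
  qed
  define q where "q u = p u - dd s x (raise (h x) (\<lambda>Z. lor u (dd s x Z)))" for u
  have q: "q u \<in> N" "u - q u \<in> lorth N" for u
  proof -
    have "lor (dd s x (raise (h x) (\<lambda>Z. lor u (dd s x Z)))) (dd s x Z) = lor u (dd s x Z)" for Z
      using raise_cramer(1)[OF pos_form_h[OF x] linear_lor_ds[OF x]] by (simp add: lift_metric_def)
    moreover have "lor (p u) (dd s x Z) = lor u (dd s x Z)" for Z unfolding p_def by (simp add: simps)
    ultimately show "q u \<in> N" using p(1)[of u] unfolding N T q_def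
      by (simp add: lor_simps ds_s[OF x] lor_commute[of "dd s x _" v] v_ds[OF x])
    have "u - q u = (u - p u) + dd s x (raise (h x) (\<lambda>Z. lor u (dd s x Z)))" unfolding q_def by simp
    moreover have "u - p u \<in> lorth N" using p(2)[of u] N T unfolding lorth_def by blast
    ultimately show "u - q u \<in> lorth N" using subspace_add[OF subspace_lorth _ dN] by (simp only:)
  qed
  show ?thesis
    unfolding spaceform_sff_def N_def[symmetric] 1
  proof (rule lproj_eqI[OF sN])
    show "\<exists>a\<in>N. u - a \<in> lorth N" for u using q by blast
    show "H x X Y - h x X Y *\<^sub>R (v + lor v v *\<^sub>R s x) \<in> N"
      unfolding N by (simp add: lor_simps v_s[OF x] s_v null[OF x] v_H[OF x] s_H[OF x] H_normal[OF x] v_ds[OF x] s_ds[OF x])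
    show "d2 s x X Y - h x X Y *\<^sub>R (v + lor v v *\<^sub>R s x) - (H x X Y - h x X Y *\<^sub>R (v + lor v v *\<^sub>R s x)) \<in> lorth N"
      using dN by (simp add: H_def)
  qed
qed

text \<open>The correction vector v + (v, v) s has square - (v, v) and is orthogonal to the
  spaceform second fundamental form; this shifts \<open>K\<close> by - (v, v).\<close>

lemma constant_curvature:
  assumes x: "x \<in> D"
    and K: "\<And>X Y. h x X X = 1 \<Longrightarrow> h x Y Y = 1 \<Longrightarrow> h x X Y = 0 \<Longrightarrow>
      lor (spaceform_sff v s x X X) (spaceform_sff v s x Y Y)
        - lor (spaceform_sff v s x X Y) (spaceform_sff v s x X Y) = K"
  shows "lor (H x Y Z) (H x X W) - lor (H x X Z) (H x Y W) =
    (K - lor v v) * (h x Y Z * h x X W - h x X Z * h x Y W)"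
proof (rule gauss_form_constant[OF bilinear_H[OF x] H_sym[OF x] pos_form_h[OF x]])
  have s_v: "lor (s x) v = -1" using v_s[OF x] lor_commute by metis
  fix X Y assume XY: "h x X X = 1" "h x Y Y = 1" "h x X Y = 0"
  show "lor (H x X X) (H x Y Y) - lor (H x X Y) (H x X Y) = K - lor v v"
    using K[OF XY] unfolding spaceform_sff_eq[OF x]
    by (simp add: XY lor_simps v_s[OF x] s_v null[OF x] v_H[OF x] s_H[OF x])
qed

end

subsection \<open>Flat conformal representatives\<close>

text \<open>Upgrades smoothness of each \<open>F x X\<close> to smoothness of the operator: over
  \<open>Basis\<close> it is a finite sum of rank one operators that depend linearly on smooth
  vectors.\<close>

lemma smooth_family_blinfun:
  fixes F :: "'x::real_normed_vector \<Rightarrow> 'a::euclidean_space \<Rightarrow> 'v::real_normed_vector"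
  assumes S: "open S" and l: "\<And>x. x \<in> S \<Longrightarrow> linear (F x)" and s: "\<And>X. smooth_on S (\<lambda>x. F x X)"
  shows "smooth_on S (\<lambda>x. Blinfun (F x))" and "x \<in> S \<Longrightarrow> blinfun_apply (Blinfun (F x)) X = F x X"
proof -
  show *: "blinfun_apply (Blinfun (F x)) X = F x X" if "x \<in> S" for x X
    using bounded_linear_Blinfun_apply[of "F x"] linear_conv_bounded_linear[of "F x"] l[OF that] by simp
  let ?L = "\<lambda>b. \<lambda>w :: 'v. blinfun_scaleR_left w o\<^sub>L blinfun_inner_left (b :: 'a)"
  have bl: "bounded_linear (?L b)" for b
    by (rule bounded_linear_compose[OF bounded_bilinear.bounded_linear_left[OF bounded_bilinear_blinfun_compose]
          bounded_linear_blinfun_scaleR_left])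
  then have sm: "smooth_on S (\<lambda>x. \<Sum>b\<in>Basis. ?L b (F x b))"
    using smooth_on_bounded_linear[OF S bl s] by (intro smooth_on_sum[OF S])
  show "smooth_on S (\<lambda>x. Blinfun (F x))"
  proof (rule smooth_on_cong[OF S _ sm])
    fix x assume x: "x \<in> S"
    show "(\<Sum>b\<in>Basis. ?L b (F x b)) = Blinfun (F x)"
    proof (rule blinfun_eqI)
      fix X
      have "blinfun_apply (\<Sum>b\<in>Basis. ?L b (F x b)) X = (\<Sum>b\<in>Basis. (X \<bullet> b) *\<^sub>R F x b)"
        by (simp add: blinfun.sum_left)
      also have "\<dots> = F x (\<Sum>b\<in>Basis. (X \<bullet> b) *\<^sub>R b)"
        by (simp add: linear_sum[OF l[OF x]] linear_cmul[OF l[OF x]])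
      finally show "blinfun_apply (\<Sum>b\<in>Basis. ?L b (F x b)) X = blinfun_apply (Blinfun (F x)) X"
        by (simp add: *[OF x] euclidean_representation)
    qed
  qed
qed

text \<open>Bootstrapping: the equation expresses the derivative of \<open>\<Phi>\<close> through
  \<open>\<Phi>\<close> itself, so each order of regularity yields the next.\<close>

lemma smooth_on_parallel_section:
  fixes A :: "'a::real_normed_vector \<Rightarrow> ('a \<Rightarrow>\<^sub>L ('b::real_normed_vector \<Rightarrow>\<^sub>L 'b))"
  assumes S: "open S" and A: "smooth_on S A"
    and d: "\<And>x. x \<in> S \<Longrightarrow> (\<Phi> has_derivative (\<lambda>X. A x X (\<Phi> x))) (at x)"
  shows "smooth_on S \<Phi>"
  unfolding smooth_on_def
proof
  show "Ck_on k S \<Phi>" for k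
  proof (induction k)
    case 0
    show ?case using d has_derivative_continuous continuous_at_imp_continuous_on by (metis Ck_on.simps(1))
  next
    case (Suc k)
    have "Ck_on k S (\<lambda>x. blinfun_apply (A x) v)" for v
      by (rule Ck_on_bounded_linear_compose[OF S blinfun.bounded_linear_left])
        (use A in \<open>simp add: smooth_on_def\<close>)
    then have "Ck_on k S (\<lambda>x. blinfun_apply (blinfun_apply (A x) v) (\<Phi> x))" for v
      by (rule Ck_on_bilinear[OF S bounded_bilinear_blinfun_apply _ Suc.IH])
    from Ck_on_SucI[OF S d this] show ?case .
  qed
qed

locale constant_curvature_map = null_map D s
  for D :: "(real ^ 'm::finite) set" and s :: "real ^ 'm \<Rightarrow> 'e::euclidean_space \<times> real" +
  fixes k :: real
  assumes curv: "x \<in> D \<Longrightarrow> lor (H x Y Z) (H x X W) - lor (H x X Z) (H x Y W) =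
    k * (h x Y Z * h x X W - h x X Z * h x Y W)"
begin

text \<open>A metric \<open>\<phi>\<^sup>-\<^sup>2h\<close> is flat if \<open>\<phi> = \<psi> + \<epsilon>/2\<close> where \<open>\<epsilon>\<^sup>2 = 1\<close>, \<open>Dd\<psi> = -k\<psi>h\<close> and
  \<open>|d\<psi>|\<^sup>2 + k\<psi>\<^sup>2 = k/4\<close>. The pair \<open>(\<psi>, grad \<psi>)\<close> is parallel for a connection that is flat
  because \<open>h\<close> has constant curvature \<open>k\<close>.\<close>
lemma flat_lift:
  assumes x0: "x0 \<in> D" and \<epsilon>: "\<epsilon> * \<epsilon> = (1::real)"
  obtains U \<phi> where "open U" "x0 \<in> U" "U \<subseteq> D" "smooth_on U \<phi>" "\<And>x. x \<in> U \<Longrightarrow> \<epsilon> * \<phi> x > 0"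
    "\<And>x X Y Z W. x \<in> U \<Longrightarrow> (let t = \<lambda>y. (1 / \<phi> y) *\<^sub>R s y; C = cov_hessian (lift_metric t) t x in
      lor (C Y Z) (C X W) - lor (C X Z) (C Y W)) = 0"
proof -
  \<comment> \<open>The system for a function \<psi> and a vector field w: the first component says
    that w is the gradient of \<psi>, the second that D w = - k \<psi> id.\<close>
  define F :: "real ^ 'm \<Rightarrow> real ^ 'm \<Rightarrow> real \<times> (real ^ 'm) \<Rightarrow> real \<times> (real ^ 'm)"
    where "F x X p = (h x X (snd p), - \<Gamma> x X (snd p) - (k * fst p) *\<^sub>R X)" for x X p
  note hs = bilinear_simps[OF pos_formD(1)[OF pos_form_h]] and \<Gamma>s = bilinear_simps[OF bilinear_christoffel]
    and hsym = pos_formD(2)[OF pos_form_h]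
  have linF: "linear (F x X)" "linear (\<lambda>X. F x X p)" if "x \<in> D" for x X p
    unfolding F_def using that by (auto intro!: linearI simp: hs \<Gamma>s algebra_simps)
  have smoothF: "smooth_on D (\<lambda>x. F x X p)" for X p
  proof -
    have "smooth_on D (\<lambda>x. (h x X (snd p)) *\<^sub>R (1 :: real, 0 :: real ^ 'm))"
      by (intro smooth_intros open_D smooth_h)
    moreover have "smooth_on D (\<lambda>x. (0 :: real, - \<Gamma> x X (snd p) - (k * fst p) *\<^sub>R X))"
      by (rule smooth_on_bounded_linear[OF open_D, where L = "\<lambda>w. (0, w)"])
        (intro bounded_linear_Pair bounded_linear_zero bounded_linear_ident smooth_intros open_D smooth_christoffel)+
    ultimately show ?thesis using smooth_on_add[OF open_D] unfolding F_def by fastforce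
  qed
  define A where "A x = Blinfun (\<lambda>X. Blinfun (F x X))" for x
  note B = smooth_family_blinfun[OF open_D linF(1) smoothF]
  have A: "smooth_on D A" "\<And>x X p. x \<in> D \<Longrightarrow> A x X p = F x X p"
  proof -
    have l: "linear (\<lambda>X. Blinfun (F x X))" if "x \<in> D" for x
      using B(2)[OF _ that] that
      by (intro linearI blinfun_eqI) (simp_all add: blinfun.add_left blinfun.scaleR_left
          linear_add[OF linF(2)[OF that]] linear_cmul[OF linF(2)[OF that]])
    show "smooth_on D A" unfolding A_def by (rule smooth_family_blinfun(1)[OF open_D l B(1)])
    show "A x X p = F x X p" if "x \<in> D" for x X p
      unfolding A_def using smooth_family_blinfun(2)[OF open_D l B(1) that] B(2)[OF _ that] that by simp
  qed
  have ddA: "dd A x X Y p = dd (\<lambda>y. F y Y p) x X" if x: "x \<in> D" for x X Y p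
  proof -
    have "((\<lambda>y. A y Y p) has_derivative (\<lambda>X. dd A x X Y p)) (at x)"
      using bounded_linear.has_derivative[OF bounded_linear_compose[OF blinfun.bounded_linear_left[of p] blinfun.bounded_linear_left[of Y]]
          smooth_on_has_derivative[OF open_D A(1) x]] by simp
    then have "((\<lambda>y. F y Y p) has_derivative (\<lambda>X. dd A x X Y p)) (at x)"
      by (rule has_derivative_transform_within_open[OF _ open_D x]) (simp add: A(2))
    then show ?thesis by (rule dd_eqI[symmetric])
  qed
  have ddF: "dd (\<lambda>y. F y Y p) x X = (h x Y (\<Gamma> x X (snd p)) + h x (\<Gamma> x X Y) (snd p), - dd (\<lambda>y. \<Gamma> y Y (snd p)) x X)"
    if x: "x \<in> D" for x X Y p
  proof (rule dd_eqI)
    have 1: "((\<lambda>y. h y Y (snd p)) has_derivative (\<lambda>X. h x Y (\<Gamma> x X (snd p)) + h x (\<Gamma> x X Y) (snd p))) (at x)"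
    proof -
      have "((\<lambda>y. h y Y (snd p)) has_derivative (\<lambda>X. lor (dd s x Y) (d2 s x X (snd p)) + lor (d2 s x X Y) (dd s x (snd p)))) (at x)"
        unfolding lift_metric_def by (intro lor.FDERIV d2s x)
      moreover have "lor (dd s x Y) (d2 s x X (snd p)) = h x Y (\<Gamma> x X (snd p))" for X
        using h_christoffel[OF x] hsym[OF x] lor_commute by metis
      ultimately show ?thesis using h_christoffel[OF x] by simp
    qed
    have 2: "((\<lambda>y. \<Gamma> y Y (snd p)) has_derivative dd (\<lambda>y. \<Gamma> y Y (snd p)) x) (at x)"
      using smooth_on_has_derivative[OF open_D smooth_christoffel x] .
    show "((\<lambda>y. F y Y p) has_derivative (\<lambda>X. (h x Y (\<Gamma> x X (snd p)) + h x (\<Gamma> x X Y) (snd p), - dd (\<lambda>y. \<Gamma> y Y (snd p)) x X))) (at x)"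
      unfolding F_def by (intro has_derivative_Pair 1) (use 2 in \<open>auto intro!: derivative_eq_intros\<close>)
  qed
  \<comment> \<open>Symmetry in \<open>X\<close> and \<open>Y\<close> of the first component is
    torsion freeness. In the second the Christoffel terms combine to \<open>riemann\<close>, which
    the terms with \<open>k\<close> compensate.\<close>
  have flat: "dd A x X Y p + A x Y (A x X p) = dd A x Y X p + A x X (A x Y p)" if x: "x \<in> D" for x X Y p
  proof -
    have R: "riemann h x X Y (snd p) = k *\<^sub>R (h x Y (snd p) *\<^sub>R X - h x X (snd p) *\<^sub>R Y)" by (rule riemann_eq[OF x curv[OF x]])
    then have "dd (\<lambda>y. \<Gamma> y Y (snd p)) x X = dd (\<lambda>y. \<Gamma> y X (snd p)) x Y + \<Gamma> x Y (\<Gamma> x X (snd p)) - \<Gamma> x X (\<Gamma> x Y (snd p))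
      + k *\<^sub>R (h x Y (snd p) *\<^sub>R X - h x X (snd p) *\<^sub>R Y)" unfolding riemann_def by (simp add: algebra_simps)
    then show ?thesis
      unfolding ddA[OF x] A(2)[OF x] ddF[OF x]
      by (simp add: F_def hs[OF x] \<Gamma>s[OF x] christoffel_sym[OF x, of Y X] hsym[OF x, of Y X] algebra_simps)
  qed
  \<comment> \<open>With zero gradient and first entry \<open>\<epsilon> / 2\<close> the energy
    below starts at k/4, since the square of \<epsilon> is 1, and \<phi> starts at
    \<epsilon>.\<close>
  obtain r \<Phi> where r: "r > 0" "ball x0 r \<subseteq> D" and \<Phi>0: "\<Phi> x0 = (\<epsilon> / 2, 0)"
    and d\<Phi>: "\<And>x. x \<in> ball x0 r \<Longrightarrow> (\<Phi> has_derivative (\<lambda>X. A x X (\<Phi> x))) (at x)"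
    by (rule flat_connection_parallel_section[OF open_D x0 A(1) flat, where c = "(\<epsilon> / 2, 0)"]) (assumption, rule that)
  have smooth_\<Phi>: "smooth_on (ball x0 r) \<Phi>"
    by (rule smooth_on_parallel_section[OF open_ball smooth_on_subset[OF r(2) A(1)] d\<Phi>])
  define \<psi> where "\<psi> x = fst (\<Phi> x)" for x
  define w where "w x = snd (\<Phi> x)" for x
  have smooth_\<psi>: "smooth_on (ball x0 r) \<psi>" unfolding \<psi>_def
    by (intro smooth_on_bounded_linear[OF open_ball bounded_linear_fst] smooth_\<Phi>)
  have d\<psi>: "(\<psi> has_derivative (\<lambda>X. h x X (w x))) (at x)"
    and dw: "(w has_derivative (\<lambda>X. - \<Gamma> x X (w x) - (k * \<psi> x) *\<^sub>R X)) (at x)" if x: "x \<in> ball x0 r" for x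
    using has_derivative_fst[OF d\<Phi>[OF x]] has_derivative_snd[OF d\<Phi>[OF x]] A(2) x r(2)
    unfolding \<psi>_def w_def by (auto simp: F_def subset_iff)
  \<comment> \<open>A first integral: by the second equation the derivative of h(w, w) is - 2 k
    \<psi> d\<psi>.\<close>
  have energy: "h x (w x) (w x) + k * (\<psi> x * \<psi> x) = k / 4" if x: "x \<in> ball x0 r" for x
  proof -
    have "((\<lambda>y. h y (w y) (w y) + k * (\<psi> y * \<psi> y)) has_derivative (\<lambda>X. 0)) (at y within ball x0 r)"
      if y: "y \<in> ball x0 r" for y
    proof -
      have yD: "y \<in> D" using y r(2) by blast
      have "((\<lambda>y. h y (w y) (w y) + k * (\<psi> y * \<psi> y)) has_derivative
        (\<lambda>X. 2 * h y ((- \<Gamma> y X (w y) - (k * \<psi> y) *\<^sub>R X) + \<Gamma> y X (w y)) (w y)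
          + k * (\<psi> y * h y X (w y) + h y X (w y) * \<psi> y))) (at y)"
        by (intro has_derivative_add metric_compatible[OF yD dw[OF y]] has_derivative_mult_right has_derivative_mult d\<psi>[OF y])
      then have "((\<lambda>y. h y (w y) (w y) + k * (\<psi> y * \<psi> y)) has_derivative (\<lambda>X. 0)) (at y)"
        by (simp add: hs[OF yD] algebra_simps)
      then show ?thesis by (rule has_derivative_at_withinI)
    qed
    from has_derivative_zero_unique[OF convex_ball this x, of x0]
    have "h x (w x) (w x) + k * (\<psi> x * \<psi> x) = h x0 (w x0) (w x0) + k * (\<psi> x0 * \<psi> x0)" using r(1) by simp
    also have "\<dots> = k / 4"
      using \<epsilon> \<Phi>0 x0 by (simp add: w_def \<psi>_def hs)
    finally show ?thesis .
  qed
  define \<phi> where "\<phi> x = \<psi> x + \<epsilon> / 2" for x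
  \<comment> \<open>The region where \<phi> keeps the sign \<epsilon>, which is prescribed so that
    the final flat lift can be made positive.\<close>
  define U where "U = {x \<in> ball x0 r. \<epsilon> * \<phi> x > 0}"
  have smooth_\<phi>: "smooth_on (ball x0 r) \<phi>" unfolding \<phi>_def by (intro smooth_intros open_ball smooth_\<psi>)
  have U: "open U"
  proof -
    have "continuous_on (ball x0 r) (\<lambda>x. \<epsilon> * \<phi> x)"
      using smooth_on_continuous[OF smooth_\<phi>] by (intro continuous_intros)
    from continuous_open_preimage[OF this open_ball, of "{0<..}"]
    show ?thesis unfolding U_def by (simp add: vimage_def Int_def)
  qed
  have UD: "U \<subseteq> D" "U \<subseteq> ball x0 r" using r(2) unfolding U_def by auto
  interpret c: conformal_change U s \<phi>
    by unfold_locales (use U smooth_on_subset[OF UD(1) smooth] pos UD null smooth_on_subset[OF UD(2) smooth_\<phi>] in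
        \<open>auto simp: U_def\<close>)
  show ?thesis
  proof (rule that[OF U _ UD(1) smooth_on_subset[OF UD(2) smooth_\<phi>]])
    show "x0 \<in> U" unfolding U_def \<phi>_def \<psi>_def using r(1) \<Phi>0 \<epsilon> by simp
    show "\<epsilon> * \<phi> x > 0" if "x \<in> U" for x using that unfolding U_def by simp
    fix x X Y Z W assume xU: "x \<in> U"
    then have x: "x \<in> D" and xb: "x \<in> ball x0 r" and n: "\<phi> x \<noteq> 0" using UD unfolding U_def by auto
    have d\<phi>: "dd \<phi> y Z = h y Z (w y)" if "y \<in> ball x0 r" for y Z
      unfolding \<phi>_def by (rule dd_eqI) (use d\<psi>[OF that] in \<open>auto intro!: derivative_eq_intros\<close>)
    have grad: "c.grad x = w x"
      by (rule raise_unique[OF pos_form_h[OF x]]) (simp add: d\<phi>[OF xb] hsym[OF x])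
    have hess: "c.hess x X Y = - k * \<psi> x * h x X Y" for X Y
    proof -
      have "((\<lambda>y. h y Y (w y)) has_derivative
        (\<lambda>X. lor (dd s x Y) (d2 s x X (w x) + dd s x (- \<Gamma> x X (w x) - (k * \<psi> x) *\<^sub>R X))
          + lor (d2 s x X Y + dd s x 0) (dd s x (w x)))) (at x)"
        by (rule h_fields_has_derivative[OF x has_derivative_const dw[OF xb]])
      then have "((\<lambda>y. dd \<phi> y Y) has_derivative
        (\<lambda>X. lor (dd s x Y) (d2 s x X (w x) + dd s x (- \<Gamma> x X (w x) - (k * \<psi> x) *\<^sub>R X))
          + lor (d2 s x X Y + dd s x 0) (dd s x (w x)))) (at x)"
        by (rule has_derivative_transform_within_open[OF _ open_ball xb]) (simp add: d\<phi>)
      then have "d2 \<phi> x X Y = lor (dd s x Y) (d2 s x X (w x) + dd s x (- \<Gamma> x X (w x) - (k * \<psi> x) *\<^sub>R X))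
          + lor (d2 s x X Y + dd s x 0) (dd s x (w x))" by (rule dd_eqI)
      moreover have "lor (dd s x Y) (d2 s x X (w x)) = h x (\<Gamma> x X (w x)) Y"
        using h_christoffel[OF x, of X "w x" Y] by (simp add: lor_commute)
      moreover have "lor (d2 s x X Y) (dd s x (w x)) = h x (\<Gamma> x X Y) (w x)" using h_christoffel[OF x] by simp
      moreover have "lor (dd s x Y) (dd s x V) = h x V Y" for V by (simp add: lift_metric_def lor_commute)
      ultimately show ?thesis
        unfolding cov_hessian_def d\<phi>[OF xb]
        by (simp add: lor_simps linear_0[OF lin_ds[OF x]] hs[OF x])
    qed
    have "h x (w x) (w x) = k / 4 - k * (\<psi> x * \<psi> x)" using energy[OF xb] by simp
    \<comment> \<open>k/4 - k \<psi>^2 factors as k (\<epsilon>/2 - \<psi>)(\<epsilon>/2 + \<psi>),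
      and the last factor is \<phi>. This extra power of \<phi> reduces \<open>e\<close> to a
      constant multiple of \<open>h / \<phi>\<^sup>2\<close>.\<close>
    also have "\<dots> = k * (\<epsilon> - \<phi> x) * \<phi> x" unfolding \<phi>_def using \<epsilon> by (simp add: algebra_simps)
    finally have ww: "h x (w x) (w x) = k * (\<epsilon> - \<phi> x) * \<phi> x" .
    have \<psi>_eq: "\<psi> x = \<phi> x - \<epsilon> / 2" unfolding \<phi>_def by simp
    have e: "c.e x X Y = k * \<epsilon> / 2 * h x X Y / (\<phi> x)\<^sup>2" for X Y
      unfolding c.e_def hess grad ww \<psi>_eq using n
      by (simp add: field_simps power2_eq_square power3_eq_cube)
    have k': "lor (H x Y Z) (H x X W) = k * (h x Y Z * h x X W - h x X Z * h x Y W) + lor (H x X Z) (H x Y W)"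
      using curv[OF x, of Y Z X W] by simp
    have "lor (c.t.H x Y Z) (c.t.H x X W) - lor (c.t.H x X Z) (c.t.H x Y W) = 0"
      unfolding c.gauss_t[OF xU] e grad ww k' using n
      by (simp add: field_simps power2_eq_square power4_eq_xxxx)
    then show "(let t = \<lambda>y. (1 / \<phi> y) *\<^sub>R s y; C = cov_hessian (lift_metric t) t x in
      lor (C Y Z) (C X W) - lor (C X Z) (C Y W)) = 0" by (simp add: Let_def)
  qed
qed

end

section \<open>Surfaces\<close>

definition orthonormal_pair :: "(real ^ 'm \<Rightarrow> real ^ 'm \<Rightarrow> real) \<Rightarrow> real ^ 'm \<Rightarrow> real ^ 'm::finite \<Rightarrow> bool"
  where "orthonormal_pair h X Y \<longleftrightarrow> h X X = 1 \<and> h Y Y = 1 \<and> h X Y = 0"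

lemma orthonormal_pair_exists:
  fixes h :: "real ^ 'm::finite \<Rightarrow> real ^ 'm \<Rightarrow> real"
  assumes m: "CARD('m) = 2" and h: "pos_form h"
  obtains X Y where "orthonormal_pair h X Y"
proof -
  note hs = bilinear_simps[OF pos_formD(1)[OF h]] and hsym = pos_formD(2)[OF h]
  have unit: "h ((1 / sqrt (h X X)) *\<^sub>R X) ((1 / sqrt (h X X)) *\<^sub>R X) = 1" if "X \<noteq> 0" for X
    using pos_formD(3)[OF h that] by (simp add: hs)
  have "CARD('m) > 0" using m by simp
  then obtain i :: 'm where "i \<in> UNIV" by blast
  define X where "X = (1 / sqrt (h (axis i 1) (axis i 1))) *\<^sub>R (axis i 1 :: real ^ 'm)"
  have XX: "h X X = 1" unfolding X_def by (rule unit) (simp add: axis_eq_0_iff)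
  have "span {X} \<noteq> UNIV"
  proof
    assume "span {X} = UNIV"
    then have "dim {X} = dim (UNIV :: (real ^ 'm) set)" using dim_span[of "{X}"] by simp
    moreover have "dim {X} \<le> 1" using dim_le_card'[of "{X}"] by simp
    ultimately show False using m by simp
  qed
  then obtain Z where Z: "Z \<notin> span {X}" by blast
  define Y' where "Y' = Z - h X Z *\<^sub>R X"
  have "Y' \<noteq> 0"
  proof
    assume "Y' = 0"
    then have "Z = h X Z *\<^sub>R X" unfolding Y'_def by simp
    moreover have "h X Z *\<^sub>R X \<in> span {X}" by (intro span_mul span_base) simp
    ultimately show False using Z by simp
  qed
  define Y where "Y = (1 / sqrt (h Y' Y')) *\<^sub>R Y'"
  have "h X Y' = 0" unfolding Y'_def using XX by (simp add: hs)
  then have "h X Y = 0" unfolding Y_def by (simp add: hs)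
  moreover have "h Y Y = 1" unfolding Y_def by (rule unit[OF \<open>Y' \<noteq> 0\<close>])
  ultimately show ?thesis using that XX unfolding orthonormal_pair_def by blast
qed

lemma orthonormal_pair_expansion:
  fixes h :: "real ^ 'm::finite \<Rightarrow> real ^ 'm \<Rightarrow> real"
  assumes m: "CARD('m) = 2" and h: "pos_form h" and XY: "orthonormal_pair h X Y"
  shows "Z = h Z X *\<^sub>R X + h Z Y *\<^sub>R Y"
proof -
  note hs = bilinear_simps[OF pos_formD(1)[OF h]] and hsym = pos_formD(2)[OF h]
  have o: "h X X = 1" "h Y Y = 1" "h X Y = 0" "h Y X = 0" using XY hsym[of Y X] unfolding orthonormal_pair_def by auto
  have "X \<noteq> Y" using o by auto
  have "independent {X, Y}"
  proof (rule independent_if_scalars_zero)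
    fix f x assume *: "(\<Sum>x\<in>{X, Y}. f x *\<^sub>R x) = 0" and x: "x \<in> {X, Y}"
    have "f X *\<^sub>R X + f Y *\<^sub>R Y = 0" using * \<open>X \<noteq> Y\<close> by simp
    then have "h (f X *\<^sub>R X + f Y *\<^sub>R Y) X = h 0 X" "h (f X *\<^sub>R X + f Y *\<^sub>R Y) Y = h 0 Y" by simp_all
    then show "f x = 0" using x o by (auto simp: hs)
  qed simp
  moreover have "card {X, Y} = DIM(real ^ 'm)" using \<open>X \<noteq> Y\<close> m by simp
  ultimately have "UNIV \<subseteq> span {X, Y}" by (intro card_ge_dim_independent) auto
  then have "Z \<in> span {X, Y}" by blast
  then obtain a where "Z - a *\<^sub>R X \<in> span {Y}" unfolding span_breakdown_eq by blast
  then obtain b where "Z - a *\<^sub>R X = b *\<^sub>R Y" unfolding span_singleton by blast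
  then have "Z = a *\<^sub>R X + b *\<^sub>R Y" by (simp add: algebra_simps)
  then show ?thesis using o by (simp add: hs)
qed

text \<open>Column \<open>j\<close> of the inverse is the solution of the linear system for the
  vector dual to the coordinate \<open>j\<close>, so \<open>mtrace\<close> can be expressed by
  \<open>raise\<close>.\<close>

lemma matrix_inv_gram:
  fixes h :: "real ^ 'm::finite \<Rightarrow> real ^ 'm \<Rightarrow> real"
  assumes h: "pos_form h"
  shows "matrix_inv (\<chi> k l. h (axis k 1) (axis l 1)) $ i $ j = raise h (\<lambda>Z. Z $ j) $ i"
proof -
  let ?G = "\<chi> k l. h (axis k 1) (axis l 1)"
  have l: "linear (\<lambda>Z :: real ^ 'm. Z $ j)" by (intro linearI) auto
  let ?W = "raise h (\<lambda>Z. Z $ j)"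
  have GW: "?G *v ?W = axis j 1"
    using det_gram_nonzero(2)[OF h, of ?W] raise_cramer(1)[OF h l]
    by (simp add: vec_eq_iff axis_def)
  have "invertible ?G" using det_gram_nonzero(1)[OF h] invertible_det_nz by blast
  then have "matrix_inv ?G ** ?G = mat 1"
    unfolding invertible_def matrix_inv_def by (rule someI2_ex) blast
  then have "matrix_inv ?G *v (?G *v ?W) = ?W" by (simp add: matrix_vector_mul_assoc)
  then have "column j (matrix_inv ?G) = ?W" unfolding GW matrix_vector_mult_basis .
  then have "column j (matrix_inv ?G) $ i = ?W $ i" by (rule arg_cong)
  then show ?thesis by (simp add: column_def)
qed

text \<open>Expanding the dual coordinate vectors in the orthonormal pair shows that the inverse
  metric is the sum of the squares of \<open>X\<close> and \<open>Y\<close>.\<close>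

lemma mtrace_orthonormal:
  fixes h :: "real ^ 'm::finite \<Rightarrow> real ^ 'm \<Rightarrow> real" and B :: "real ^ 'm \<Rightarrow> real ^ 'm \<Rightarrow> 'v::real_vector"
  assumes m: "CARD('m) = 2" and h: "pos_form h" and XY: "orthonormal_pair h X Y" and B: "bilinear B"
  shows "mtrace h B = B X X + B Y Y"
proof -
  have l: "linear (\<lambda>Z :: real ^ 'm. Z $ j)" for j by (intro linearI) auto
  have W: "raise h (\<lambda>Z. Z $ j) = (X $ j) *\<^sub>R X + (Y $ j) *\<^sub>R Y" for j
    using orthonormal_pair_expansion[OF m h XY, of "raise h (\<lambda>Z. Z $ j)"] raise_cramer(1)[OF h l] by simp
  have e: "B Z Z = (\<Sum>i\<in>UNIV. \<Sum>j\<in>UNIV. (Z $ j * Z $ i) *\<^sub>R B (axis i 1) (axis j 1))" for Z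
  proof -
    have "B Z Z = (\<Sum>i\<in>UNIV. (Z $ i) *\<^sub>R B (axis i 1) Z)"
      by (rule linear_vec_expansion) (use B in \<open>simp add: bilinear_def\<close>)
    also have "\<dots> = (\<Sum>i\<in>UNIV. (Z $ i) *\<^sub>R (\<Sum>j\<in>UNIV. (Z $ j) *\<^sub>R B (axis i 1) (axis j 1)))"
      by (intro sum.cong refl arg_cong2[where f = scaleR] linear_vec_expansion) (use B in \<open>simp add: bilinear_def\<close>)
    finally show ?thesis by (simp add: scaleR_sum_right mult.commute)
  qed
  show ?thesis
    unfolding mtrace_def matrix_inv_gram[OF h] W e[of X] e[of Y]
    by (simp add: scaleR_add_left sum.distrib)
qed

text \<open>A symmetric operator S, extended as a derivation, acts on bivectors of a plane by its
  trace: SX wedge Y + X wedge SY = (tr S) X wedge Y. Here this is paired with \<open>w\<close> and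
  \<open>Z\<close>.\<close>

lemma symmetric_form_2d_identity:
  fixes h :: "real ^ 'm::finite \<Rightarrow> real ^ 'm \<Rightarrow> real"
  assumes m: "CARD('m) = 2" and h: "pos_form h" and E: "orthonormal_pair h E F"
    and S: "bilinear S" "\<And>X Y. S X Y = S Y X"
  shows "S X w * h Y Z - S Y w * h X Z + h w X * S Y Z - h w Y * S X Z =
    (S E E + S F F) * (h w X * h Y Z - h w Y * (h X Z :: real))"
proof -
  note hs = bilinear_simps[OF pos_formD(1)[OF h]] and hsym = pos_formD(2)[OF h] and Ss = bilinear_simps[OF S(1)]
  have o: "h E E = 1" "h F F = 1" "h E F = 0" "h F E = 0" using E hsym[of F E] unfolding orthonormal_pair_def by auto
  have ex: "\<exists>a b. X = a *\<^sub>R E + b *\<^sub>R F" for X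
    using orthonormal_pair_expansion[OF m h E, of X] by blast
  obtain a b where "X = a *\<^sub>R E + b *\<^sub>R F" using ex by blast
  moreover obtain c d where "Y = c *\<^sub>R E + d *\<^sub>R F" using ex by blast
  moreover obtain p q where "Z = p *\<^sub>R E + q *\<^sub>R F" using ex by blast
  moreover obtain r t where "w = r *\<^sub>R E + t *\<^sub>R F" using ex by blast
  ultimately show ?thesis by (simp add: hs Ss o S(2)[of F E] algebra_simps)
qed

text \<open>Passing from one orthonormal pair to another multiplies the Gauss expression by the
  square of the determinant of the change of basis, and that square is 1.\<close>

lemma gauss_form_2d:
  fixes H :: "real ^ 'm::finite \<Rightarrow> real ^ 'm \<Rightarrow> 'e::euclidean_space \<times> real"
  assumes m: "CARD('m) = 2" and h: "pos_form h" and E: "orthonormal_pair h E F"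
    and H: "bilinear H" "\<And>X Y. H X Y = H Y X"
  shows "lor (H Y Z) (H X W) - lor (H X Z) (H Y W) =
    (lor (H E E) (H F F) - lor (H E F) (H E F)) * (h Y Z * h X W - h X Z * h Y W)"
proof (rule gauss_form_constant[OF H h])
  note hs = bilinear_simps[OF pos_formD(1)[OF h]] and hsym = pos_formD(2)[OF h] and Hs = bilinear_simps[OF H(1)]
  have o: "h E E = 1" "h F F = 1" "h E F = 0" "h F E = 0" using E hsym[of F E] unfolding orthonormal_pair_def by auto
  fix X Y assume XY: "h X X = 1" "h Y Y = 1" "h X Y = 0"
  obtain a b where a: "X = a *\<^sub>R E + b *\<^sub>R F" using orthonormal_pair_expansion[OF m h E, of X] by blast
  obtain c d where c: "Y = c *\<^sub>R E + d *\<^sub>R F" using orthonormal_pair_expansion[OF m h E, of Y] by blast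
  note ab = a c
  let ?Q = "lor (H E E) (H F F) - lor (H E F) (H E F)"
  have "a * a + b * b = 1" "c * c + d * d = 1" "a * c + b * d = 0"
    using XY unfolding ab by (simp_all add: hs o mult.commute)
  then have det: "(a * d - b * c) * (a * d - b * c) = 1" by algebra
  have "lor (H X X) (H Y Y) - lor (H X Y) (H X Y) = (a * d - b * c) * (a * d - b * c) * ?Q"
    unfolding ab by (simp add: Hs lor_simps H(2)[of F E] lor_commute[of "H F F" "H E E"]
        lor_commute[of "H E F" "H E E"] lor_commute[of "H F F" "H E F"] algebra_simps)
  then show "lor (H X X) (H Y Y) - lor (H X Y) (H X Y) = ?Q" using det by simp
qed

subsection \<open>The Cotton--York equation for the difference tensor\<close>

context conformal_change begin

lemma dd_h_christoffel:
  assumes x: "x \<in> D"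
  shows "((\<lambda>y. h y Y Z) has_derivative (\<lambda>X. h x Y (\<Gamma> x X Z) + h x (\<Gamma> x X Y) Z)) (at x)"
proof -
  have "((\<lambda>y. h y Y Z) has_derivative (\<lambda>X. lor (dd s x Y) (d2 s x X Z) + lor (d2 s x X Y) (dd s x Z))) (at x)"
    unfolding lift_metric_def by (intro lor.FDERIV d2s x)
  moreover have "lor (dd s x Y) (d2 s x X Z) = h x Y (\<Gamma> x X Z)" for X
    using h_christoffel[OF x, of X Z Y] pos_formD(2)[OF pos_form_h[OF x]] lor_commute[of "dd s x Y"] by simp
  ultimately show ?thesis by (simp add: h_christoffel[OF x])
qed

lemma hess_alt: "hess x X Y = d2 \<phi> x X Y - dd \<phi> x (\<Gamma> x X Y)"
  unfolding cov_hessian_def ..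

lemma smooth_hess: "smooth_on D (\<lambda>x. hess x X Y)"
  unfolding hess_alt by (intro smooth_intros open_D smooth_on_dd smooth_\<phi> smooth_christoffel)

lemma hess_sym: "x \<in> D \<Longrightarrow> hess x X Y = hess x Y X"
  unfolding hess_alt using clairaut[OF open_D smooth_\<phi>] christoffel_sym by metis

lemma bilinear_hess: "x \<in> D \<Longrightarrow> bilinear (hess x)"
  unfolding hess_alt bilinear_def
  by (auto intro!: linearI simp: bilinear_simps[OF d2_bilinear[OF open_D smooth_\<phi>]] bilinear_simps[OF bilinear_christoffel]
      linear_add[OF lin_d\<phi>] linear_cmul[OF lin_d\<phi>] algebra_simps)

lemma h_grad_derivative:
  assumes x: "x \<in> D"
  shows "h x (dd grad x X + \<Gamma> x X (grad x)) Z = hess x X Z"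
proof -
  have g: "(grad has_derivative dd grad x) (at x)" by (rule smooth_on_has_derivative[OF open_D smooth_grad x])
  have "((\<lambda>y. h y (grad y) Z) has_derivative (\<lambda>X. lor (dd s x (grad x)) (d2 s x X Z + dd s x 0)
      + lor (d2 s x X (grad x) + dd s x (dd grad x X)) (dd s x Z))) (at x)"
    by (rule h_fields_has_derivative[OF x g has_derivative_const])
  then have "((\<lambda>y. dd \<phi> y Z) has_derivative (\<lambda>X. lor (dd s x (grad x)) (d2 s x X Z + dd s x 0)
      + lor (d2 s x X (grad x) + dd s x (dd grad x X)) (dd s x Z))) (at x)"
    by (rule has_derivative_transform_within_open[OF _ open_D x]) (simp add: h_grad)
  then have "d2 \<phi> x X Z = lor (dd s x (grad x)) (d2 s x X Z + dd s x 0)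
      + lor (d2 s x X (grad x) + dd s x (dd grad x X)) (dd s x Z)" by (rule dd_eqI)
  moreover have "lor (dd s x (grad x)) (d2 s x X Z) = dd \<phi> x (\<Gamma> x X Z)"
    using h_christoffel[OF x, of X Z "grad x"] h_grad[OF x, of "\<Gamma> x X Z"] pos_formD(2)[OF pos_form_h[OF x]]
      lor_commute[of "dd s x (grad x)"] by simp
  moreover have "h x (dd grad x X + \<Gamma> x X (grad x)) Z = lor (dd s x (dd grad x X)) (dd s x Z) + lor (d2 s x X (grad x)) (dd s x Z)"
    using h_christoffel[OF x] bilinear_simps(1)[OF pos_formD(1)[OF pos_form_h[OF x]]] by (simp add: lift_metric_def)
  ultimately show ?thesis
    unfolding hess_alt by (simp add: lor_simps linear_0[OF lin_ds[OF x]])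
qed

lemma hess_derivative:
  assumes x: "x \<in> D"
  shows "((\<lambda>y. hess y Y Z) has_derivative (\<lambda>X. d2 (\<lambda>y. dd \<phi> y Z) x X Y
    - (d2 \<phi> x X (\<Gamma> x Y Z) + dd \<phi> x (dd (\<lambda>y. \<Gamma> y Y Z) x X)))) (at x)"
  unfolding hess_alt
  by (intro has_derivative_diff has_derivative_dd_field[OF open_D smooth_\<phi> x]
      smooth_on_has_derivative[OF open_D _ x] smooth_on_dd smooth_\<phi> smooth_christoffel)

text \<open>Third derivatives of \<phi> cancel by symmetry; the remaining Christoffel terms assemble
  to \<open>riemann\<close>.\<close>

lemma ricci_identity:
  assumes x: "x \<in> D"
  shows "cov_bilin h hess x X Y Z - cov_bilin h hess x Y X Z = - dd \<phi> x (riemann h x X Y Z)"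
proof -
  have "d2 (\<lambda>y. dd \<phi> y Z) x X Y = d2 (\<lambda>y. dd \<phi> y Z) x Y X"
    by (rule clairaut[OF open_D smooth_on_dd[OF smooth_\<phi>] x])
  moreover have "dd (\<lambda>y. hess y Y Z) x X = d2 (\<lambda>y. dd \<phi> y Z) x X Y
    - (d2 \<phi> x X (\<Gamma> x Y Z) + dd \<phi> x (dd (\<lambda>y. \<Gamma> y Y Z) x X))" for X Y
    by (rule dd_eqI[OF hess_derivative[OF x]])
  ultimately show ?thesis
    unfolding cov_bilin_def riemann_def using christoffel_sym[OF x, of Y X]
    by (simp add: hess_alt linear_add[OF lin_d\<phi>[OF x]] linear_diff[OF lin_d\<phi>[OF x]])
qed

definition \<rho> where "\<rho> k x = (k + h x (grad x) (grad x)) / (2 * (\<phi> x)\<^sup>2)"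
text \<open>A Schouten tensor of \<open>h\<close>: the conformal transformation law to the metric
  \<open>h / \<phi>\<^sup>2\<close> takes it to \<open>k / 2\<close> times that metric.\<close>

definition p where "p k x X Y = \<rho> k x * h x X Y - hess x X Y / \<phi> x"

lemma smooth_p: "smooth_on D (\<lambda>x. p k x X Y)"
proof -
  have "smooth_on D (\<lambda>x. h x (grad x) (grad x))"
  proof (rule smooth_on_cong[OF open_D])
    show "smooth_on D (\<lambda>x. lor (dd s x (grad x)) (dd s x (grad x)))"
      by (intro smooth_on_lor smooth_on_dd_field open_D smooth smooth_grad)
  qed (simp add: lift_metric_def)
  moreover have "smooth_on D (\<lambda>x. (\<phi> x)\<^sup>2)"
    unfolding power2_eq_square by (intro smooth_intros open_D smooth_\<phi>)
  ultimately show ?thesis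
    unfolding p_def \<rho>_def using \<phi>_nz by (intro smooth_intros open_D smooth_h smooth_hess smooth_\<phi>) auto
qed

text \<open>The hypothesis on \<open>k\<close> is the conformal change of Gauss curvature at
  \<open>x\<close>. The hessian terms reduce to their trace by
  \<open>symmetric_form_2d_identity\<close>, the third order terms to curvature by
  \<open>ricci_identity\<close>; all are multiples of d\<phi>(X) h(Y, Z) - d\<phi>(Y) h(X, Z), and
  by that hypothesis the coefficients add up to 0.\<close>

lemma codazzi_p:
  assumes m: "CARD('m) = 2" and x: "x \<in> D" and E: "orthonormal_pair (h x) E F"
    and k: "k = (\<phi> x)\<^sup>2 * (lor (H x E E) (H x F F) - lor (H x E F) (H x E F))
      + \<phi> x * (hess x E E + hess x F F) - h x (grad x) (grad x)"
  shows "cov_bilin h (p k) x X Y Z = cov_bilin h (p k) x Y X Z"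
proof -
  note hs = bilinear_simps[OF pos_formD(1)[OF pos_form_h[OF x]]] and hsym = pos_formD(2)[OF pos_form_h[OF x]]
    and n = \<phi>_nz[OF x]
  define K where "K = lor (H x E E) (H x F F) - lor (H x E F) (H x E F)"
  define \<Delta> where "\<Delta> = hess x E E + hess x F F"
  define ww where "ww = h x (grad x) (grad x)"
  have R: "riemann h x X Y Z = K *\<^sub>R (h x Y Z *\<^sub>R X - h x X Z *\<^sub>R Y)"
    unfolding K_def by (rule riemann_eq[OF x gauss_form_2d[OF m pos_form_h[OF x] E bilinear_H[OF x] H_sym[OF x]]])
  have d\<rho>: "(\<rho> k has_derivative (\<lambda>X. hess x X (grad x) / (\<phi> x)\<^sup>2 - (k + ww) * dd \<phi> x X / (\<phi> x)^3)) (at x)"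
  proof -
    have "((\<lambda>y. h y (grad y) (grad y)) has_derivative (\<lambda>X. 2 * h x (dd grad x X + \<Gamma> x X (grad x)) (grad x))) (at x)"
      by (rule metric_compatible[OF x smooth_on_has_derivative[OF open_D smooth_grad x]])
    then have 1: "((\<lambda>y. h y (grad y) (grad y)) has_derivative (\<lambda>X. 2 * hess x X (grad x))) (at x)"
      unfolding h_grad_derivative[OF x] .
    show ?thesis unfolding \<rho>_def ww_def
      using d\<phi>[OF x] 1 n by (auto intro!: derivative_eq_intros simp: fun_eq_iff field_simps power2_eq_square power3_eq_cube)
  qed
  have dp: "dd (\<lambda>y. p k y Y Z) x X =
      (\<rho> k x * (h x Y (\<Gamma> x X Z) + h x (\<Gamma> x X Y) Z)
        + (hess x X (grad x) / (\<phi> x)\<^sup>2 - (k + ww) * dd \<phi> x X / (\<phi> x)^3) * h x Y Z)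
      - (dd (\<lambda>y. hess y Y Z) x X / \<phi> x - hess x Y Z * dd \<phi> x X / (\<phi> x)\<^sup>2)" for X Y Z
  proof (rule dd_eqI, unfold p_def, rule has_derivative_diff)
    show "((\<lambda>y. \<rho> k y * h y Y Z) has_derivative (\<lambda>X. \<rho> k x * (h x Y (\<Gamma> x X Z) + h x (\<Gamma> x X Y) Z)
        + (hess x X (grad x) / (\<phi> x)\<^sup>2 - (k + ww) * dd \<phi> x X / (\<phi> x)^3) * h x Y Z)) (at x)"
      by (rule has_derivative_mult[OF d\<rho> dd_h_christoffel[OF x]])
    show "((\<lambda>y. hess y Y Z / \<phi> y) has_derivative
        (\<lambda>X. dd (\<lambda>y. hess y Y Z) x X / \<phi> x - hess x Y Z * dd \<phi> x X / (\<phi> x)\<^sup>2)) (at x)"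
      using smooth_on_has_derivative[OF open_D smooth_hess x, of Y Z] d\<phi>[OF x] n
      by (auto intro!: derivative_eq_intros simp: field_simps power2_eq_square)
  qed
  have cov: "cov_bilin h (p k) x X Y Z = (hess x X (grad x) / (\<phi> x)\<^sup>2 - (k + ww) * dd \<phi> x X / (\<phi> x)^3) * h x Y Z
      + hess x Y Z * dd \<phi> x X / (\<phi> x)\<^sup>2 - cov_bilin h hess x X Y Z / \<phi> x" for X Y Z
    unfolding cov_bilin_def dp using n by (simp add: p_def diff_divide_distrib add_divide_distrib algebra_simps)
  have k': "k = (\<phi> x)\<^sup>2 * K + \<phi> x * \<Delta> - ww" using k unfolding K_def \<Delta>_def ww_def .
  have id: "hess x X (grad x) * h x Y Z - hess x Y (grad x) * h x X Z + dd \<phi> x X * hess x Y Z - dd \<phi> x Y * hess x X Z =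
    \<Delta> * (dd \<phi> x X * h x Y Z - dd \<phi> x Y * h x X Z)"
    using symmetric_form_2d_identity[OF m pos_form_h[OF x] E bilinear_hess[OF x] hess_sym[OF x], of X "grad x" Y Z]
    unfolding h_grad[OF x] \<Delta>_def .
  have ric: "cov_bilin h hess x X Y Z - cov_bilin h hess x Y X Z = - K * (h x Y Z * dd \<phi> x X - h x X Z * dd \<phi> x Y)"
    unfolding ricci_identity[OF x] R
    by (simp add: linear_cmul[OF lin_d\<phi>[OF x]] linear_diff[OF lin_d\<phi>[OF x]] algebra_simps)
  have "cov_bilin h (p k) x X Y Z - cov_bilin h (p k) x Y X Z =
    (hess x X (grad x) * h x Y Z - hess x Y (grad x) * h x X Z + dd \<phi> x X * hess x Y Z - dd \<phi> x Y * hess x X Z) / (\<phi> x)\<^sup>2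
    - (k + ww) / (\<phi> x)^3 * (dd \<phi> x X * h x Y Z - dd \<phi> x Y * h x X Z)
    - (cov_bilin h hess x X Y Z - cov_bilin h hess x Y X Z) / \<phi> x"
    unfolding cov using n by (simp add: diff_divide_distrib add_divide_distrib algebra_simps)
  also have "\<dots> = 0" unfolding id ric k' using n
    by (simp add: field_simps power2_eq_square power3_eq_cube)
  finally show ?thesis by simp
qed

end

section \<open>The central sphere congruence of a surface\<close>

text \<open>The fibre of the mean curvature sphere congruence. The last generator is the
  \<open>h\<close>-trace of the second derivative of \<open>s\<close>; admitting all orthonormal
  pairs avoids the choice of one.\<close>

definition central_span :: "(real ^ 'm::finite \<Rightarrow> 'e::euclidean_space \<times> real) \<Rightarrow> real ^ 'm \<Rightarrow> ('e \<times> real) set"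
  where "central_span s x = span ({s x} \<union> range (dd s x) \<union>
    {d2 s x X X + d2 s x Y Y |X Y. orthonormal_pair (lift_metric s x) X Y})"

text \<open>Splitting along \<open>P\<close> and \<open>N\<close> shows that \<open>W\<close> meets
  its orthogonal space only in 0; a dimension count then shows that the two span everything.\<close>

lemma has_signatureD:
  assumes "has_signature W a b"
  shows "subspace W" "dim W = a + b" "\<exists>w\<in>W. u - w \<in> lorth W"
proof -
  from assms obtain P N where PN: "subspace P" "subspace N" "dim P = a" "dim N = b"
    "\<forall>v\<in>P. v \<noteq> 0 \<longrightarrow> lor v v > 0" "\<forall>v\<in>N. v \<noteq> 0 \<longrightarrow> lor v v < 0"
    "\<forall>v\<in>P. \<forall>w\<in>N. lor v w = 0" "W = {v + w |v w. v \<in> P \<and> w \<in> N}"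
    unfolding has_signature_def by blast
  show sW: "subspace W" unfolding PN(8) by (rule subspace_sums[OF PN(1,2)])
  have "P \<inter> N = {0}"
  proof -
    have "v = 0" if "v \<in> P" "v \<in> N" for v
    proof (rule ccontr)
      assume "v \<noteq> 0"
      then have "lor v v > 0" "lor v v < 0" using PN(5,6) that by blast+
      then show False by simp
    qed
    then show ?thesis using subspace_0[OF PN(1)] subspace_0[OF PN(2)] by blast
  qed
  then show dW: "dim W = a + b" using dim_sums_Int[OF PN(1,2)] unfolding PN(8) PN(3)[symmetric] PN(4)[symmetric]
    by (simp add: dim_eq_0[THEN iffD2])
  have trivial: "d = 0" if d: "d \<in> W" "d \<in> lorth W" for d
  proof -
    obtain p n where pn: "d = p + n" "p \<in> P" "n \<in> N" using d(1) unfolding PN(8) by blast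
    have pW: "p \<in> W" using pn(2) subspace_0[OF PN(2)] unfolding PN(8)
      by (intro CollectI exI[of _ p] exI[of _ 0]) simp
    have nW: "n \<in> W" using pn(3) subspace_0[OF PN(1)] unfolding PN(8)
      by (intro CollectI exI[of _ 0] exI[of _ n]) simp
    have "lor p n = 0" "lor n p = 0" using PN(7) pn lor_commute[of p n] by auto
    then have "lor p p = 0" "lor n n = 0"
      using lorthD[OF d(2) pW] lorthD[OF d(2) nW] unfolding pn(1) by (simp_all add: lor_simps)
    then have "p = 0" "n = 0" using bspec[OF PN(5) pn(2)] bspec[OF PN(6) pn(3)] by auto
    then show ?thesis using pn(1) by simp
  qed
  let ?J = "\<lambda>w :: 'a \<times> real. (fst w, - snd w)"
  have linJ: "linear ?J" by (intro linearI) (auto simp: scaleR_prod_def)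
  have J: "lor d w = d \<bullet> ?J w" for d w by (simp add: lor_def inner_prod_def)
  have "inj ?J" by (auto simp: inj_on_def prod_eq_iff)
  have sJ: "subspace (?J ` W)" by (rule linear_subspace_image[OF linJ sW])
  have dJ: "dim (?J ` W) = dim W" by (rule dim_image_eq[OF linJ]) (use \<open>inj ?J\<close> inj_on_subset in auto)
  have perp: "lorth W = {y \<in> UNIV. \<forall>x\<in>?J ` W. orthogonal x y}"
    unfolding lorth_def J orthogonal_def by (auto simp: inner_commute)
  have "dim (lorth W) + dim W = dim (UNIV :: ('a \<times> real) set)"
    using dim_subspace_orthogonal_to_vectors[OF sJ subspace_UNIV] unfolding perp dJ by simp
  moreover have "W \<inter> lorth W = {0}"
    using trivial subspace_0[OF sW] subspace_0[OF subspace_lorth] by blast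
  then have "dim {v + w |v w. v \<in> W \<and> w \<in> lorth W} = dim W + dim (lorth W)"
    using dim_sums_Int[OF sW subspace_lorth[of W]] by (simp add: dim_eq_0[THEN iffD2])
  ultimately have "dim {v + w |v w. v \<in> W \<and> w \<in> lorth W} = dim (UNIV :: ('a \<times> real) set)" by simp
  then have "{v + w |v w. v \<in> W \<and> w \<in> lorth W} = UNIV"
    by (intro subspace_dim_equal[OF subspace_sums[OF sW subspace_lorth] subspace_UNIV]) auto
  then have "u \<in> {v + w |v w. v \<in> W \<and> w \<in> lorth W}" by simp
  then obtain w n where wn: "u = w + n" "w \<in> W" "n \<in> lorth W" by blast
  show "\<exists>w\<in>W. u - w \<in> lorth W" by (rule bexI[OF _ wn(2)]) (simp add: wn)
qed

locale null_surface = null_map D s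
  for D :: "(real ^ 'm::finite) set" and s :: "real ^ 'm \<Rightarrow> 'e::euclidean_space \<times> real" +
  assumes card: "CARD('m) = 2"
begin

definition mean where "mean x = (1 / 2) *\<^sub>R mtrace (h x) (H x)"

text \<open>The second null direction of \<open>V \<inter> (ds)\<^sup>\<bottom>\<close>, normalized by \<open>(s, hat) = -1\<close>.\<close>
definition hat where "hat x = mean x + (lor (mean x) (mean x) / 2) *\<^sub>R s x"

text \<open>Minus the coefficient of \<open>s x\<close> when the hessian is expressed in the frame
  of \<open>s\<close>, \<open>hat\<close>, \<open>ds\<close> and a normal vector.\<close>

definition \<eta> where "\<eta> x X Y = lor (H x X Y) (hat x)"

lemma orthonormal_exists: "x \<in> D \<Longrightarrow> \<exists>E F. orthonormal_pair (h x) E F"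
  using orthonormal_pair_exists[OF card pos_form_h] by metis

lemma mean_eq:
  assumes "x \<in> D" "orthonormal_pair (h x) E F"
  shows "mean x = (1 / 2) *\<^sub>R (H x E E + H x F F)"
  unfolding mean_def mtrace_orthonormal[OF card pos_form_h[OF assms(1)] assms(2) bilinear_H[OF assms(1)]] ..

lemma mean_lor:
  assumes x: "x \<in> D"
  shows "lor (mean x) (s x) = -1" "lor (mean x) (dd s x Z) = 0"
proof -
  obtain E F where E: "orthonormal_pair (h x) E F" using orthonormal_exists[OF x] by blast
  then show "lor (mean x) (s x) = -1" "lor (mean x) (dd s x Z) = 0"
    unfolding mean_eq[OF x E] orthonormal_pair_def
    by (simp_all add: lor_simps s_H[OF x] H_normal[OF x])
qed

lemma hat_lor:
  assumes x: "x \<in> D"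
  shows "lor (hat x) (s x) = -1" "lor (s x) (hat x) = -1" "lor (hat x) (hat x) = 0"
    "lor (hat x) (dd s x Z) = 0" "lor (dd s x Z) (hat x) = 0"
proof -
  show *: "lor (hat x) (s x) = -1" "lor (hat x) (dd s x Z) = 0"
    unfolding hat_def by (simp_all add: lor_simps mean_lor[OF x] null[OF x] s_ds[OF x])
  then show "lor (s x) (hat x) = -1" "lor (dd s x Z) (hat x) = 0" using lor_commute by metis+
  have "lor (s x) (mean x) = -1" using mean_lor(1)[OF x] lor_commute by metis
  then show "lor (hat x) (hat x) = 0"
    unfolding hat_def by (simp add: lor_simps mean_lor[OF x] null[OF x])
qed

lemma s_nonzero: "x \<in> D \<Longrightarrow> s x \<noteq> 0"
  using hat_lor(1) by (metis lor.zero_right zero_neq_neg_one)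

lemma smooth_H: "smooth_on D (\<lambda>x. H x X Y)"
  unfolding H_def by (intro smooth_intros open_D smooth_on_dd smooth smooth_christoffel)

lemma smooth_mean: "smooth_on D mean"
proof (rule smooth_on_cong[OF open_D])
  have l: "linear (\<lambda>Z :: real ^ 'm. Z $ j)" for j by (intro linearI) auto
  show "smooth_on D (\<lambda>x. (1 / 2) *\<^sub>R (\<Sum>i\<in>UNIV. \<Sum>j\<in>UNIV.
      (raise (h x) (\<lambda>Z. Z $ j) $ i) *\<^sub>R H x (axis i 1) (axis j 1)))"
    by (intro smooth_on_scaleR smooth_on_sum smooth_on_const smooth_on_vec_nth smooth_on_raise
        open_D smooth_H pos_form_h smooth_h l)
  show "(1 / 2) *\<^sub>R (\<Sum>i\<in>UNIV. \<Sum>j\<in>UNIV.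
      (raise (h x) (\<lambda>Z. Z $ j) $ i) *\<^sub>R H x (axis i 1) (axis j 1)) = mean x" if "x \<in> D" for x
    unfolding mean_def mtrace_def matrix_inv_gram[OF pos_form_h[OF that]] ..
qed

lemma smooth_hat: "smooth_on D hat"
  unfolding hat_def by (intro smooth_intros open_D smooth_mean smooth) simp

text \<open>Coordinates on the central sphere: two null directions with product -1 and the tangent
  plane orthogonal to both, so that components are read off by pairing.\<close>

definition frame where "frame x p = fst p *\<^sub>R s x + fst (snd p) *\<^sub>R hat x + dd s x (snd (snd p))" for p :: "real \<times> real \<times> (real ^ 'm)"

lemma linear_frame: "x \<in> D \<Longrightarrow> linear (frame x)"
  unfolding frame_def using linear_add[OF lin_ds] linear_cmul[OF lin_ds]
  by (intro linearI) (auto simp: algebra_simps)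

lemma frame_lor:
  assumes x: "x \<in> D"
  shows "lor (frame x p) (s x) = - fst (snd p)" "lor (frame x p) (hat x) = - fst p"
    "lor (frame x p) (dd s x Z) = h x (snd (snd p)) Z"
  unfolding frame_def by (simp_all add: lor_simps hat_lor[OF x] null[OF x] s_ds[OF x] ds_s[OF x] lift_metric_def)

lemma inj_frame: assumes x: "x \<in> D" shows "inj (frame x)"
proof (rule injI)
  fix p q assume eq: "frame x p = frame x q"
  have "snd (snd p) = snd (snd q)"
    by (rule pos_form_eqI[OF pos_form_h[OF x]]) (metis eq frame_lor(3)[OF x])
  moreover have "fst p = fst q" "fst (snd p) = fst (snd q)"
    using frame_lor(1,2)[OF x, of p] frame_lor(1,2)[OF x, of q] eq by simp_all
  ultimately show "p = q" by (simp add: prod_eq_iff)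
qed

lemma mean_central:
  assumes x: "x \<in> D" and E: "orthonormal_pair (h x) E F"
  shows "d2 s x E E + d2 s x F F = frame x (- lor (mean x) (mean x), 2, \<Gamma> x E E + \<Gamma> x F F)"
proof -
  have "d2 s x X Y = H x X Y + dd s x (\<Gamma> x X Y)" for X Y by (simp add: H_def)
  then have "d2 s x E E + d2 s x F F = 2 *\<^sub>R mean x + dd s x (\<Gamma> x E E + \<Gamma> x F F)"
    unfolding mean_eq[OF x E] by (simp add: linear_add[OF lin_ds[OF x]])
  then show ?thesis unfolding frame_def hat_def by (simp add: algebra_simps)
qed

lemma central_span_eq:
  assumes x: "x \<in> D"
  shows "central_span s x = range (frame x)"
proof
  show "central_span s x \<subseteq> range (frame x)"
    unfolding central_span_def
  proof (rule span_minimal)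
    have "s x = frame x (1, 0, 0)" "dd s x W = frame x (0, 0, W)" for W
      unfolding frame_def by (simp_all add: linear_0[OF lin_ds[OF x]])
    then show "{s x} \<union> range (dd s x) \<union> {d2 s x X X + d2 s x Y Y |X Y. orthonormal_pair (h x) X Y} \<subseteq> range (frame x)"
      using mean_central[OF x] by (auto simp del: Un_insert_left)
    show "subspace (range (frame x))" by (rule linear_subspace_image[OF linear_frame[OF x] subspace_UNIV])
  qed
  obtain E F where E: "orthonormal_pair (h x) E F" using orthonormal_exists[OF x] by blast
  let ?V = "central_span s x"
  have V: "s x \<in> ?V" "\<And>W. dd s x W \<in> ?V" "d2 s x E E + d2 s x F F \<in> ?V"
    unfolding central_span_def using E by (auto intro!: span_base)
  have sV: "subspace ?V" unfolding central_span_def by (rule subspace_span)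
  note cl = subspace_add[OF sV] subspace_diff[OF sV] subspace_scale[OF sV]
  have "hat x = (1 / 2) *\<^sub>R ((d2 s x E E + d2 s x F F) - dd s x (\<Gamma> x E E + \<Gamma> x F F) + lor (mean x) (mean x) *\<^sub>R s x)"
    unfolding mean_central[OF x E] frame_def by (simp add: algebra_simps)
  moreover have "(1 / 2) *\<^sub>R (m - dd s x Z + c *\<^sub>R s x) \<in> ?V" if "m \<in> ?V" for m Z c
    by (intro cl that V(1,2))
  ultimately have "hat x \<in> ?V" using V(3) by simp
  then show "range (frame x) \<subseteq> ?V" using V unfolding frame_def by (auto intro!: cl)
qed

lemma subspace_central_span: "subspace (central_span s x)"
  unfolding central_span_def by (rule subspace_span)

lemma central_span_mem:
  "s x \<in> central_span s x" "dd s x W \<in> central_span s x" "x \<in> D \<Longrightarrow> hat x \<in> central_span s x"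
proof -
  show "s x \<in> central_span s x" "dd s x W \<in> central_span s x"
    unfolding central_span_def by (auto intro!: span_base)
  assume x: "x \<in> D"
  have "hat x = frame x (0, 1, 0)" unfolding frame_def by (simp add: linear_0[OF lin_ds[OF x]])
  then show "hat x \<in> central_span s x" unfolding central_span_eq[OF x] by blast
qed

lemma dim_central_span: assumes x: "x \<in> D" shows "dim (central_span s x) = 4"
proof -
  have "dim (range (frame x)) = dim (UNIV :: (real \<times> real \<times> (real ^ 'm)) set)"
    by (rule dim_image_eq[OF linear_frame[OF x]]) (use inj_frame[OF x] inj_on_subset in auto)
  then show ?thesis unfolding central_span_eq[OF x] using card by simp
qed

lemma lorth_central_span:
  assumes x: "x \<in> D"
  shows "u \<in> lorth (central_span s x) \<longleftrightarrow> lor u (s x) = 0 \<and> lor u (hat x) = 0 \<and> (\<forall>Z. lor u (dd s x Z) = 0)"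
proof
  assume "u \<in> lorth (central_span s x)"
  then show "lor u (s x) = 0 \<and> lor u (hat x) = 0 \<and> (\<forall>Z. lor u (dd s x Z) = 0)"
    using lorthD central_span_mem x by blast
next
  assume "lor u (s x) = 0 \<and> lor u (hat x) = 0 \<and> (\<forall>Z. lor u (dd s x Z) = 0)"
  then show "u \<in> lorth (central_span s x)"
    unfolding central_span_eq[OF x] lorth_def frame_def by (auto simp: lor_simps)
qed

lemma signature_central_span:
  assumes x: "x \<in> D"
  shows "has_signature (central_span s x) 3 1"
  unfolding has_signature_def
proof (intro exI conjI)
  \<comment> \<open>The plane of \<open>s\<close> and \<open>hat\<close> splits into s - hat, of
    square 2, and s + hat, of square -2; the tangent directions join the positive part.\<close>
  let ?f = "\<lambda>p :: real \<times> (real ^ 'm). frame x (fst p, - fst p, snd p)"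
  let ?g = "\<lambda>a :: real. frame x (a, a, 0)"
  have "linear (\<lambda>p :: real \<times> (real ^ 'm). (fst p, - fst p, snd p))" by (intro linearI) auto
  from linear_compose[OF this linear_frame[OF x]] have lf: "linear ?f" unfolding o_def .
  have "linear (\<lambda>a :: real. (a, a, 0 :: real ^ 'm))" by (intro linearI) auto
  from linear_compose[OF this linear_frame[OF x]] have lg: "linear ?g" unfolding o_def .
  have "inj ?f" "inj ?g"
    by (rule injI, drule injD[OF inj_frame[OF x]], simp add: prod_eq_iff)+
  show "subspace (range ?f)" "subspace (range ?g)"
    by (rule linear_subspace_image[OF lf subspace_UNIV] linear_subspace_image[OF lg subspace_UNIV])+
  have "dim (range ?f) = dim (UNIV :: (real \<times> (real ^ 'm)) set)"
    by (rule dim_image_eq[OF lf]) (use \<open>inj ?f\<close> inj_on_subset in auto)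
  then show "dim (range ?f) = 3" using card by simp
  have "dim (range ?g) = dim (UNIV :: real set)"
    by (rule dim_image_eq[OF lg]) (use \<open>inj ?g\<close> inj_on_subset in auto)
  then show "dim (range ?g) = 1" by simp
  have ff: "lor (frame x p) (frame x q) = - fst p * fst (snd q) - fst (snd p) * fst q + h x (snd (snd p)) (snd (snd q))" for p q
    unfolding frame_def[of x q] by (simp add: lor_simps frame_lor[OF x])
  show "\<forall>v\<in>range ?f. v \<noteq> 0 \<longrightarrow> lor v v > 0"
  proof (intro ballI impI)
    fix v assume "v \<in> range ?f" "v \<noteq> 0"
    then obtain a W where v: "v = frame x (a, -a, W)" by auto
    then have "a \<noteq> 0 \<or> W \<noteq> 0" using \<open>v \<noteq> 0\<close> by (auto simp: frame_def linear_0[OF lin_ds[OF x]])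
    then show "lor v v > 0"
    proof
      assume "a \<noteq> 0"
      then have "a * a > 0" using not_real_square_gt_zero by blast
      moreover have "h x W W \<ge> 0"
        using pos[OF x, of W] bilinear_simps[OF pos_formD(1)[OF pos_form_h[OF x]]] by (cases "W = 0") auto
      ultimately show ?thesis unfolding v ff by simp
    next
      assume "W \<noteq> 0"
      then show ?thesis unfolding v ff using pos[OF x] by (simp add: add_nonneg_pos)
    qed
  qed
  show "\<forall>v\<in>range ?g. v \<noteq> 0 \<longrightarrow> lor v v < 0"
  proof (intro ballI impI)
    fix v assume "v \<in> range ?g" "v \<noteq> 0"
    then obtain a where v: "v = frame x (a, a, 0)" by auto
    then have "a \<noteq> 0" using \<open>v \<noteq> 0\<close> by (auto simp: frame_def linear_0[OF lin_ds[OF x]])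
    then have "a * a > 0" using not_real_square_gt_zero by blast
    then show "lor v v < 0"
      unfolding v ff using bilinear_simps[OF pos_formD(1)[OF pos_form_h[OF x]]] by simp
  qed
  show "\<forall>v\<in>range ?f. \<forall>w\<in>range ?g. lor v w = 0"
    using bilinear_simps[OF pos_formD(1)[OF pos_form_h[OF x]]] by (auto simp: ff)
  have 1: "frame x (a, b, W) = ?f ((a - b) / 2, W) + ?g ((a + b) / 2)" for a b W
    by (simp add: linear_add[OF linear_frame[OF x], symmetric] field_simps)
  have 2: "?f p + ?g a = frame x (fst p + a, a - fst p, snd p)" for p a
    by (simp add: linear_add[OF linear_frame[OF x], symmetric])
  show "central_span s x = {v + w |v w. v \<in> range ?f \<and> w \<in> range ?g}"
    unfolding central_span_eq[OF x]
  proof (intro subset_antisym subsetI)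
    fix u assume "u \<in> range (frame x)"
    then obtain a b W where u: "u = frame x (a, b, W)" by auto
    show "u \<in> {v + w |v w. v \<in> range ?f \<and> w \<in> range ?g}"
      unfolding u 1[of a b W] 
      by (intro CollectI exI[of _ "?f ((a - b) / 2, W)"] exI[of _ "?g ((a + b) / 2)"] conjI refl rangeI)
  next
    fix u assume "u \<in> {v + w |v w. v \<in> range ?f \<and> w \<in> range ?g}"
    then obtain p a where "u = ?f p + ?g a" by blast
    then show "u \<in> range (frame x)" unfolding 2 by simp
  qed
qed

text \<open>Orthogonal projection onto the central sphere. The pairings with \<open>s\<close> and
  \<open>hat\<close> change places and sign because these two are null with product -1.\<close>

definition pV where "pV x u = frame x (- lor u (hat x), - lor u (s x), raise (h x) (\<lambda>Z. lor u (dd s x Z)))"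

lemma pV_mem:
  assumes x: "x \<in> D"
  shows "pV x u \<in> central_span s x" "u - pV x u \<in> lorth (central_span s x)"
proof -
  show "pV x u \<in> central_span s x" unfolding pV_def central_span_eq[OF x] by simp
  show "u - pV x u \<in> lorth (central_span s x)"
    unfolding lorth_central_span[OF x] pV_def
    by (simp add: lor.diff_left frame_lor[OF x] raise_cramer(1)[OF pos_form_h[OF x] linear_lor_ds[OF x]])
qed

lemma lproj_central_span:
  assumes x: "x \<in> D"
  shows "lproj (central_span s x) u = pV x u"
    and "lproj (lorth (central_span s x)) u = u - pV x u"
proof -
  let ?V = "central_span s x"
  show "lproj ?V u = pV x u"
    by (rule lproj_eqI[OF subspace_central_span]) (use pV_mem[OF x] in blast)+
  have ll: "a \<in> lorth (lorth ?V)" if "a \<in> ?V" for a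
    by (rule lorthI) (simp add: lor_commute[of a] lorthD[OF _ that])
  show "lproj (lorth ?V) u = u - pV x u"
  proof (rule lproj_eqI[OF subspace_lorth])
    show "\<exists>a\<in>lorth ?V. w - a \<in> lorth (lorth ?V)" for w
      by (rule bexI[of _ "w - pV x w"]) (use pV_mem[OF x] ll in auto)
  qed (use pV_mem[OF x] ll in auto)
qed

lemma normal_projection_eqI:
  assumes x: "x \<in> D" and "u - w \<in> central_span s x" "w \<in> lorth (central_span s x)"
  shows "u - pV x u = w"
proof -
  have "lproj (lorth (central_span s x)) u = w"
  proof (rule lproj_eqI[OF subspace_lorth])
    have ll: "a \<in> lorth (lorth (central_span s x))" if "a \<in> central_span s x" for a
      by (rule lorthI) (simp add: lor_commute[of a] lorthD[OF _ that])
    show "\<exists>a\<in>lorth (central_span s x). w - a \<in> lorth (lorth (central_span s x))" for w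
      by (rule bexI[of _ "w - pV x w"]) (use pV_mem[OF x] ll in auto)
    show "u - w \<in> lorth (lorth (central_span s x))" by (rule ll[OF assms(2)])
  qed (rule assms(3))
  then show ?thesis by (simp add: lproj_central_span[OF x])
qed

section \<open>The tracefree second fundamental form\<close>

abbreviation II where "II x \<equiv> sff (central_span s x) s x"

lemma II_eq:
  assumes x: "x \<in> D"
  shows "II x X Y = - (H x X Y + \<eta> x X Y *\<^sub>R s x - h x X Y *\<^sub>R hat x)"
proof -
  let ?w = "H x X Y + \<eta> x X Y *\<^sub>R s x - h x X Y *\<^sub>R hat x"
  have "d2 s x X Y - pV x (d2 s x X Y) = ?w"
  proof (rule normal_projection_eqI[OF x])
    show "?w \<in> lorth (central_span s x)"
      unfolding lorth_central_span[OF x] \<eta>_def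
      by (simp add: lor_simps s_H[OF x] null[OF x] hat_lor[OF x] H_normal[OF x] s_ds[OF x])
    have "d2 s x X Y - ?w = frame x (- \<eta> x X Y, h x X Y, \<Gamma> x X Y)"
      unfolding H_def frame_def by simp
    then show "d2 s x X Y - ?w \<in> central_span s x" unfolding central_span_eq[OF x] by simp
  qed
  then show ?thesis unfolding sff_def lproj_central_span(2)[OF x] by simp
qed

lemma II_normal: "x \<in> D \<Longrightarrow> II x X Y \<in> lorth (central_span s x)"
  unfolding sff_def lproj_central_span(2) using subspace_neg[OF subspace_lorth pV_mem(2)] by blast

lemma II_sym: "x \<in> D \<Longrightarrow> II x X Y = II x Y X"
  unfolding sff_def by (simp add: d2s_sym)

lemma bilinear_\<eta>: "x \<in> D \<Longrightarrow> bilinear (\<eta> x)"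
  unfolding \<eta>_def bilinear_def
  by (auto intro!: linearI simp: bilinear_simps[OF bilinear_H] lor_simps)

lemma bilinear_II:
  assumes x: "x \<in> D" shows "bilinear (II x)"
  unfolding II_eq[OF x, abs_def] bilinear_def
  by (auto intro!: linearI simp: bilinear_simps[OF bilinear_H[OF x]] bilinear_simps[OF bilinear_\<eta>[OF x]]
      bilinear_simps[OF pos_formD(1)[OF pos_form_h[OF x]]] algebra_simps)

lemma smooth_II: "smooth_on D (\<lambda>x. II x X Y)"
proof (rule smooth_on_cong[OF open_D])
  show "smooth_on D (\<lambda>x. - (H x X Y + \<eta> x X Y *\<^sub>R s x - h x X Y *\<^sub>R hat x))"
    unfolding \<eta>_def by (intro smooth_intros open_D smooth_H smooth_hat smooth smooth_h)
qed (simp add: II_eq)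

lemma trace_\<eta>:
  assumes x: "x \<in> D" and E: "orthonormal_pair (h x) E F"
  shows "\<eta> x E E + \<eta> x F F = lor (mean x) (mean x)"
proof -
  have "\<eta> x E E + \<eta> x F F = lor (2 *\<^sub>R mean x) (hat x)"
    unfolding \<eta>_def mean_eq[OF x E] by (simp add: lor_simps)
  also have "\<dots> = lor (mean x) (mean x)"
    unfolding hat_def by (simp add: lor_simps mean_lor[OF x])
  finally show ?thesis .
qed

lemma trace_II:
  assumes x: "x \<in> D"
  shows "mtrace (h x) (II x) = 0"
proof -
  obtain E F where E: "orthonormal_pair (h x) E F" using orthonormal_exists[OF x] by blast
  have "mtrace (h x) (II x) = II x E E + II x F F"
    by (rule mtrace_orthonormal[OF card pos_form_h[OF x] E bilinear_II[OF x]])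
  also have "\<dots> = - (2 *\<^sub>R mean x + (\<eta> x E E + \<eta> x F F) *\<^sub>R s x - 2 *\<^sub>R hat x)"
    using E unfolding II_eq[OF x] mean_eq[OF x E] orthonormal_pair_def by (simp add: algebra_simps scaleR_2)
  also have "\<dots> = 0" unfolding trace_\<eta>[OF x E] hat_def by (simp add: scaleR_add_right)
  finally show ?thesis .
qed

text \<open>Removing the trace removes the pairing of the hessian with \<open>s\<close>, so that its
  projection to the central sphere has only a component along \<open>s\<close>.\<close>

lemma r_zero_eq:
  assumes x: "x \<in> D" and V: "V x = central_span s x"
  shows "r_zero V s x X Y = \<eta> x X Y - lor (mean x) (mean x) / 2 * h x X Y"
proof -
  have tf: "tracefree_part (h x) (H x) X Y = H x X Y - h x X Y *\<^sub>R mean x"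
    unfolding tracefree_part_def mean_def using card by simp
  have mh: "lor (mean x) (hat x) = lor (mean x) (mean x) / 2"
    unfolding hat_def by (simp add: lor_simps mean_lor[OF x])
  have "raise (h x) (\<lambda>Z. lor (H x X Y - h x X Y *\<^sub>R mean x) (dd s x Z)) = 0"
    by (rule raise_unique[OF pos_form_h[OF x]])
      (simp add: lor_simps H_normal[OF x] mean_lor[OF x] bilinear_simps[OF pos_formD(1)[OF pos_form_h[OF x]]])
  then have "lproj (V x) (tracefree_part (h x) (H x) X Y) =
      - ((\<eta> x X Y - lor (mean x) (mean x) / 2 * h x X Y) *\<^sub>R s x)"
    unfolding V lproj_central_span(1)[OF x] tf pV_def frame_def \<eta>_def
    by (simp add: lor_simps mh s_H[OF x] mean_lor[OF x] linear_0[OF lin_ds[OF x]] algebra_simps)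
  then show ?thesis unfolding r_zero_def using s_nonzero[OF x] by (intro the_equality) auto
qed

text \<open>The orthonormal pair serves as an independent pair; the existence of one is what makes
  the number described in \<open>gauss_curv\<close> unique.\<close>

lemma gauss_curv_eq:
  assumes x: "x \<in> D" and E: "orthonormal_pair (h x) E F"
  shows "gauss_curv h x = lor (H x E E) (H x F F) - lor (H x E F) (H x E F)"
proof -
  let ?k = "lor (H x E E) (H x F F) - lor (H x E F) (H x E F)"
  note sc = sectional_curv_eq[OF x gauss_form_2d[OF card pos_form_h[OF x] E bilinear_H[OF x] H_sym[OF x]]]
  have o: "h x E E = 1" "h x F F = 1" "h x E F = 0" "h x F E = 0"
    using E pos_formD(2)[OF pos_form_h[OF x], of F E] unfolding orthonormal_pair_def by auto
  have "E \<noteq> F" using o by auto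
  have "independent {E, F}"
  proof (rule independent_if_scalars_zero)
    fix f y assume *: "(\<Sum>y\<in>{E, F}. f y *\<^sub>R y) = 0" and y: "y \<in> {E, F}"
    have "f E *\<^sub>R E + f F *\<^sub>R F = 0" using * \<open>E \<noteq> F\<close> by simp
    then have "h x (f E *\<^sub>R E + f F *\<^sub>R F) E = h x 0 E" "h x (f E *\<^sub>R E + f F *\<^sub>R F) F = h x 0 F" by simp_all
    then show "f y = 0" using y o by (auto simp: bilinear_simps[OF pos_formD(1)[OF pos_form_h[OF x]]])
  qed simp
  show ?thesis unfolding gauss_curv_def
  proof (rule the_equality)
    show "\<forall>X Y. X \<noteq> Y \<and> independent {X, Y} \<longrightarrow> sectional_curv h x X Y = ?k" using sc by blast
    show "k = ?k" if "\<forall>X Y. X \<noteq> Y \<and> independent {X, Y} \<longrightarrow> sectional_curv h x X Y = k" for k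
      using that sc \<open>E \<noteq> F\<close> \<open>independent {E, F}\<close> by metis
  qed
qed

subsection \<open>The Ricci equation\<close>

definition shape where "shape x X u = raise (h x) (\<lambda>Z. lor u (II x X Z))"

lemma sff_transpose_eq: "x \<in> D \<Longrightarrow> sff_transpose (central_span s x) s x Y u = shape x Y u"
  unfolding sff_transpose_def shape_def raise_def ..

lemma lor_normal_d2s:
  assumes x: "x \<in> D" and u: "u \<in> lorth (central_span s x)"
  shows "lor u (d2 s x X Y) = - lor u (II x X Y)"
proof -
  have "lor u (pV x (d2 s x X Y)) = 0" using lorthD[OF u pV_mem(1)[OF x]] .
  then show ?thesis unfolding sff_def lproj_central_span(2)[OF x] by (simp add: lor_simps)
qed

text \<open>The normal vector is extended to a normal field. In its second normal derivative the
  mixed derivatives of the extension commute, so flatness leaves only the second fundamental form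
  applied to the shape operator.\<close>

lemma ricci_equation:
  assumes D': "(D, \<psi>) \<in> A" and V: "\<And>y. y \<in> D \<Longrightarrow> V (\<psi> y) = central_span s y"
    and flat: "normal_nabla_flat A V" and x: "x \<in> D" and u: "u \<in> lorth (central_span s x)"
  shows "II x X (shape x Y u) = II x Y (shape x X u)"
proof -
  \<comment> \<open>The extension is the normal projection of the constant vector \<open>u\<close>,
    which is smooth because \<open>pV\<close> is explicit.\<close>
  define \<xi> where "\<xi> y = u - pV y u" for y
  have sr: "smooth_on D (\<lambda>y. raise (h y) (\<lambda>Z. lor (f y) (dd s y Z)))" if "smooth_on D f" for f
    by (intro smooth_on_raise smooth_on_lor open_D pos_form_h smooth_h linear_lor_ds smooth_on_dd smooth that)
  have smooth_\<xi>: "smooth_on D \<xi>"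
    unfolding \<xi>_def pV_def frame_def fst_conv snd_conv
    by (intro smooth_on_diff smooth_on_add smooth_on_scaleR smooth_on_minus smooth_on_lor smooth_on_const
        smooth_on_dd_field sr open_D smooth smooth_hat)
  have \<xi>N: "\<xi> y \<in> lorth (central_span s y)" if "y \<in> D" for y
    unfolding \<xi>_def by (rule pV_mem(2)[OF that])
  have \<xi>x: "\<xi> x = u"
    unfolding \<xi>_def by (rule normal_projection_eqI[OF x _ u]) (simp add: subspace_0[OF subspace_central_span])
  have d\<xi>_s: "lor (dd \<xi> y Y) (s y) = 0" if y: "y \<in> D" for y Y
  proof -
    have 1: "((\<lambda>y. lor (\<xi> y) (s y)) has_derivative (\<lambda>X. lor (\<xi> y) (dd s y X) + lor (dd \<xi> y X) (s y))) (at y)"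
      by (intro lor.FDERIV ds y smooth_on_has_derivative[OF open_D smooth_\<xi>])
    have "((\<lambda>y. lor (\<xi> y) (s y)) has_derivative (\<lambda>X. 0)) (at y)"
      by (rule has_derivative_transform_within_open[OF has_derivative_const open_D y])
        (use \<xi>N lorth_central_span in auto)
    from fun_cong[OF has_derivative_unique[OF this 1], of Y]
    show ?thesis using \<xi>N[OF y] lorth_central_span[OF y] by simp
  qed
  have d\<xi>_ds: "lor (dd \<xi> y Y) (dd s y Z) = - lor (\<xi> y) (d2 s y Y Z)" if y: "y \<in> D" for y Y Z
  proof -
    have 1: "((\<lambda>y. lor (\<xi> y) (dd s y Z)) has_derivative (\<lambda>X. lor (\<xi> y) (d2 s y X Z) + lor (dd \<xi> y X) (dd s y Z))) (at y)"
      by (intro lor.FDERIV d2s y smooth_on_has_derivative[OF open_D smooth_\<xi>])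
    have "((\<lambda>y. lor (\<xi> y) (dd s y Z)) has_derivative (\<lambda>X. 0)) (at y)"
      by (rule has_derivative_transform_within_open[OF has_derivative_const open_D y])
        (use \<xi>N lorth_central_span in auto)
    from fun_cong[OF has_derivative_unique[OF this 1], of Y] show ?thesis by simp
  qed
  \<comment> \<open>Up to sign, \<open>c\<close> and \<open>W\<close> give the components of the
    derivative of \<xi> along \<open>s\<close> and \<open>ds\<close>; the one along
    \<open>hat\<close> vanishes by \<open>d\<xi>_s\<close>.\<close>
  define c where "c Y y = lor (dd \<xi> y Y) (hat y)" for Y y
  define W where "W Y y = raise (h y) (\<lambda>Z. lor (dd \<xi> y Y) (dd s y Z))" for Y y
  have Wx: "W Y x = shape x Y u" for Y
    unfolding W_def shape_def d\<xi>_ds[OF x] \<xi>x lor_normal_d2s[OF x u] by simp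
  have nab: "normal_nabla V \<psi> \<xi> Y y = dd \<xi> y Y - (- c Y y *\<^sub>R s y + dd s y (W Y y))" if y: "y \<in> D" for y Y
    unfolding normal_nabla_def V[OF y] lproj_central_span(2)[OF y] pV_def frame_def c_def W_def
    by (simp add: d\<xi>_s[OF y])
  have nab2: "normal_nabla V \<psi> (normal_nabla V \<psi> \<xi> Y) X x
      = (d2 \<xi> x X Y - pV x (d2 \<xi> x X Y)) + II x X (shape x Y u)" for X Y
  proof -
    have dc: "(c Y has_derivative dd (c Y) x) (at x)"
      unfolding c_def by (rule smooth_on_has_derivative[OF open_D _ x])
        (intro smooth_on_lor open_D smooth_on_dd smooth_\<xi> smooth_hat)
    have dW: "(W Y has_derivative dd (W Y) x) (at x)"
      unfolding W_def by (rule smooth_on_has_derivative[OF open_D sr[OF smooth_on_dd[OF smooth_\<xi>]] x])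
    have "((\<lambda>y. dd \<xi> y Y - (- c Y y *\<^sub>R s y + dd s y (W Y y))) has_derivative
      (\<lambda>X. d2 \<xi> x X Y - ((- c Y x *\<^sub>R dd s x X + - dd (c Y) x X *\<^sub>R s x)
        + (d2 s x X (W Y x) + dd s x (dd (W Y) x X))))) (at x)"
      by (intro has_derivative_diff has_derivative_add has_derivative_scaleR has_derivative_minus dc ds x
          has_derivative_dd_field[OF open_D smooth x dW]
          smooth_on_has_derivative[OF open_D smooth_on_dd[OF smooth_\<xi>] x])
    then have "(normal_nabla V \<psi> \<xi> Y has_derivative
      (\<lambda>X. d2 \<xi> x X Y - ((- c Y x *\<^sub>R dd s x X + - dd (c Y) x X *\<^sub>R s x)
        + (d2 s x X (W Y x) + dd s x (dd (W Y) x X))))) (at x)"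
      by (rule has_derivative_transform_within_open[OF _ open_D x]) (simp add: nab)
    then have d: "dd (normal_nabla V \<psi> \<xi> Y) x X = d2 \<xi> x X Y - ((- c Y x *\<^sub>R dd s x X + - dd (c Y) x X *\<^sub>R s x)
        + (d2 s x X (W Y x) + dd s x (dd (W Y) x X)))" by (rule dd_eqI)
    \<comment> \<open>When the tangential correction is differentiated, only d2 s (X, W) leaves the
      central sphere; its normal part gives the second fundamental form.\<close>
    let ?N = "(d2 \<xi> x X Y - pV x (d2 \<xi> x X Y)) + II x X (shape x Y u)"
    have II: "II x X (shape x Y u) = - (d2 s x X (shape x Y u) - pV x (d2 s x X (shape x Y u)))"
      unfolding sff_def lproj_central_span(2)[OF x] ..
    have "normal_nabla V \<psi> (normal_nabla V \<psi> \<xi> Y) X x = dd (normal_nabla V \<psi> \<xi> Y) x X - pV x (dd (normal_nabla V \<psi> \<xi> Y) x X)"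
      unfolding normal_nabla_def[of V \<psi> "normal_nabla V \<psi> \<xi> Y"] V[OF x] lproj_central_span(2)[OF x] ..
    also have "\<dots> = ?N"
    proof (rule normal_projection_eqI[OF x])
      show "?N \<in> lorth (central_span s x)"
        by (intro subspace_add[OF subspace_lorth] pV_mem(2)[OF x] II_normal[OF x])
      have "dd (normal_nabla V \<psi> \<xi> Y) x X - ?N = pV x (d2 \<xi> x X Y) + c Y x *\<^sub>R dd s x X + dd (c Y) x X *\<^sub>R s x
          - dd s x (dd (W Y) x X) - pV x (d2 s x X (shape x Y u))"
        unfolding d II Wx by simp
      also have "\<dots> \<in> central_span s x"
        by (intro subspace_add[OF subspace_central_span] subspace_diff[OF subspace_central_span]
            subspace_scale[OF subspace_central_span] pV_mem(1)[OF x] central_span_mem)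
      finally show "dd (normal_nabla V \<psi> \<xi> Y) x X - ?N \<in> central_span s x" .
    qed
    finally show ?thesis .
  qed
  have "open D \<and> D \<subseteq> D \<and> smooth_on D \<xi> \<and> (\<forall>y\<in>D. \<xi> y \<in> lorth (V (\<psi> y)))"
    using open_D smooth_\<xi> \<xi>N V by simp
  then have "normal_nabla V \<psi> (normal_nabla V \<psi> \<xi> Y) X x = normal_nabla V \<psi> (normal_nabla V \<psi> \<xi> X) Y x"
    using flat D' x unfolding normal_nabla_flat_def by blast
  moreover have "d2 \<xi> x X Y = d2 \<xi> x Y X" by (rule clairaut[OF open_D smooth_\<xi> x])
  ultimately show ?thesis unfolding nab2 by simp
qed

end

section \<open>Change of parametrization and of lift\<close>

lemma has_derivative_dd_field_compose:
  fixes f :: "real ^ 'm::finite \<Rightarrow> 'v::real_normed_vector"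
  assumes D: "open D" "smooth_on D f" "\<tau> x \<in> D" and \<tau>: "(\<tau> has_derivative T) (at x)"
    and E: "open E" "x \<in> E" "\<And>y. y \<in> E \<Longrightarrow> \<tau> y \<in> D" and W: "(W has_derivative W') (at x)"
  shows "((\<lambda>y. dd f (\<tau> y) (W y)) has_derivative (\<lambda>X. d2 f (\<tau> x) (T X) (W x) + dd f (\<tau> x) (W' X))) (at x)"
proof -
  have d: "((\<lambda>y. dd f (\<tau> y) Z) has_derivative (\<lambda>X. d2 f (\<tau> x) (T X) Z)) (at x)" for Z
    using has_derivative_compose[OF \<tau> smooth_on_has_derivative[OF D(1) smooth_on_dd[OF D(2)] D(3)]] .
  have "((\<lambda>y. \<Sum>i\<in>UNIV. (W y $ i) *\<^sub>R dd f (\<tau> y) (axis i 1)) has_derivative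
    (\<lambda>X. \<Sum>i\<in>UNIV. (W x $ i) *\<^sub>R d2 f (\<tau> x) (T X) (axis i 1) + (W' X $ i) *\<^sub>R dd f (\<tau> x) (axis i 1))) (at x)"
    by (intro has_derivative_sum has_derivative_scaleR d
        bounded_linear.has_derivative[OF bounded_linear_vec_nth W])
  moreover have "(\<Sum>i\<in>UNIV. (W x $ i) *\<^sub>R d2 f (\<tau> x) (T X) (axis i 1) + (W' X $ i) *\<^sub>R dd f (\<tau> x) (axis i 1))
    = d2 f (\<tau> x) (T X) (W x) + dd f (\<tau> x) (W' X)" for X
    using linear_vec_expansion[OF d2_linear2[OF D, of "T X"], of "W x"]
      linear_vec_expansion[OF smooth_on_linear_dd[OF D], of "W' X"]
    by (simp add: sum.distrib)
  ultimately have "((\<lambda>y. \<Sum>i\<in>UNIV. (W y $ i) *\<^sub>R dd f (\<tau> y) (axis i 1)) has_derivative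
    (\<lambda>X. d2 f (\<tau> x) (T X) (W x) + dd f (\<tau> x) (W' X))) (at x)" by simp
  then show ?thesis
    by (rule has_derivative_transform_within_open[OF _ E(1,2)])
      (use linear_vec_expansion[OF smooth_on_linear_dd[OF D(1,2) E(3)]] in \<open>rule sym\<close>)
qed

locale reparam = null_map D s
  for D :: "(real ^ 'm::finite) set" and s :: "real ^ 'm \<Rightarrow> 'e::euclidean_space \<times> real" +
  fixes E :: "(real ^ 'm) set" and \<tau> :: "real ^ 'm \<Rightarrow> real ^ 'm"
  assumes open_E: "open E" and smooth_\<tau>: "smooth_on E \<tau>" and \<tau>_mem: "x \<in> E \<Longrightarrow> \<tau> x \<in> D"
    and \<tau>_inj: "x \<in> E \<Longrightarrow> dd \<tau> x X = 0 \<Longrightarrow> X = 0"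
begin

abbreviation s' where "s' \<equiv> \<lambda>x. s (\<tau> x)"

lemmas d\<tau> = smooth_on_has_derivative[OF open_E smooth_\<tau>]
lemmas lin_d\<tau> = smooth_on_linear_dd[OF open_E smooth_\<tau>]

lemma smooth_s': "smooth_on E s'"
  by (rule smooth_on_compose[OF open_E open_D \<tau>_mem smooth_\<tau> smooth])

lemma dd_s': "x \<in> E \<Longrightarrow> dd s' x X = dd s (\<tau> x) (dd \<tau> x X)"
  by (rule dd_eqI[OF has_derivative_compose[OF d\<tau> ds[OF \<tau>_mem]]])

lemma d2_s':
  assumes x: "x \<in> E"
  shows "d2 s' x X Y = d2 s (\<tau> x) (dd \<tau> x X) (dd \<tau> x Y) + dd s (\<tau> x) (d2 \<tau> x X Y)"
proof -
  have "d2 s' x X Y = dd (\<lambda>y. dd s (\<tau> y) (dd \<tau> y Y)) x X"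
    by (subst dd_cong_open[OF open_E x]) (auto simp: dd_s')
  also have "\<dots> = d2 s (\<tau> x) (dd \<tau> x X) (dd \<tau> x Y) + dd s (\<tau> x) (d2 \<tau> x X Y)"
    by (rule dd_eqI[OF has_derivative_dd_field_compose[OF open_D smooth \<tau>_mem[OF x] d\<tau>[OF x] open_E x \<tau>_mem]])
      (auto intro: smooth_on_has_derivative[OF open_E smooth_on_dd[OF smooth_\<tau>] x])
  finally show ?thesis .
qed

lemma h_s': "x \<in> E \<Longrightarrow> lift_metric s' x X Y = h (\<tau> x) (dd \<tau> x X) (dd \<tau> x Y)"
  by (simp add: lift_metric_def dd_s')

sublocale r: null_map E s'
proof
  show "lift_metric s' x X X > 0" if "x \<in> E" "X \<noteq> 0" for x X
    unfolding h_s'[OF that(1)] using pos[OF \<tau>_mem[OF that(1)]] \<tau>_inj that by blast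
qed (use open_E smooth_s' null \<tau>_mem in auto)

lemma surj_d\<tau>: assumes x: "x \<in> E" shows "surj (dd \<tau> x)"
proof -
  have "inj (dd \<tau> x)" unfolding linear_injective_0[OF lin_d\<tau>[OF x]] using \<tau>_inj[OF x] by blast
  then show ?thesis using linear_injective_imp_surjective[OF lin_d\<tau>[OF x]] by blast
qed

text \<open>Tensoriality: the second derivative of the transition map enters only tangentially and
  is absorbed by the candidate Christoffel vector \<open>U\<close>.\<close>

lemma H_s':
  assumes x: "x \<in> E"
  shows "r.H x X Y = H (\<tau> x) (dd \<tau> x X) (dd \<tau> x Y)"
proof -
  obtain U where U: "dd \<tau> x U = \<Gamma> (\<tau> x) (dd \<tau> x X) (dd \<tau> x Y) + d2 \<tau> x X Y"
    using surj_d\<tau>[OF x] by (metis surjD)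
  have eq: "d2 s' x X Y - dd s' x U = H (\<tau> x) (dd \<tau> x X) (dd \<tau> x Y)"
    unfolding d2_s'[OF x] dd_s'[OF x] U H_def by (simp add: linear_add[OF lin_ds[OF \<tau>_mem[OF x]]])
  show ?thesis unfolding eq[symmetric]
  proof (rule r.H_eqI(2)[OF x])
    show "lor (d2 s' x X Y - dd s' x U) (dd s' x Z) = 0" for Z
      unfolding eq unfolding dd_s'[OF x] by (rule H_normal[OF \<tau>_mem[OF x]])
  qed
qed

lemma flat_s':
  assumes x: "x \<in> E"
    and "\<And>X Y Z W. lor (H (\<tau> x) Y Z) (H (\<tau> x) X W) - lor (H (\<tau> x) X Z) (H (\<tau> x) Y W) = 0"
  shows "riemann (lift_metric s') x X Y Z = 0"
proof (rule pos_form_eqI[OF r.pos_form_h[OF x]])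
  show "lift_metric s' x (riemann (lift_metric s') x X Y Z) W = lift_metric s' x 0 W" for W
    unfolding r.gauss_equation[OF x] H_s'[OF x] assms(2)
    using bilinear_simps[OF pos_formD(1)[OF r.pos_form_h[OF x]]] by simp
qed

end

lemma central_span_eqI:
  fixes s t :: "real ^ 'm::finite \<Rightarrow> 'e::euclidean_space \<times> real"
  assumes "null_surface D s" "null_surface E t" "x \<in> D" "y \<in> E" "central_span t y \<subseteq> central_span s x"
  shows "central_span t y = central_span s x"
proof -
  interpret s: null_surface D s by fact
  interpret t: null_surface E t by fact
  show ?thesis
    by (rule subspace_dim_equal[OF t.subspace_central_span s.subspace_central_span assms(5)])
      (simp add: t.dim_central_span[OF assms(4)] s.dim_central_span[OF assms(3)])
qed

locale reparam_surface = reparam D s E \<tau>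
  for D :: "(real ^ 'm::finite) set" and s :: "real ^ 'm \<Rightarrow> 'e::euclidean_space \<times> real" and E \<tau> +
  assumes card: "CARD('m) = 2"
begin

sublocale null_surface D s by unfold_locales (rule card)

lemma null_surface_s': "null_surface E s'"
  by unfold_locales (rule card)

lemma central_span_s':
  assumes x: "x \<in> E"
  shows "central_span s' x = central_span s (\<tau> x)"
proof (rule central_span_eqI[OF null_surface_axioms null_surface_s' \<tau>_mem[OF x] x])
  let ?V = "central_span s (\<tau> x)"
  note cl = subspace_add[OF subspace_central_span]
  have *: "d2 s' x X X + d2 s' x Y Y \<in> ?V" if XY: "orthonormal_pair (lift_metric s' x) X Y" for X Y
  proof -
    have "orthonormal_pair (h (\<tau> x)) (dd \<tau> x X) (dd \<tau> x Y)"
      using XY unfolding orthonormal_pair_def h_s'[OF x] .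
    then have m: "d2 s (\<tau> x) (dd \<tau> x X) (dd \<tau> x X) + d2 s (\<tau> x) (dd \<tau> x Y) (dd \<tau> x Y) \<in> ?V"
      unfolding central_span_def by (intro span_base) blast
    have "d2 s' x X X + d2 s' x Y Y =
      (d2 s (\<tau> x) (dd \<tau> x X) (dd \<tau> x X) + d2 s (\<tau> x) (dd \<tau> x Y) (dd \<tau> x Y))
      + (dd s (\<tau> x) (d2 \<tau> x X X) + dd s (\<tau> x) (d2 \<tau> x Y Y))" by (simp add: d2_s'[OF x])
    then show ?thesis using cl[OF m cl[OF central_span_mem(2) central_span_mem(2)]] by (simp only:)
  qed
  show "central_span s' x \<subseteq> ?V"
    unfolding central_span_def[of s']
  proof (rule span_minimal[OF _ subspace_central_span])
    show "{s' x} \<union> range (dd s' x) \<union> {d2 s' x X X + d2 s' x Y Y |X Y. orthonormal_pair (lift_metric s' x) X Y} \<subseteq> ?V"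
      using * central_span_mem by (auto simp: dd_s'[OF x])
  qed
qed

lemma II_s':
  assumes x: "x \<in> E"
  shows "sff (central_span s (\<tau> x)) s' x X Y = II (\<tau> x) (dd \<tau> x X) (dd \<tau> x Y)"
proof -
  let ?a = "d2 s (\<tau> x) (dd \<tau> x X) (dd \<tau> x Y)"
  note y = \<tau>_mem[OF x]
  have "d2 s' x X Y - pV (\<tau> x) (d2 s' x X Y) = ?a - pV (\<tau> x) ?a"
  proof (rule normal_projection_eqI[OF y _ pV_mem(2)[OF y]])
    have "d2 s' x X Y - (?a - pV (\<tau> x) ?a) = dd s (\<tau> x) (d2 \<tau> x X Y) + pV (\<tau> x) ?a"
      unfolding d2_s'[OF x] by simp
    then show "d2 s' x X Y - (?a - pV (\<tau> x) ?a) \<in> central_span s (\<tau> x)"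
      using subspace_add[OF subspace_central_span central_span_mem(2) pV_mem(1)[OF y]] by (simp only:)
  qed
  then show ?thesis unfolding sff_def lproj_central_span(2)[OF y] by simp
qed

end

locale conformal_surface = conformal_change D s \<phi>
  for D :: "(real ^ 'm::finite) set" and s :: "real ^ 'm \<Rightarrow> 'e::euclidean_space \<times> real" and \<phi> +
  assumes card: "CARD('m) = 2"
begin

sublocale null_surface D s by unfold_locales (rule card)

lemma null_surface_t: "null_surface D t"
  by unfold_locales (rule card)

text \<open>Rescaling adds only multiples of \<open>s\<close> and \<open>ds\<close> to the scaled
  second derivative, and orthonormal pairs of the two metrics differ by a factor. Equal dimensions
  make one inclusion enough.\<close>

lemma central_span_t:
  assumes x: "x \<in> D"
  shows "central_span t x = central_span s x"
proof (rule central_span_eqI[OF null_surface_axioms null_surface_t x x])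
  let ?V = "central_span s x"
  note cl = subspace_add[OF subspace_central_span] subspace_diff[OF subspace_central_span]
    subspace_scale[OF subspace_central_span]
  have *: "d2 t x X X + d2 t x Y Y \<in> ?V" if XY: "orthonormal_pair (lift_metric t x) X Y" for X Y
  proof -
    let ?X = "(1 / \<phi> x) *\<^sub>R X" and ?Y = "(1 / \<phi> x) *\<^sub>R Y"
    have "h x X X = \<phi> x * \<phi> x" "h x Y Y = \<phi> x * \<phi> x" "h x X Y = 0"
      using XY \<phi>_nz[OF x] unfolding orthonormal_pair_def h_t[OF x]
      by (auto simp: power2_eq_square divide_eq_1_iff)
    then have "orthonormal_pair (h x) ?X ?Y"
      using \<phi>_nz[OF x] unfolding orthonormal_pair_def
      by (simp add: bilinear_simps[OF pos_formD(1)[OF pos_form_h[OF x]]])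
    then have m: "d2 s x ?X ?X + d2 s x ?Y ?Y \<in> ?V"
      unfolding central_span_def by (intro span_base) blast
    have e: "d2 s x Z Z = (\<phi> x * \<phi> x) *\<^sub>R d2 s x ((1 / \<phi> x) *\<^sub>R Z) ((1 / \<phi> x) *\<^sub>R Z)" for Z
      using \<phi>_nz[OF x] by (simp add: bilinear_simps[OF bilin_d2s[OF x]])
    have "d2 t x Z Z = \<phi> x *\<^sub>R d2 s x ((1 / \<phi> x) *\<^sub>R Z) ((1 / \<phi> x) *\<^sub>R Z)
      - (2 * dd \<phi> x Z / (\<phi> x)\<^sup>2) *\<^sub>R dd s x Z
      - (d2 \<phi> x Z Z / (\<phi> x)\<^sup>2 - 2 * dd \<phi> x Z * dd \<phi> x Z / (\<phi> x)^3) *\<^sub>R s x" for Z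
      unfolding t_derivatives(2)[OF x] e[of Z] using \<phi>_nz[OF x]
      by (simp add: scaleR_left.add[symmetric] scaleR_left_diff_distrib[symmetric] del: scaleR_left_diff_distrib)
        (simp add: scaleR_2[symmetric] algebra_simps)
    then have "d2 t x X X + d2 t x Y Y = \<phi> x *\<^sub>R (d2 s x ?X ?X + d2 s x ?Y ?Y)
      - (2 * dd \<phi> x X / (\<phi> x)\<^sup>2) *\<^sub>R dd s x X - (2 * dd \<phi> x Y / (\<phi> x)\<^sup>2) *\<^sub>R dd s x Y
      - (d2 \<phi> x X X / (\<phi> x)\<^sup>2 - 2 * dd \<phi> x X * dd \<phi> x X / (\<phi> x)^3) *\<^sub>R s x
      - (d2 \<phi> x Y Y / (\<phi> x)\<^sup>2 - 2 * dd \<phi> x Y * dd \<phi> x Y / (\<phi> x)^3) *\<^sub>R s x"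
      by (simp add: scaleR_add_right)
    then show ?thesis using m by (simp only:) (intro cl(2) cl(3) central_span_mem)
  qed
  show "central_span t x \<subseteq> ?V"
    unfolding central_span_def[of t]
  proof (rule span_minimal[OF _ subspace_central_span])
    have "dd t x X \<in> ?V" for X unfolding t_derivatives(1)[OF x] by (intro cl central_span_mem)
    moreover have "t x \<in> ?V" by (intro cl central_span_mem)
    ultimately show "{t x} \<union> range (dd t x) \<union> {d2 t x X X + d2 t x Y Y |X Y. orthonormal_pair (lift_metric t x) X Y} \<subseteq> ?V"
      using * by auto
  qed
qed

lemma II_t:
  assumes x: "x \<in> D"
  shows "sff (central_span s x) t x X Y = (1 / \<phi> x) *\<^sub>R II x X Y"
proof -
  let ?a = "d2 s x X Y"
  note cl = subspace_add[OF subspace_central_span] subspace_diff[OF subspace_central_span]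
    subspace_scale[OF subspace_central_span]
  have "d2 t x X Y - pV x (d2 t x X Y) = (1 / \<phi> x) *\<^sub>R (?a - pV x ?a)"
  proof (rule normal_projection_eqI[OF x _ subspace_scale[OF subspace_lorth pV_mem(2)[OF x]]])
    have "d2 t x X Y - (1 / \<phi> x) *\<^sub>R (?a - pV x ?a) = (1 / \<phi> x) *\<^sub>R pV x ?a
      - (dd \<phi> x X / (\<phi> x)\<^sup>2) *\<^sub>R dd s x Y - (dd \<phi> x Y / (\<phi> x)\<^sup>2) *\<^sub>R dd s x X
      - (d2 \<phi> x X Y / (\<phi> x)\<^sup>2 - 2 * dd \<phi> x X * dd \<phi> x Y / (\<phi> x)^3) *\<^sub>R s x"
      unfolding t_derivatives(2)[OF x] by (simp add: scaleR_diff_right)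
    also have "\<dots> \<in> central_span s x" by (intro cl(2) cl(3) central_span_mem pV_mem(1)[OF x])
    finally show "d2 t x X Y - (1 / \<phi> x) *\<^sub>R (?a - pV x ?a) \<in> central_span s x" .
  qed
  then show ?thesis unfolding sff_def lproj_central_span(2)[OF x] by (simp add: scaleR_diff_right)
qed

end

subsection \<open>The Cotton--York potential of a surface in a spaceform\<close>

text \<open>Here \<open>s\<close> is an arbitrary lift and \<open>t\<close> the spaceform lift, as
  \<phi> = - (v, s) gives (v, t) = -1. Only \<open>t\<close> has constant curvature, but the
  potential has to be tested in every positive lift.\<close>

locale spaceform_surface = conformal_surface D s \<phi>
  for D :: "(real ^ 'm::finite) set" and s :: "real ^ 'm \<Rightarrow> 'e::euclidean_space \<times> real" and \<phi> +
  fixes v :: "'e \<times> real" and k :: real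
  assumes \<phi>_v: "x \<in> D \<Longrightarrow> \<phi> x = - lor v (s x)"
    and curv_t: "x \<in> D \<Longrightarrow> lor (t.H x Y Z) (t.H x X W) - lor (t.H x X Z) (t.H x Y W) =
      k * (lift_metric t x Y Z * lift_metric t x X W - lift_metric t x X Z * lift_metric t x Y W)"
begin

text \<open>Formed with the rescaled lift \<open>t\<close>, so that all lifts \<open>s\<close> of
  the same null lines give the same tensor.\<close>

definition q where "q x X Y = lor v (sff (central_span s x) t x X Y)"

lemma q_II: "x \<in> D \<Longrightarrow> q x X Y = lor v (II x X Y) / \<phi> x"
  unfolding q_def II_t by (simp add: lor_simps)

lemma smooth_q: "smooth_on D (\<lambda>x. q x X Y)"
proof (rule smooth_on_cong[OF open_D])
  show "smooth_on D (\<lambda>x. lor v (II x X Y) / \<phi> x)"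
    by (intro smooth_on_divide smooth_on_lor smooth_on_const smooth_II smooth_\<phi> open_D \<phi>_nz)
qed (simp add: q_II)

lemma bilinear_q: "x \<in> D \<Longrightarrow> bilinear (q x)"
  unfolding bilinear_def q_II
  by (auto intro!: linearI simp: q_II bilinear_simps[OF bilinear_II] lor_simps add_divide_distrib)

lemma q_sym: "x \<in> D \<Longrightarrow> q x X Y = q x Y X"
  by (simp add: q_II II_sym)

lemma trace_q:
  assumes x: "x \<in> D" and E: "orthonormal_pair (h x) E F"
  shows "q x E E + q x F F = 0"
proof -
  have "II x E E + II x F F = 0"
    using trace_II[OF x] mtrace_orthonormal[OF card pos_form_h[OF x] E bilinear_II[OF x]] by simp
  then have "lor v (II x E E) + lor v (II x F F) = 0" by (metis lor.add_right lor.zero_right)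
  then show ?thesis unfolding q_II[OF x] by (simp add: add_divide_distrib[symmetric])
qed

lemma mtrace_q: "x \<in> D \<Longrightarrow> mtrace (h x) (q x) = 0"
  using orthonormal_exists mtrace_orthonormal[OF card pos_form_h _ bilinear_q] trace_q by metis

lemma hess_v: assumes x: "x \<in> D" shows "hess x X Y = - lor v (H x X Y)"
proof -
  have 1: "dd \<phi> y Y = - lor v (dd s y Y)" if y: "y \<in> D" for y Y
  proof -
    have "((\<lambda>y. - lor v (s y)) has_derivative (\<lambda>X. - lor v (dd s y X))) (at y)"
      by (intro has_derivative_minus bounded_linear.has_derivative[OF lor.bounded_linear_right] ds y)
    then have "(\<phi> has_derivative (\<lambda>X. - lor v (dd s y X))) (at y)"
      by (rule has_derivative_transform_within_open[OF _ open_D y]) (simp add: \<phi>_v)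
    then show ?thesis by (rule dd_eqI)
  qed
  have "((\<lambda>y. - lor v (dd s y Y)) has_derivative (\<lambda>X. - lor v (d2 s x X Y))) (at x)"
    by (intro has_derivative_minus bounded_linear.has_derivative[OF lor.bounded_linear_right] d2s x)
  then have "((\<lambda>y. dd \<phi> y Y) has_derivative (\<lambda>X. - lor v (d2 s x X Y))) (at x)"
    by (rule has_derivative_transform_within_open[OF _ open_D x]) (simp add: 1)
  then have "d2 \<phi> x X Y = - lor v (d2 s x X Y)" by (rule dd_eqI)
  then show ?thesis unfolding hess_alt H_def by (simp add: 1[OF x] lor_simps)
qed

lemma q_eq:
  assumes x: "x \<in> D"
  shows "q x X Y = \<eta> x X Y + (hess x X Y + lor v (hat x) * h x X Y) / \<phi> x"
proof -
  have "lor v (s x) = - \<phi> x" using \<phi>_v[OF x] by simp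
  then show ?thesis
    unfolding q_II[OF x] II_eq[OF x] hess_v[OF x] using \<phi>_nz[OF x]
    by (simp add: lor_simps field_simps)
qed

text \<open>The constant curvature equation of \<open>t\<close> on the pair \<open>E\<close>,
  \<open>F\<close>, expanded by \<open>gauss_t\<close> and multiplied by the fourth power of \<phi>.
  This is the hypothesis of \<open>codazzi_p\<close>.\<close>

lemma k_eq:
  assumes x: "x \<in> D" and E: "orthonormal_pair (h x) E F"
  shows "k = (\<phi> x)\<^sup>2 * (lor (H x E E) (H x F F) - lor (H x E F) (H x E F))
      + \<phi> x * (hess x E E + hess x F F) - h x (grad x) (grad x)"
proof -
  have o: "h x E E = 1" "h x F F = 1" "h x E F = 0" "h x F E = 0"
    using E pos_formD(2)[OF pos_form_h[OF x], of F E] unfolding orthonormal_pair_def by auto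
  have c: "lor (H x F F) (H x E E) = lor (H x E E) (H x F F)" by (rule lor_commute)
  have scale: "k = f\<^sup>2 * (a - b) + f * (A + B) - w"
    if "f \<noteq> 0" "a / f\<^sup>2 + w / f^4 - ((- A / f\<^sup>2 + w / f^3) + (- B / f\<^sup>2 + w / f^3)) / f - b / f\<^sup>2 = k / f^4"
    for a b f w A B :: real
  proof -
    have "k = f^4 * (k / f^4)" using that(1) by simp
    also have "\<dots> = f\<^sup>2 * (a - b) + f * (A + B) - w"
      unfolding that(2)[symmetric] using that(1)
      by (simp add: field_simps power2_eq_square power3_eq_cube power4_eq_xxxx)
    finally show ?thesis .
  qed
  show ?thesis
    using curv_t[OF x, of F F E E] unfolding gauss_t[OF x] h_t[OF x] e_def H_sym[OF x, of F E] c
    by (intro scale[OF \<phi>_nz[OF x]]) (simp add: o power2_eq_square power4_eq_xxxx)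
qed

lemma r_tensor_eq:
  assumes x: "x \<in> D" and V: "V x = central_span s x"
  shows "r_tensor V s x X Y = q x X Y + p k x X Y"
proof -
  obtain E F where E: "orthonormal_pair (h x) E F" using orthonormal_exists[OF x] by blast
  have o: "h x E E = 1" "h x F F = 1" using E unfolding orthonormal_pair_def by auto
  let ?m = "lor (mean x) (mean x)"
  let ?K = "lor (H x E E) (H x F F) - lor (H x E F) (H x E F)"
  note n = \<phi>_nz[OF x]
  \<comment> \<open>That \<open>q\<close> is tracefree determines the square of \<open>mean\<close>,
    the one term of \<open>r_zero\<close> that does not occur in \<open>p\<close>.\<close>
  have "?m + (hess x E E + hess x F F + 2 * lor v (hat x)) / \<phi> x = 0"
    using trace_q[OF x E] trace_\<eta>[OF x E] unfolding q_eq[OF x] o by (simp add: add_divide_distrib)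
  then have m: "?m = - ((hess x E E + hess x F F + 2 * lor v (hat x)) / \<phi> x)" by linarith
  have \<rho>: "\<rho> k x = (?K + (hess x E E + hess x F F) / \<phi> x) / 2"
    unfolding \<rho>_def k_eq[OF x E] using n by (simp add: field_simps power2_eq_square)
  show ?thesis
    unfolding r_tensor_def r_zero_eq[where V = V, OF x V] gauss_curv_eq[OF x E] q_eq[OF x] p_def \<rho> m
    using n by (simp add: field_simps)
qed

text \<open>By \<open>r_tensor_eq\<close> the claim is the Codazzi equation of \<open>p\<close>. The
  tensor \<open>q'\<close> stands for chart components that agree with \<open>q\<close> on
  \<open>D\<close>; as \<open>D\<close> is open, this includes derivatives.\<close>

lemma cotton_york_q:
  assumes x: "x \<in> D" and V: "\<And>y. y \<in> D \<Longrightarrow> V y = central_span s y"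
    and q': "\<And>y X Y. y \<in> D \<Longrightarrow> q' y X Y = q y X Y"
  shows "cov_bilin h q' x X Y Z - cov_bilin h q' x Y X Z = cotton_york V s x X Y Z"
proof -
  obtain E F where E: "orthonormal_pair (h x) E F" using orthonormal_exists[OF x] by blast
  have "cov_bilin h (r_tensor V s) x X Y Z = cov_bilin h q' x X Y Z + cov_bilin h (p k) x X Y Z" for X Y Z
  proof -
    have "((\<lambda>y. q y Y Z + p k y Y Z) has_derivative (\<lambda>X. dd (\<lambda>y. q y Y Z) x X + dd (\<lambda>y. p k y Y Z) x X)) (at x)"
      by (intro has_derivative_add smooth_on_has_derivative[OF open_D _ x] smooth_q smooth_p)
    then have "((\<lambda>y. r_tensor V s y Y Z) has_derivative (\<lambda>X. dd (\<lambda>y. q y Y Z) x X + dd (\<lambda>y. p k y Y Z) x X)) (at x)"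
      by (rule has_derivative_transform_within_open[OF _ open_D x]) (simp add: r_tensor_eq[where V = V] V)
    then have "dd (\<lambda>y. r_tensor V s y Y Z) x X = dd (\<lambda>y. q y Y Z) x X + dd (\<lambda>y. p k y Y Z) x X"
      by (rule dd_eqI)
    moreover have "dd (\<lambda>y. q' y Y Z) x = dd (\<lambda>y. q y Y Z) x"
      by (rule dd_cong_open[OF open_D x]) (simp add: q')
    ultimately show ?thesis
      unfolding cov_bilin_def by (simp add: r_tensor_eq[where V = V, OF x V[OF x]] q'[OF x])
  qed
  then show ?thesis
    unfolding cotton_york_def using codazzi_p[OF card x E k_eq[OF x E], of X Y Z] by simp
qed

text \<open>The Ricci equation of the flat normal connection, paired with \<open>v\<close> and
  divided by \<phi>.\<close>

lemma q_commutes: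
  assumes D': "(D, \<psi>) \<in> A" and V: "\<And>y. y \<in> D \<Longrightarrow> V (\<psi> y) = central_span s y"
    and flat: "normal_nabla_flat A V" and x: "x \<in> D" and u: "u \<in> lorth (central_span s x)"
  shows "q x X (sff_transpose (central_span s x) s x Y u) = q x Y (sff_transpose (central_span s x) s x X u)"
  unfolding sff_transpose_eq[OF x] q_II[OF x] using ricci_equation[OF D' V flat x u, of X Y] by simp

end

section \<open>Immersed submanifolds of the conformal sphere\<close>

lemma null_map_cong:
  assumes "null_map D s" and eq: "\<And>x. x \<in> D \<Longrightarrow> t x = s x"
  shows "null_map D t"
proof -
  interpret null_map D s by fact
  show ?thesis
  proof
    show "smooth_on D t" by (rule smooth_on_cong[OF open_D _ smooth]) (simp add: eq)
    show "lift_metric t x X X > 0" if "x \<in> D" "X \<noteq> 0" for x X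
      using pos[OF that] dd_cong_open[OF open_D that(1), of t s] eq by (simp add: lift_metric_def)
  qed (use open_D null eq in auto)
qed

lemma d2_cong_open:
  assumes "open S" "x \<in> S" "\<And>y. y \<in> S \<Longrightarrow> f y = g y"
  shows "d2 f x X Y = d2 g x X Y"
proof -
  have "dd f y Y = dd g y Y" if "y \<in> S" for y using dd_cong_open[OF assms(1) that, of f g] assms(3) by simp
  then show ?thesis using dd_cong_open[OF assms(1,2), of "\<lambda>y. dd f y Y" "\<lambda>y. dd g y Y"] by simp
qed

lemma central_span_cong:
  assumes S: "open S" "x \<in> S" "\<And>y. y \<in> S \<Longrightarrow> f y = g y"
  shows "central_span f x = central_span g x"
proof -
  have "lift_metric f x = lift_metric g x" "dd f x = dd g x" "f x = g x"
    using dd_cong_open[OF S] S by (auto simp: lift_metric_def fun_eq_iff)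
  then show ?thesis unfolding central_span_def by (simp add: d2_cong_open[OF S])
qed

lemma sff_cong:
  assumes S: "open S" "x \<in> S" "\<And>y. y \<in> S \<Longrightarrow> f y = g y"
  shows "sff W f x X Y = sff W g x X Y"
  unfolding sff_def by (simp add: d2_cong_open[OF S])

locale immersed =
  fixes A :: "('p::{t2_space, second_countable_topology}, 'm::finite) param set"
    and \<Lambda> :: "'p \<Rightarrow> ('e::euclidean_space \<times> real) set"
  assumes atlas: "smooth_atlas A" and immersion: "sphere_immersion A \<Lambda>"
begin

lemma chart:
  assumes "(D, \<psi>) \<in> A"
  shows "open D" "open (\<psi> ` D)" "continuous_on D \<psi>" "inj_on \<psi> D" "continuous_on (\<psi> ` D) (inv_into D \<psi>)"
proof -
  have *: "open D" "open (\<psi> ` D)" "homeomorphism D (\<psi> ` D) \<psi> (inv_into D \<psi>)"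
    using atlas assms unfolding smooth_atlas_def by blast+
  then show "open D" "open (\<psi> ` D)" "continuous_on D \<psi>" "continuous_on (\<psi> ` D) (inv_into D \<psi>)"
    unfolding homeomorphism_def by blast+
  show "inj_on \<psi> D" using *(3) unfolding homeomorphism_def inj_on_def by metis
qed

lemma chart_at: "\<exists>D \<psi> x. (D, \<psi>) \<in> A \<and> x \<in> D \<and> \<psi> x = p"
proof -
  have "p \<in> (\<Union>(D, \<psi>)\<in>A. \<psi> ` D)" using atlas unfolding smooth_atlas_def by blast
  then show ?thesis by blast
qed

lemma open_chart_preimage: "(D, \<psi>) \<in> A \<Longrightarrow> open U \<Longrightarrow> open (D \<inter> \<psi> -` U)"
  using continuous_open_preimage[OF chart(3,1)] by blast

lemma open_chart_image:
  assumes "(D, \<psi>) \<in> A" "U \<subseteq> D" "open U"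
  shows "open (\<psi> ` U)"
proof -
  have "\<psi> ` U = \<psi> ` D \<inter> inv_into D \<psi> -` U"
    using assms(2) chart(4)[OF assms(1)] by (auto simp: inv_into_f_f subset_iff)
  then show ?thesis using continuous_open_preimage[OF chart(5,2)] assms by metis
qed

context
  fixes D' \<psi>' D \<psi>
  assumes charts: "(D', \<psi>') \<in> A" "(D, \<psi>) \<in> A"
begin

definition overlap where "overlap = D' \<inter> \<psi>' -` (\<psi> ` D)"

lemma open_overlap: "open overlap"
  unfolding overlap_def by (rule open_chart_preimage[OF charts(1) chart(2)[OF charts(2)]])

lemma smooth_transition: "smooth_on overlap (inv_into D \<psi> \<circ> \<psi>')"
  using atlas charts unfolding smooth_atlas_def overlap_def by blast

lemma transition:
  assumes "x \<in> overlap"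
  shows "(inv_into D \<psi> \<circ> \<psi>') x \<in> D" "\<psi> ((inv_into D \<psi> \<circ> \<psi>') x) = \<psi>' x"
  using assms unfolding overlap_def by (auto intro: inv_into_into f_inv_into_f)

lemma transition_eq:
  assumes "x \<in> D'" "y \<in> D" "\<psi>' x = \<psi> y"
  shows "x \<in> overlap" "(inv_into D \<psi> \<circ> \<psi>') x = y"
  using assms chart(4)[OF charts(2)] unfolding overlap_def by (auto simp: inv_into_f_f)

end

text \<open>The reverse transition map is a left inverse, so its derivative undoes that of the
  transition map.\<close>

lemma transition_inj:
  assumes charts: "(D', \<psi>') \<in> A" "(D, \<psi>) \<in> A" and x: "x \<in> overlap D' \<psi>' D \<psi>"
    and X: "dd (inv_into D \<psi> \<circ> \<psi>') x X = 0"
  shows "X = 0"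
proof -
  let ?to = "inv_into D \<psi> \<circ> \<psi>'" and ?back = "inv_into D' \<psi>' \<circ> \<psi>"
  let ?E = "overlap D' \<psi>' D \<psi>"
  have ret: "?to y \<in> overlap D \<psi> D' \<psi>'" "?back (?to y) = y" if "y \<in> ?E" for y
  proof -
    have "y \<in> D'" using that unfolding overlap_def[OF charts] by blast
    then show "?to y \<in> overlap D \<psi> D' \<psi>'" "?back (?to y) = y"
      using transition_eq[OF charts(2,1) transition(1)[OF charts that] _ transition(2)[OF charts that]] by auto
  qed
  have 1: "((\<lambda>y. ?back (?to y)) has_derivative (\<lambda>X. dd ?back (?to x) (dd ?to x X))) (at x)"
    by (rule has_derivative_compose[OF smooth_on_has_derivative[OF open_overlap[OF charts] smooth_transition[OF charts] x]
          smooth_on_has_derivative[OF open_overlap[OF charts(2,1)] smooth_transition[OF charts(2,1)] ret(1)[OF x]]])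
  have "((\<lambda>y. ?back (?to y)) has_derivative (\<lambda>X. X)) (at x)"
    by (rule has_derivative_transform_within_open[OF has_derivative_ident open_overlap[OF charts] x]) (simp only: ret)
  from fun_cong[OF has_derivative_unique[OF this 1], of X] have "X = dd ?back (?to x) 0" using X by simp
  then show ?thesis
    using linear_0[OF smooth_on_linear_dd[OF open_overlap[OF charts(2,1)] smooth_transition[OF charts(2,1)] ret(1)[OF x]]] by simp
qed

lemma section_point:
  assumes "positive_section A \<Lambda> U \<sigma>" "p \<in> U"
  shows "lor (\<sigma> p) (\<sigma> p) = 0" "snd (\<sigma> p) > 0" "\<Lambda> p = span {\<sigma> p}"
proof -
  have s: "\<sigma> p \<in> \<Lambda> p" "lor (\<sigma> p) (\<sigma> p) = 0" "snd (\<sigma> p) > 0"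
    using assms unfolding positive_section_def light_cone_half_def by blast+
  then show "lor (\<sigma> p) (\<sigma> p) = 0" "snd (\<sigma> p) > 0" by auto
  have "\<Lambda> p \<in> conformal_sphere" using immersion unfolding sphere_immersion_def by blast
  then obtain w where w: "\<Lambda> p = span {w}" unfolding conformal_sphere_def by blast
  then obtain c where c: "\<sigma> p = c *\<^sub>R w" using s(1) unfolding w span_singleton by blast
  then have "c \<noteq> 0" using s(3) by auto
  then have "w = (1 / c) *\<^sub>R \<sigma> p" using c by simp
  then have "w \<in> span {\<sigma> p}" by (metis span_base span_mul insertI1)
  then show "\<Lambda> p = span {\<sigma> p}"
    using c unfolding w by (intro span_eq[THEN iffD2]) (auto intro: span_mul span_base)
qed

lemma section_smooth: "positive_section A \<Lambda> U \<sigma> \<Longrightarrow> (D, \<psi>) \<in> A \<Longrightarrow> smooth_on (D \<inter> \<psi> -` U) (\<sigma> \<circ> \<psi>)"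
  unfolding positive_section_def smooth_map_on_def by blast

lemma section_smooth_UNIV: "positive_section A \<Lambda> UNIV \<sigma> \<Longrightarrow> (D, \<psi>) \<in> A \<Longrightarrow> smooth_on D (\<sigma> \<circ> \<psi>)"
  using section_smooth[of UNIV] by simp

text \<open>The factor between two positive sections of a line is read off their last coordinates,
  which are positive. It is written as a reciprocal to match the rescaled lift in
  \<open>conformal_change\<close>.\<close>

lemma section_ratio:
  assumes "positive_section A \<Lambda> U \<sigma>" "positive_section A \<Lambda> U' \<sigma>'" "p \<in> U" "p \<in> U'"
  shows "\<sigma> p = (1 / (snd (\<sigma>' p) / snd (\<sigma> p))) *\<^sub>R \<sigma>' p"
proof -
  have "\<sigma> p \<in> span {\<sigma>' p}"
    using section_point(3)[OF assms(1,3)] section_point(3)[OF assms(2,4)] span_base[of "\<sigma> p" "{\<sigma> p}"] by simp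
  then obtain c where c: "\<sigma> p = c *\<^sub>R \<sigma>' p" unfolding span_singleton by blast
  then have "snd (\<sigma> p) = c * snd (\<sigma>' p)" by simp
  then have "1 / (snd (\<sigma>' p) / snd (\<sigma> p)) = c"
    using section_point(2)[OF assms(2,4)] section_point(2)[OF assms(1,3)] by (simp add: field_simps)
  then show ?thesis using c by (simp only:)
qed

text \<open>\<open>sphere_immersion\<close> gives injectivity for one global section. Its
  derivatives are orthogonal to the section and, if nonzero directions are used, outside the line,
  hence spacelike by \<open>lor_orthogonal_to_null\<close>; any other section is a conformal
  rescaling.\<close>

lemma null_map_section:
  assumes \<sigma>: "positive_section A \<Lambda> U \<sigma>" and U: "open U" and D: "(D, \<psi>) \<in> A"
  shows "null_map (D \<inter> \<psi> -` U) (\<sigma> \<circ> \<psi>)"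
proof -
  let ?E = "D \<inter> \<psi> -` U"
  have oE: "open ?E" by (rule open_chart_preimage[OF D U])
  obtain \<sigma>0 where \<sigma>0: "positive_section A \<Lambda> UNIV \<sigma>0"
    and inj: "\<forall>(D, \<psi>)\<in>A. \<forall>x\<in>D. \<forall>X. dd (\<sigma>0 \<circ> \<psi>) x X \<in> \<Lambda> (\<psi> x) \<longrightarrow> X = 0"
    using immersion unfolding sphere_immersion_def by blast
  have sm: "smooth_on ?E (\<sigma>0 \<circ> \<psi>)" by (rule smooth_on_subset[OF _ section_smooth_UNIV[OF \<sigma>0 D]]) blast
  have nl: "lor ((\<sigma>0 \<circ> \<psi>) y) ((\<sigma>0 \<circ> \<psi>) y) = 0" for y using section_point(1)[OF \<sigma>0] by simp
  interpret n: null_map ?E "\<sigma>0 \<circ> \<psi>"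
  proof
    show "lift_metric (\<sigma>0 \<circ> \<psi>) x X X > 0" if x: "x \<in> ?E" and X: "X \<noteq> 0" for x X
    proof -
      let ?n = "(\<sigma>0 \<circ> \<psi>) x" and ?u = "dd (\<sigma>0 \<circ> \<psi>) x X"
      have n0: "?n \<noteq> 0" using section_point(2)[OF \<sigma>0, of "\<psi> x"] by auto
      have un: "lor ?u ?n = 0" by (rule null_derivative[OF oE sm nl x])
      have "?u \<notin> \<Lambda> (\<psi> x)" using inj D x X by blast
      then have "\<not> (\<exists>c. ?u = c *\<^sub>R ?n)"
        using section_point(3)[OF \<sigma>0, of "\<psi> x"] by (auto simp: span_singleton)
      then have "lor ?u ?u \<noteq> 0" using lor_orthogonal_to_null(2)[OF nl n0 un] by blast
      then show ?thesis using lor_orthogonal_to_null(1)[OF nl n0 un] unfolding lift_metric_def by simp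
    qed
  qed (use oE sm nl in auto)
  let ?\<phi> = "\<lambda>x. snd (\<sigma>0 (\<psi> x)) / snd (\<sigma> (\<psi> x))"
  interpret c: conformal_change ?E "\<sigma>0 \<circ> \<psi>" ?\<phi>
  proof
    have 1: "smooth_on ?E (\<lambda>x. snd ((\<sigma>0 \<circ> \<psi>) x))"
      by (rule smooth_on_bounded_linear[OF oE bounded_linear_snd sm])
    have 2: "smooth_on ?E (\<lambda>x. snd ((\<sigma> \<circ> \<psi>) x))"
      by (rule smooth_on_bounded_linear[OF oE bounded_linear_snd section_smooth[OF \<sigma> D]])
    have "snd ((\<sigma> \<circ> \<psi>) x) \<noteq> 0" if "x \<in> ?E" for x using section_point(2)[OF \<sigma>, of "\<psi> x"] that by auto
    from smooth_on_divide[OF oE 1 2 this] show "smooth_on ?E ?\<phi>" by simp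
    show "?\<phi> x \<noteq> 0" if "x \<in> ?E" for x
      using section_point(2)[OF \<sigma>0, of "\<psi> x"] section_point(2)[OF \<sigma>, of "\<psi> x"] that by auto
  qed
  show ?thesis
    by (rule null_map_cong[OF c.t.null_map_axioms]) (use section_ratio[OF \<sigma> \<sigma>0] in auto)
qed

lemma null_map_section_UNIV: "positive_section A \<Lambda> UNIV \<sigma> \<Longrightarrow> (D, \<psi>) \<in> A \<Longrightarrow> null_map D (\<sigma> \<circ> \<psi>)"
  using null_map_section[of UNIV] by simp

lemma global_section: "\<exists>\<sigma>. positive_section A \<Lambda> UNIV \<sigma>"
  using immersion unfolding sphere_immersion_def by blast

end

section \<open>The central sphere congruence as a global object\<close>

locale immersed_surface = immersed A \<Lambda>
  for A :: "('p::{t2_space, second_countable_topology}, 'm::finite) param set"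
    and \<Lambda> :: "'p \<Rightarrow> ('e::euclidean_space \<times> real) set" +
  assumes card: "CARD('m) = 2"
begin

lemma null_surface_section:
  assumes "positive_section A \<Lambda> UNIV \<sigma>" "(D, \<psi>) \<in> A"
  shows "null_surface D (\<sigma> \<circ> \<psi>)"
proof -
  interpret null_map D "\<sigma> \<circ> \<psi>" by (rule null_map_section_UNIV[OF assms])
  show ?thesis by unfold_locales (rule card)
qed

lemma reparam_surface_transition:
  assumes charts: "(D', \<psi>') \<in> A" "(D, \<psi>) \<in> A" and s: "null_map D s"
  shows "reparam_surface D s (overlap D' \<psi>' D \<psi>) (inv_into D \<psi> \<circ> \<psi>')"
proof -
  interpret null_map D s by fact
  show ?thesis
    by unfold_locales (use open_overlap[OF charts] smooth_transition[OF charts] transition[OF charts]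
        transition_inj[OF charts] card in auto)
qed

lemma central_span_section:
  assumes \<sigma>: "positive_section A \<Lambda> UNIV \<sigma>" and \<sigma>': "positive_section A \<Lambda> UNIV \<sigma>'"
    and D: "(D, \<psi>) \<in> A" "x \<in> D"
  shows "central_span (\<sigma> \<circ> \<psi>) x = central_span (\<sigma>' \<circ> \<psi>) x"
proof -
  let ?\<phi> = "\<lambda>x. snd (\<sigma>' (\<psi> x)) / snd (\<sigma> (\<psi> x))"
  interpret n: null_map D "\<sigma>' \<circ> \<psi>" by (rule null_map_section_UNIV[OF \<sigma>' D(1)])
  interpret c: conformal_surface D "\<sigma>' \<circ> \<psi>" ?\<phi>
  proof
    have "smooth_on D (\<lambda>x. snd ((\<sigma>' \<circ> \<psi>) x))" "smooth_on D (\<lambda>x. snd ((\<sigma> \<circ> \<psi>) x))"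
      by (intro smooth_on_bounded_linear[OF n.open_D bounded_linear_snd] section_smooth_UNIV[OF _ D(1)] \<sigma> \<sigma>')+
    moreover have "snd ((\<sigma> \<circ> \<psi>) x) \<noteq> 0" for x using section_point(2)[OF \<sigma>, of "\<psi> x"] by simp
    ultimately have "smooth_on D (\<lambda>x. snd ((\<sigma>' \<circ> \<psi>) x) / snd ((\<sigma> \<circ> \<psi>) x))"
      by (intro smooth_on_divide n.open_D)
    then show "smooth_on D ?\<phi>" by simp
    show "?\<phi> x \<noteq> 0" for x
      using section_point(2)[OF \<sigma>', of "\<psi> x"] section_point(2)[OF \<sigma>, of "\<psi> x"] by auto
  qed (rule card)
  have "\<sigma> \<circ> \<psi> = c.t" using section_ratio[OF \<sigma> \<sigma>'] by (auto simp: fun_eq_iff)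
  then show ?thesis using c.central_span_t[OF D(2)] by metis
qed

lemma central_span_chart:
  assumes \<sigma>: "positive_section A \<Lambda> UNIV \<sigma>" and charts: "(D', \<psi>') \<in> A" "(D, \<psi>) \<in> A"
    and x: "x \<in> D'" "y \<in> D" "\<psi>' x = \<psi> y"
  shows "central_span (\<sigma> \<circ> \<psi>') x = central_span (\<sigma> \<circ> \<psi>) y"
proof -
  interpret r: reparam_surface D "\<sigma> \<circ> \<psi>" "overlap D' \<psi>' D \<psi>" "inv_into D \<psi> \<circ> \<psi>'"
    by (rule reparam_surface_transition[OF charts null_map_section_UNIV[OF \<sigma> charts(2)]])
  note xE = transition_eq[OF charts x]
  have "central_span (\<sigma> \<circ> \<psi>') x = central_span r.s' x"
    by (rule central_span_cong[OF r.open_E xE(1)]) (use transition(2)[OF charts] in simp)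
  also have "\<dots> = central_span (\<sigma> \<circ> \<psi>) y" unfolding r.central_span_s'[OF xE(1)] xE(2) ..
  finally show ?thesis .
qed

text \<open>A choice among all sections and charts at the point; by \<open>V_eq\<close> they all
  give the same space.\<close>

definition V where "V p = (SOME W. \<exists>\<sigma> D \<psi> x. positive_section A \<Lambda> UNIV \<sigma> \<and> (D, \<psi>) \<in> A \<and> x \<in> D \<and> \<psi> x = p \<and>
  W = central_span (\<sigma> \<circ> \<psi>) x)"

lemma V_eq:
  assumes "positive_section A \<Lambda> UNIV \<sigma>" "(D, \<psi>) \<in> A" "x \<in> D"
  shows "V (\<psi> x) = central_span (\<sigma> \<circ> \<psi>) x"
proof -
  have "\<exists>W \<sigma>' D' \<psi>' x'. positive_section A \<Lambda> UNIV \<sigma>' \<and> (D', \<psi>') \<in> A \<and> x' \<in> D' \<and> \<psi>' x' = \<psi> x \<and>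
      W = central_span (\<sigma>' \<circ> \<psi>') x'" using assms by blast
  from someI_ex[OF this] obtain \<sigma>' D' \<psi>' x' where *: "positive_section A \<Lambda> UNIV \<sigma>'" "(D', \<psi>') \<in> A" "x' \<in> D'"
    "\<psi>' x' = \<psi> x" "V (\<psi> x) = central_span (\<sigma>' \<circ> \<psi>') x'" unfolding V_def by blast
  show ?thesis
    unfolding *(5) central_span_section[OF *(1) assms(1) *(2,3)]
    by (rule central_span_chart[OF assms(1) *(2) assms(2) *(3) assms(3) *(4)])
qed

lemma sphere_congruence_V: "sphere_congruence A \<Lambda> V"
proof -
  obtain \<sigma> where \<sigma>: "positive_section A \<Lambda> UNIV \<sigma>" using global_section by blast
  have "\<exists>U F. open U \<and> p \<in> U \<and> (\<forall>i<4::nat. smooth_map_on A U (F i)) \<and>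
       (\<forall>q\<in>U. V q = span ((\<lambda>i. F i q) ` {..<4}) \<and> dim (V q) = 4)" for p
  proof -
    obtain D \<psi> x0 where D: "(D, \<psi>) \<in> A" and x0: "x0 \<in> D" "\<psi> x0 = p" using chart_at by blast
    interpret n: null_surface D "\<sigma> \<circ> \<psi>" by (rule null_surface_section[OF \<sigma> D])
    obtain a b :: 'm where ab: "UNIV = {a, b}" "a \<noteq> b" using card by (metis card_2_iff)
    \<comment> \<open>A local frame indexed as \<open>smooth_subbundle\<close> requires;
      \<open>hat\<close> supplies the direction outside the osculating space.\<close>
    define f :: "nat \<Rightarrow> real ^ 'm \<Rightarrow> 'e \<times> real" where
      "f i = [\<sigma> \<circ> \<psi>, n.hat, \<lambda>x. dd (\<sigma> \<circ> \<psi>) x (axis a 1), \<lambda>x. dd (\<sigma> \<circ> \<psi>) x (axis b 1)] ! i" for i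
    have i4: "{..<4} = {0, 1, 2, 3 :: nat}" by auto
    have f: "f 0 = \<sigma> \<circ> \<psi>" "f 1 = n.hat" "f 2 = (\<lambda>x. dd (\<sigma> \<circ> \<psi>) x (axis a 1))" "f 3 = (\<lambda>x. dd (\<sigma> \<circ> \<psi>) x (axis b 1))"
      unfolding f_def by (simp_all add: numeral_2_eq_2 numeral_3_eq_3)
    have sf: "smooth_on D (f i)" if "i < 4" for i
    proof -
      have "i \<in> {0, 1, 2, 3}" using that by auto
      then show ?thesis using f n.smooth n.smooth_hat smooth_on_dd[OF n.smooth] by auto
    qed
    have smooth_frame: "smooth_map_on A (\<psi> ` D) (\<lambda>q. f i (inv_into D \<psi> q))" if "i < 4" for i
      unfolding smooth_map_on_def
    proof (clarify)
      fix D' \<psi>' assume D': "(D', \<psi>') \<in> A"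
      have "smooth_on (overlap D' \<psi>' D \<psi>) (\<lambda>x. f i ((inv_into D \<psi> \<circ> \<psi>') x))"
        by (rule smooth_on_compose[OF open_overlap[OF D' D] n.open_D transition(1)[OF D' D] smooth_transition[OF D' D] sf[OF that]])
      then show "smooth_on (D' \<inter> \<psi>' -` \<psi> ` D) ((\<lambda>q. f i (inv_into D \<psi> q)) \<circ> \<psi>')"
        unfolding overlap_def[OF D' D] by (simp add: o_def)
    qed
    have spans: "V q = span ((\<lambda>i. f i (inv_into D \<psi> q)) ` {..<4}) \<and> dim (V q) = 4" if "q \<in> \<psi> ` D" for q
    proof -
      define x where "x = inv_into D \<psi> q"
      have x: "x \<in> D" "\<psi> x = q" using that unfolding x_def by (auto intro: inv_into_into f_inv_into_f)
      have Vq: "V q = central_span (\<sigma> \<circ> \<psi>) x" using V_eq[OF \<sigma> D x(1)] x(2) by simp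
      let ?F = "{(\<sigma> \<circ> \<psi>) x, n.hat x, dd (\<sigma> \<circ> \<psi>) x (axis a 1), dd (\<sigma> \<circ> \<psi>) x (axis b 1)}"
      have F: "(\<lambda>i. f i (inv_into D \<psi> q)) ` {..<4} = ?F" unfolding i4 x_def[symmetric] by (simp add: f f(2)[unfolded One_nat_def])
      have "central_span (\<sigma> \<circ> \<psi>) x = span ?F"
      proof
        show "span ?F \<subseteq> central_span (\<sigma> \<circ> \<psi>) x"
          by (rule span_minimal[OF _ n.subspace_central_span]) (use n.central_span_mem x in auto)
        have dW: "dd (\<sigma> \<circ> \<psi>) x W \<in> span ?F" for W
        proof -
          have "dd (\<sigma> \<circ> \<psi>) x W = (W $ a) *\<^sub>R dd (\<sigma> \<circ> \<psi>) x (axis a 1) + (W $ b) *\<^sub>R dd (\<sigma> \<circ> \<psi>) x (axis b 1)"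
            using linear_vec_expansion[OF n.lin_ds[OF x(1)], of W] ab(2) unfolding ab(1) by simp
          also have "\<dots> \<in> span ?F" by (intro span_add span_mul span_base) auto
          finally show ?thesis .
        qed
        have "n.frame x p \<in> span ?F" for p
          unfolding n.frame_def by (intro span_add span_mul dW) (auto intro: span_base)
        then show "central_span (\<sigma> \<circ> \<psi>) x \<subseteq> span ?F" unfolding n.central_span_eq[OF x(1)] by blast
      qed
      then show ?thesis unfolding F Vq using n.dim_central_span[OF x(1)] by simp
    qed
    have p: "p \<in> \<psi> ` D" using x0 by blast
    show ?thesis
      by (rule exI[of _ "\<psi> ` D"], rule exI[of _ "\<lambda>i q. f i (inv_into D \<psi> q)"])
        (intro conjI allI impI ballI chart(2)[OF D] p smooth_frame conjunct1[OF spans] conjunct2[OF spans])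
  qed
  then have sub: "smooth_subbundle A (CARD('m) + 2) V" unfolding smooth_subbundle_def card by simp
  have "has_signature (V p) (CARD('m) + 1) 1 \<and> osculating A \<Lambda> p \<subseteq> V p" for p
  proof
    obtain D \<psi> x where D: "(D, \<psi>) \<in> A" and x: "x \<in> D" "\<psi> x = p" using chart_at by blast
    interpret n: null_surface D "\<sigma> \<circ> \<psi>" by (rule null_surface_section[OF \<sigma> D])
    have Vp: "V p = central_span (\<sigma> \<circ> \<psi>) x" using V_eq[OF \<sigma> D x(1)] x(2) by simp
    show "has_signature (V p) (CARD('m) + 1) 1" unfolding Vp card using n.signature_central_span[OF x(1)] by simp
    have "\<sigma> p \<in> V p" unfolding Vp using n.central_span_mem(1)[of x] x(2) by simp
    then have "\<Lambda> p \<subseteq> V p"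
      unfolding section_point(3)[OF \<sigma> UNIV_I] Vp by (intro span_minimal n.subspace_central_span) auto
    moreover have "dd (\<sigma>' \<circ> \<psi>') x' X \<in> V p"
      if "positive_section A \<Lambda> UNIV \<sigma>'" "(D', \<psi>') \<in> A" "x' \<in> D'" "\<psi>' x' = p" for \<sigma>' D' \<psi>' x' X
    proof -
      interpret n': null_surface D' "\<sigma>' \<circ> \<psi>'" by (rule null_surface_section[OF that(1,2)])
      show ?thesis using V_eq[OF that(1-3)] n'.central_span_mem(2) that(4) by simp
    qed
    ultimately show "osculating A \<Lambda> p \<subseteq> V p"
      unfolding osculating_def Vp by (intro span_minimal n.subspace_central_span) auto
  qed
  then show ?thesis using sub unfolding sphere_congruence_def by blast
qed

lemma trace_V:
  assumes "positive_section A \<Lambda> UNIV \<sigma>" "(D, \<psi>) \<in> A" "x \<in> D"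
  shows "mtrace (lift_metric (\<sigma> \<circ> \<psi>) x) (sff (V (\<psi> x)) (\<sigma> \<circ> \<psi>) x) = 0"
proof -
  interpret n: null_surface D "\<sigma> \<circ> \<psi>" by (rule null_surface_section[OF assms(1,2)])
  show ?thesis unfolding V_eq[OF assms] by (rule n.trace_II[OF assms(3)])
qed

text \<open>A congruence with tracefree form contains the trace of the second derivative besides the
  osculating space, hence all of \<open>central_span\<close>, and both have dimension 4.\<close>

lemma V_unique:
  assumes V': "sphere_congruence A \<Lambda> V'"
    and tr: "\<forall>\<sigma>. positive_section A \<Lambda> UNIV \<sigma> \<longrightarrow> (\<forall>(D, \<psi>)\<in>A. \<forall>x\<in>D.
             mtrace (lift_metric (\<sigma> \<circ> \<psi>) x) (sff (V' (\<psi> x)) (\<sigma> \<circ> \<psi>) x) = 0)"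
  shows "V' = V"
proof
  fix p
  obtain \<sigma> where \<sigma>: "positive_section A \<Lambda> UNIV \<sigma>" using global_section by blast
  obtain D \<psi> x where D: "(D, \<psi>) \<in> A" and x: "x \<in> D" "\<psi> x = p" using chart_at by blast
  interpret n: null_surface D "\<sigma> \<circ> \<psi>" by (rule null_surface_section[OF \<sigma> D])
  let ?W = "V' p"
  have sig: "has_signature ?W 3 1" and osc: "osculating A \<Lambda> p \<subseteq> ?W"
    using V' card unfolding sphere_congruence_def by auto
  note W = has_signatureD[OF sig]
  have "\<sigma> p \<in> \<Lambda> p" using \<sigma> unfolding positive_section_def by blast
  then have s: "(\<sigma> \<circ> \<psi>) x \<in> ?W"
    using osc span_base[of "\<sigma> p"] x(2) unfolding osculating_def by auto
  have ds: "dd (\<sigma> \<circ> \<psi>) x X \<in> ?W" for X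
  proof -
    have "dd (\<sigma> \<circ> \<psi>) x X \<in> osculating A \<Lambda> p"
      unfolding osculating_def by (rule span_base) (use \<sigma> D x in blast)
    then show ?thesis using osc by blast
  qed
  have ll: "a \<in> lorth (lorth ?W)" if "a \<in> ?W" for a
    by (rule lorthI) (simp add: lor_commute[of a] lorthD[OF _ that])
  have P: "lproj (lorth ?W) u = u - a" if "a \<in> ?W" "u - a \<in> lorth ?W" for u a
  proof (rule lproj_eqI[OF subspace_lorth])
    show "\<exists>a\<in>lorth ?W. w - a \<in> lorth (lorth ?W)" for w
    proof -
      obtain b where "b \<in> ?W" "w - b \<in> lorth ?W" using W(3) by blast
      then show ?thesis using ll by (intro bexI[of _ "w - b"]) auto
    qed
  qed (use that ll in auto)
  have linP: "linear (lproj (lorth ?W))"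
  proof
    fix u w and c :: real
    obtain a where a: "a \<in> ?W" "u - a \<in> lorth ?W" using W(3) by blast
    obtain b where b: "b \<in> ?W" "w - b \<in> lorth ?W" using W(3) by blast
    have "(u + w) - (a + b) \<in> lorth ?W" using subspace_add[OF subspace_lorth a(2) b(2)] by (simp add: algebra_simps)
    then show "lproj (lorth ?W) (u + w) = lproj (lorth ?W) u + lproj (lorth ?W) w"
      using P[OF a] P[OF b] P[OF subspace_add[OF W(1) a(1) b(1)]] by simp
    have "c *\<^sub>R u - c *\<^sub>R a \<in> lorth ?W" using subspace_scale[OF subspace_lorth a(2), of c] by (simp add: algebra_simps)
    then show "lproj (lorth ?W) (c *\<^sub>R u) = c *\<^sub>R lproj (lorth ?W) u"
      using P[OF a] P[OF subspace_scale[OF W(1) a(1)]] by (simp add: scaleR_diff_right)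
  qed
  have d2: "d2 (\<sigma> \<circ> \<psi>) x X X + d2 (\<sigma> \<circ> \<psi>) x Y Y \<in> ?W"
    if XY: "orthonormal_pair (lift_metric (\<sigma> \<circ> \<psi>) x) X Y" for X Y
  proof -
    have bl: "bilinear (sff ?W (\<sigma> \<circ> \<psi>) x)"
      unfolding sff_def bilinear_def
      by (auto intro!: linearI simp: linear_add[OF linP] linear_cmul[OF linP] bilinear_simps[OF n.bilin_d2s[OF x(1)]])
    have "mtrace (lift_metric (\<sigma> \<circ> \<psi>) x) (sff ?W (\<sigma> \<circ> \<psi>) x) = 0" using tr \<sigma> D x by blast
    then have "sff ?W (\<sigma> \<circ> \<psi>) x X X + sff ?W (\<sigma> \<circ> \<psi>) x Y Y = 0"
      using mtrace_orthonormal[OF card n.pos_form_h[OF x(1)] XY bl] by simp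
    then have "lproj (lorth ?W) (d2 (\<sigma> \<circ> \<psi>) x X X + d2 (\<sigma> \<circ> \<psi>) x Y Y) = 0"
    proof -
      have "lproj (lorth ?W) (d2 (\<sigma> \<circ> \<psi>) x X X + d2 (\<sigma> \<circ> \<psi>) x Y Y)
        = - (sff ?W (\<sigma> \<circ> \<psi>) x X X + sff ?W (\<sigma> \<circ> \<psi>) x Y Y)"
        unfolding sff_def linear_add[OF linP] by simp
      also assume "sff ?W (\<sigma> \<circ> \<psi>) x X X + sff ?W (\<sigma> \<circ> \<psi>) x Y Y = 0"
      finally show ?thesis by (simp only: minus_zero)
    qed
    moreover obtain a where "a \<in> ?W" "d2 (\<sigma> \<circ> \<psi>) x X X + d2 (\<sigma> \<circ> \<psi>) x Y Y - a \<in> lorth ?W" using W(3) by blast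
    ultimately show ?thesis using P by fastforce
  qed
  have "central_span (\<sigma> \<circ> \<psi>) x \<subseteq> ?W"
    unfolding central_span_def by (rule span_minimal[OF _ W(1)]) (use s ds d2 in auto)
  then have "central_span (\<sigma> \<circ> \<psi>) x = ?W"
    by (rule subspace_dim_equal[OF n.subspace_central_span W(1)]) (simp add: W(2) n.dim_central_span[OF x(1)])
  then show "V' p = V p" using V_eq[OF \<sigma> D x(1)] x(2) by simp
qed

lemma central_sphere_congruence_eq: "central_sphere_congruence A \<Lambda> = V"
  unfolding central_sphere_congruence_def
proof (rule the_equality)
  show "sphere_congruence A \<Lambda> V \<and> (\<forall>\<sigma>. positive_section A \<Lambda> UNIV \<sigma> \<longrightarrow> (\<forall>(D, \<psi>)\<in>A. \<forall>x\<in>D.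
             mtrace (lift_metric (\<sigma> \<circ> \<psi>) x) (sff (V (\<psi> x)) (\<sigma> \<circ> \<psi>) x) = 0))"
    using sphere_congruence_V trace_V by blast
qed (use V_unique in blast)

end

section \<open>Submanifolds of spaceforms with constant gaussian curvature\<close>

locale immersed_spaceform = immersed A \<Lambda>
  for A :: "('p::{t2_space, second_countable_topology}, 'm::finite) param set"
    and \<Lambda> :: "'p \<Rightarrow> ('e::euclidean_space \<times> real) set" +
  fixes v :: "'e \<times> real" and K :: real
  assumes spaceform: "in_spaceform v \<Lambda>" and gauss: "constant_gaussian_curvature A v \<Lambda> K"
begin

abbreviation k where "k \<equiv> K - lor v v"

lemma spaceform_section:
  assumes \<sigma>: "positive_section A \<Lambda> UNIV \<sigma>"
  shows "lor v (\<sigma> p) \<noteq> 0" "spaceform_lift v \<Lambda> p = (1 / - lor v (\<sigma> p)) *\<^sub>R \<sigma> p"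
proof -
  have \<Lambda>: "\<Lambda> p = range (\<lambda>c. c *\<^sub>R \<sigma> p)" using section_point(3)[OF \<sigma> UNIV_I] span_singleton by metis
  obtain w where "w \<in> \<Lambda> p" "lor v w \<noteq> 0" using spaceform unfolding in_spaceform_def by blast
  then show n: "lor v (\<sigma> p) \<noteq> 0" unfolding \<Lambda> by (auto simp: lor_simps)
  show "spaceform_lift v \<Lambda> p = (1 / - lor v (\<sigma> p)) *\<^sub>R \<sigma> p"
    unfolding spaceform_lift_def
  proof (rule the_equality)
    show "(1 / - lor v (\<sigma> p)) *\<^sub>R \<sigma> p \<in> \<Lambda> p \<and> lor v ((1 / - lor v (\<sigma> p)) *\<^sub>R \<sigma> p) = - 1"
    proof
      show "(1 / - lor v (\<sigma> p)) *\<^sub>R \<sigma> p \<in> \<Lambda> p" unfolding \<Lambda> by (rule rangeI)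
    qed (use n in \<open>simp add: lor_simps\<close>)
    fix w assume "w \<in> \<Lambda> p \<and> lor v w = - 1"
    then obtain c where c: "w = c *\<^sub>R \<sigma> p" and w: "lor v w = -1" unfolding \<Lambda> by blast
    have "c * lor v (\<sigma> p) = -1" using w unfolding c by (simp add: lor_simps)
    then have "c = 1 / - lor v (\<sigma> p)" using n by (simp add: field_simps)
    then show "w = (1 / - lor v (\<sigma> p)) *\<^sub>R \<sigma> p" using c by simp
  qed
qed

lemma spaceform_lift_eq:
  assumes \<sigma>: "positive_section A \<Lambda> UNIV \<sigma>"
  shows "spaceform_lift v \<Lambda> \<circ> \<psi> = (\<lambda>y. (1 / - lor v (\<sigma> (\<psi> y))) *\<^sub>R (\<sigma> \<circ> \<psi>) y)"
  using spaceform_section(2)[OF \<sigma>] by (simp add: fun_eq_iff)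

lemma conformal_change_section:
  assumes \<sigma>: "positive_section A \<Lambda> UNIV \<sigma>" and D: "(D, \<psi>) \<in> A"
  shows "conformal_change D (\<sigma> \<circ> \<psi>) (\<lambda>y. - lor v (\<sigma> (\<psi> y)))"
proof -
  interpret n: null_map D "\<sigma> \<circ> \<psi>" by (rule null_map_section_UNIV[OF \<sigma> D])
  show ?thesis
  proof
    have "smooth_on D (\<lambda>y. - lor v ((\<sigma> \<circ> \<psi>) y))"
      by (intro smooth_on_minus smooth_on_lor smooth_on_const n.open_D n.smooth)
    then show "smooth_on D (\<lambda>y. - lor v (\<sigma> (\<psi> y)))" by simp
  qed (use spaceform_section(1)[OF \<sigma>] in simp)
qed

lemma constant_curvature_spaceform_lift:
  assumes D: "(D, \<psi>) \<in> A"
  shows "constant_curvature_map D (spaceform_lift v \<Lambda> \<circ> \<psi>) k"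
proof -
  obtain \<sigma> where \<sigma>: "positive_section A \<Lambda> UNIV \<sigma>" using global_section by blast
  interpret c: conformal_change D "\<sigma> \<circ> \<psi>" "\<lambda>y. - lor v (\<sigma> (\<psi> y))" by (rule conformal_change_section[OF \<sigma> D])
  interpret s: spaceform_map D "spaceform_lift v \<Lambda> \<circ> \<psi>" v
    unfolding spaceform_lift_eq[OF \<sigma>]
    by unfold_locales (use spaceform_section(1)[OF \<sigma>] in \<open>simp add: lor_simps\<close>)
  show ?thesis
  proof
    fix x Y Z X W assume x: "x \<in> D"
    show "lor (s.H x Y Z) (s.H x X W) - lor (s.H x X Z) (s.H x Y W) = k * (s.h x Y Z * s.h x X W - s.h x X Z * s.h x Y W)"
    proof (rule s.constant_curvature[OF x])
      show "lor (spaceform_sff v (spaceform_lift v \<Lambda> \<circ> \<psi>) x X X) (spaceform_sff v (spaceform_lift v \<Lambda> \<circ> \<psi>) x Y Y)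
        - lor (spaceform_sff v (spaceform_lift v \<Lambda> \<circ> \<psi>) x X Y) (spaceform_sff v (spaceform_lift v \<Lambda> \<circ> \<psi>) x X Y) = K"
        if "s.h x X X = 1" "s.h x Y Y = 1" "s.h x X Y = 0" for X Y
        using gauss D x that unfolding constant_gaussian_curvature_def Let_def by blast
    qed
  qed
qed

lemma induced_metric_constant_curvature: "induced_metric_constant_curvature A v \<Lambda> k"
  unfolding induced_metric_constant_curvature_def
proof (clarify)
  fix D \<psi> x and X Y :: "real ^ 'm" assume D: "(D, \<psi>) \<in> A" and x: "x \<in> D" and XY: "X \<noteq> Y" "independent {X, Y}"
  interpret c: constant_curvature_map D "spaceform_lift v \<Lambda> \<circ> \<psi>" k
    by (rule constant_curvature_spaceform_lift[OF D])
  show "sectional_curv (lift_metric (spaceform_lift v \<Lambda> \<circ> \<psi>)) x X Y = k"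
    by (rule c.sectional_curv_eq[OF x c.curv[OF x] XY])
qed

lemma conformally_flat: "conformally_flat A \<Lambda>"
  unfolding conformally_flat_def
proof
  fix p
  obtain \<sigma> where \<sigma>: "positive_section A \<Lambda> UNIV \<sigma>" using global_section by blast
  obtain D \<psi> x0 where D: "(D, \<psi>) \<in> A" and x0: "x0 \<in> D" "\<psi> x0 = p" using chart_at by blast
  let ?s = "spaceform_lift v \<Lambda> \<circ> \<psi>"
  let ?\<mu> = "\<lambda>y. - lor v (\<sigma> (\<psi> y))"
  interpret cc: conformal_change D "\<sigma> \<circ> \<psi>" ?\<mu> by (rule conformal_change_section[OF \<sigma> D])
  interpret c: constant_curvature_map D ?s k by (rule constant_curvature_spaceform_lift[OF D])
  have \<mu>0: "?\<mu> x0 \<noteq> 0" by (rule cc.\<phi>_nz[OF x0(1)])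
  \<comment> \<open>The spaceform lift is \<sigma> divided by \<open>?\<mu>\<close>, which may be
    negative. The flat lift is \<sigma> divided by \<phi> times \<open>?\<mu>\<close>, so it is
    positive where both factors have the sign \<epsilon>; this is the purpose of
    \<open>U1\<close>.\<close>
  define \<epsilon> where "\<epsilon> = sgn (?\<mu> x0)"
  have \<epsilon>: "\<epsilon> * \<epsilon> = 1" unfolding \<epsilon>_def using \<mu>0 by (simp add: sgn_if)
  obtain U0 \<phi> where U0: "open U0" "x0 \<in> U0" "U0 \<subseteq> D" "smooth_on U0 \<phi>" "\<And>x. x \<in> U0 \<Longrightarrow> \<epsilon> * \<phi> x > 0"
    and flat: "\<And>x X Y Z W. x \<in> U0 \<Longrightarrow> (let t = \<lambda>y. (1 / \<phi> y) *\<^sub>R ?s y; C = cov_hessian (lift_metric t) t x in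
      lor (C Y Z) (C X W) - lor (C X Z) (C Y W)) = 0"
    by (rule c.flat_lift[OF x0(1) \<epsilon>]) (rule that)
  define U1 where "U1 = U0 \<inter> (\<lambda>x. \<epsilon> * ?\<mu> x) -` {0<..}"
  have U1: "open U1"
  proof -
    have "continuous_on U0 ?\<mu>" using smooth_on_continuous[OF cc.smooth_\<phi>] U0(3) continuous_on_subset by blast
    then have "continuous_on U0 (\<lambda>x. \<epsilon> * ?\<mu> x)" by (rule continuous_on_mult[OF continuous_on_const])
    then show ?thesis unfolding U1_def by (rule continuous_open_preimage[OF _ U0(1)]) simp
  qed
  have U1D: "U1 \<subseteq> D" "U1 \<subseteq> U0" using U0(3) unfolding U1_def by auto
  have x01: "x0 \<in> U1" unfolding U1_def using U0(2) \<mu>0 by (auto simp: \<epsilon>_def sgn_if)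
  define t where "t = (\<lambda>y. (1 / \<phi> y) *\<^sub>R ?s y)"
  interpret f: conformal_change U1 ?s \<phi>
  proof
    show "open U1" by (rule U1)
    show "smooth_on U1 ?s" by (rule smooth_on_subset[OF U1D(1) c.smooth])
    show "lift_metric ?s x X X > 0" if "x \<in> U1" "X \<noteq> 0" for x X
      using c.pos subsetD[OF U1D(1) that(1)] that(2) .
    show "lor (?s x) (?s x) = 0" if "x \<in> U1" for x by (rule c.null[OF subsetD[OF U1D(1) that]])
    show "smooth_on U1 \<phi>" by (rule smooth_on_subset[OF U1D(2) U0(4)])
    show "\<phi> x \<noteq> 0" if "x \<in> U1" for x using U0(5)[OF subsetD[OF U1D(2) that]] by auto
  qed
  have t_pos: "t x \<in> \<Lambda> (\<psi> x) \<inter> light_cone_half" if x: "x \<in> U1" for x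
  proof -
    have "t x = (1 / (\<phi> x * ?\<mu> x)) *\<^sub>R \<sigma> (\<psi> x)"
      unfolding t_def using spaceform_section(2)[OF \<sigma>, of "\<psi> x"] by simp
    moreover have "\<phi> x * ?\<mu> x > 0"
    proof -
      have "\<epsilon> * \<phi> x > 0" "\<epsilon> * ?\<mu> x > 0" using x U0(5) unfolding U1_def by auto
      then have "(\<epsilon> * \<phi> x) * (\<epsilon> * ?\<mu> x) > 0" by (rule mult_pos_pos)
      moreover have "(\<epsilon> * \<phi> x) * (\<epsilon> * ?\<mu> x) = (\<epsilon> * \<epsilon>) * (\<phi> x * ?\<mu> x)" by (simp only: mult_ac)
      ultimately show ?thesis by (simp only: \<epsilon> mult_1_left)
    qed
    ultimately obtain c where c: "c > 0" "t x = c *\<^sub>R \<sigma> (\<psi> x)" by (metis zero_less_divide_1_iff)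
    have "t x \<in> \<Lambda> (\<psi> x)" unfolding section_point(3)[OF \<sigma> UNIV_I] c(2) by (intro span_mul span_base) simp
    then show ?thesis
      using c section_point(1,2)[OF \<sigma> UNIV_I, of "\<psi> x"] unfolding light_cone_half_def by (simp add: lor_simps)
  qed
  define U where "U = \<psi> ` U1"
  define \<sigma>' where "\<sigma>' q = t (inv_into D \<psi> q)" for q
  have oU: "open U" unfolding U_def by (rule open_chart_image[OF D U1D(1) U1])
  have inv: "inv_into D \<psi> q \<in> U1" "\<psi> (inv_into D \<psi> q) = q" if "q \<in> U" for q
    using that U1D(1) chart(4)[OF D] unfolding U_def by (auto simp: inv_into_f_f subset_iff)
  have UD: "U \<subseteq> \<psi> ` D" using U1D unfolding U_def by blast
  have st: "smooth_on U1 t" unfolding t_def by (rule f.smooth_t)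
  have chart': "open (D' \<inter> \<psi>' -` U)" "D' \<inter> \<psi>' -` U \<subseteq> overlap D' \<psi>' D \<psi>"
    "smooth_on (D' \<inter> \<psi>' -` U) (inv_into D \<psi> \<circ> \<psi>')" "\<And>x. x \<in> D' \<inter> \<psi>' -` U \<Longrightarrow> (inv_into D \<psi> \<circ> \<psi>') x \<in> U1"
    if D': "(D', \<psi>') \<in> A" for D' \<psi>'
  proof -
    show "open (D' \<inter> \<psi>' -` U)" by (rule open_chart_preimage[OF D' oU])
    show sub: "D' \<inter> \<psi>' -` U \<subseteq> overlap D' \<psi>' D \<psi>" unfolding overlap_def[OF D' D] using UD by blast
    show "smooth_on (D' \<inter> \<psi>' -` U) (inv_into D \<psi> \<circ> \<psi>')" by (rule smooth_on_subset[OF sub smooth_transition[OF D' D]])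
    show "(inv_into D \<psi> \<circ> \<psi>') x \<in> U1" if "x \<in> D' \<inter> \<psi>' -` U" for x using inv(1) that by simp
  qed
  show "\<exists>U \<sigma>. open U \<and> p \<in> U \<and> positive_section A \<Lambda> U \<sigma> \<and>
       (\<forall>(D, \<psi>)\<in>A. \<forall>x\<in>D \<inter> \<psi> -` U. \<forall>X Y Z. riemann (lift_metric (\<sigma> \<circ> \<psi>)) x X Y Z = 0)"
  proof (intro exI[of _ U] exI[of _ \<sigma>'] conjI)
    show "open U" by (rule oU)
    show "p \<in> U" unfolding U_def using x01 x0(2) by blast
    show "positive_section A \<Lambda> U \<sigma>'"
      unfolding positive_section_def smooth_map_on_def
    proof (intro conjI ballI, clarify)
      fix D' \<psi>' assume D': "(D', \<psi>') \<in> A"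
      have "smooth_on (D' \<inter> \<psi>' -` U) (\<lambda>x. t ((inv_into D \<psi> \<circ> \<psi>') x))"
        by (rule smooth_on_compose[OF chart'(1)[OF D'] U1 chart'(4)[OF D'] chart'(3)[OF D'] st])
      then show "smooth_on (D' \<inter> \<psi>' -` U) (\<sigma>' \<circ> \<psi>')" unfolding \<sigma>'_def by (simp add: o_def)
    next
      fix q assume "q \<in> U"
      then show "\<sigma>' q \<in> \<Lambda> q \<inter> light_cone_half" using t_pos[OF inv(1)] inv(2) unfolding \<sigma>'_def by simp
    qed
    show "\<forall>(D, \<psi>)\<in>A. \<forall>x\<in>D \<inter> \<psi> -` U. \<forall>X Y Z. riemann (lift_metric (\<sigma>' \<circ> \<psi>)) x X Y Z = 0"
    proof (clarify)
      fix D' \<psi>' x X Y Z assume D': "(D', \<psi>') \<in> A" and x: "x \<in> D'" "\<psi>' x \<in> U"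
      have xE: "x \<in> D' \<inter> \<psi>' -` U" using x by blast
      \<comment> \<open>The flat lift was computed in one chart; in any other chart it is a
        reparametrization, and the tensoriality of the hessian carries the vanishing over.\<close>
      interpret r: reparam U1 f.t "D' \<inter> \<psi>' -` U" "inv_into D \<psi> \<circ> \<psi>'"
        by unfold_locales (use chart'[OF D'] transition_inj[OF D' D] in auto)
      have "\<sigma>' \<circ> \<psi>' = r.s'" unfolding \<sigma>'_def t_def by (simp add: fun_eq_iff)
      moreover have "riemann (lift_metric r.s') x X Y Z = 0"
        by (rule r.flat_s'[OF xE]) (use flat[OF subsetD[OF U1D(2) chart'(4)[OF D' xE]]] in \<open>simp add: Let_def\<close>)
      ultimately show "riemann (lift_metric (\<sigma>' \<circ> \<psi>')) x X Y Z = 0" by metis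
    qed
  qed
qed

lemma commuting_cy_potential_exists:
  assumes card: "CARD('m) = 2" and flat: "weightless_normal_flat A \<Lambda>"
  shows "\<exists>q. commuting_cy_potential A \<Lambda> q"
proof
  interpret immersed_surface A \<Lambda> by unfold_locales (rule card)
  let ?sp = "spaceform_lift v \<Lambda>"
  have flatV: "normal_nabla_flat A V" using flat sphere_congruence_V unfolding weightless_normal_flat_def by blast
  have ss: "spaceform_surface D (\<sigma> \<circ> \<psi>) (\<lambda>y. - lor v (\<sigma> (\<psi> y))) v k"
    if \<sigma>: "positive_section A \<Lambda> UNIV \<sigma>" and D: "(D, \<psi>) \<in> A" for \<sigma> D \<psi>
  proof -
    interpret cc: conformal_change D "\<sigma> \<circ> \<psi>" "\<lambda>y. - lor v (\<sigma> (\<psi> y))" by (rule conformal_change_section[OF \<sigma> D])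
    interpret c: constant_curvature_map D cc.t k
      using constant_curvature_spaceform_lift[OF D] unfolding spaceform_lift_eq[OF \<sigma>] .
    show ?thesis by unfold_locales (use card c.curv in auto)
  qed
  \<comment> \<open>One formula for every chart, built from the spaceform lift and \<open>V\<close>;
    no positive section enters, so the same tensor can be tested against each of them.\<close>
  define q where "q = (\<lambda>(D :: (real ^ 'm) set, \<psi> :: real ^ 'm \<Rightarrow> 'p) (x :: real ^ 'm) (X :: real ^ 'm) (Y :: real ^ 'm). lor v (sff (V (\<psi> x)) (?sp \<circ> \<psi>) x X Y))"
  have q_eq: "q (D, \<psi>) x X Y = spaceform_surface.q (\<sigma> \<circ> \<psi>) (\<lambda>y. - lor v (\<sigma> (\<psi> y))) v x X Y"
    if \<sigma>: "positive_section A \<Lambda> UNIV \<sigma>" and D: "(D, \<psi>) \<in> A" "x \<in> D" for \<sigma> D \<psi> x X Y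
  proof -
    interpret s: spaceform_surface D "\<sigma> \<circ> \<psi>" "\<lambda>y. - lor v (\<sigma> (\<psi> y))" v k by (rule ss[OF \<sigma> D(1)])
    show ?thesis unfolding q_def s.q_def V_eq[OF \<sigma> D, symmetric] by (simp add: spaceform_lift_eq[OF \<sigma>])
  qed
  obtain \<sigma>0 where \<sigma>0: "positive_section A \<Lambda> UNIV \<sigma>0" using global_section by blast
  show "commuting_cy_potential A \<Lambda> q"
    unfolding commuting_cy_potential_def
  proof (intro conjI)
    show "symmetric_2tensor A q"
      unfolding symmetric_2tensor_def
    proof (clarify, intro conjI)
      fix D \<psi> assume D: "(D, \<psi>) \<in> A"
      interpret s: spaceform_surface D "\<sigma>0 \<circ> \<psi>" "\<lambda>y. - lor v (\<sigma>0 (\<psi> y))" v k by (rule ss[OF \<sigma>0 D])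
      have qs: "q (D, \<psi>) x = s.q x" if "x \<in> D" for x using q_eq[OF \<sigma>0 D that] by (simp add: fun_eq_iff)
      show "\<forall>x\<in>D. bilinear (q (D, \<psi>) x) \<and> (\<forall>X Y. q (D, \<psi>) x X Y = q (D, \<psi>) x Y X)"
        using qs s.bilinear_q s.q_sym by simp
      show "\<forall>X Y. smooth_on D (\<lambda>x. q (D, \<psi>) x X Y)"
        using smooth_on_cong[OF s.open_D _ s.smooth_q] qs by simp
      show "\<forall>(D', \<psi>')\<in>A. \<forall>x\<in>D. \<forall>x'\<in>D'. \<psi> x = \<psi>' x' \<longrightarrow>
          (\<forall>X Y. q (D, \<psi>) x X Y =
             q (D', \<psi>') x' (dd (inv_into D' \<psi>' \<circ> \<psi>) x X) (dd (inv_into D' \<psi>' \<circ> \<psi>) x Y))"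
      proof (clarify)
        fix D' \<psi>' x x' X Y assume D': "(D', \<psi>') \<in> A" and x: "x \<in> D" "x' \<in> D'" "\<psi> x = \<psi>' x'"
        interpret s': spaceform_surface D' "\<sigma>0 \<circ> \<psi>'" "\<lambda>y. - lor v (\<sigma>0 (\<psi>' y))" v k by (rule ss[OF \<sigma>0 D'])
        have nm: "null_map D' (?sp \<circ> \<psi>')" unfolding spaceform_lift_eq[OF \<sigma>0] by (rule s'.t.null_map_axioms)
        interpret r: reparam_surface D' "?sp \<circ> \<psi>'" "overlap D \<psi> D' \<psi>'" "inv_into D' \<psi>' \<circ> \<psi>"
          by (rule reparam_surface_transition[OF D D' nm])
        note xE = transition_eq[OF D D' x]
        have W: "V (\<psi>' x') = central_span (?sp \<circ> \<psi>') x'"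
          unfolding V_eq[OF \<sigma>0 D' x(2)] spaceform_lift_eq[OF \<sigma>0] using s'.central_span_t[OF x(2)] by simp
        have "sff (V (\<psi>' x')) (?sp \<circ> \<psi>) x X Y = sff (V (\<psi>' x')) r.s' x X Y"
          by (rule sff_cong[OF r.open_E xE(1)]) (use transition(2)[OF D D'] in simp)
        also have "\<dots> = sff (V (\<psi>' x')) (?sp \<circ> \<psi>') x' (dd (inv_into D' \<psi>' \<circ> \<psi>) x X) (dd (inv_into D' \<psi>' \<circ> \<psi>) x Y)"
          using r.II_s'[OF xE(1), of X Y] unfolding xE(2) W .
        finally show "q (D, \<psi>) x X Y = q (D', \<psi>') x' (dd (inv_into D' \<psi>' \<circ> \<psi>) x X) (dd (inv_into D' \<psi>' \<circ> \<psi>) x Y)"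
          unfolding q_def by (simp add: x(3))
      qed
    qed
    show "\<forall>\<sigma>. positive_section A \<Lambda> UNIV \<sigma> \<longrightarrow>
      (\<forall>(D, \<psi>)\<in>A. \<forall>x\<in>D.
        let s = \<sigma> \<circ> \<psi>; h = lift_metric s; V = central_sphere_congruence A \<Lambda> \<circ> \<psi> in
        mtrace (h x) (q (D, \<psi>) x) = 0 \<and>
        (\<forall>X Y Z. cov_bilin h (q (D, \<psi>)) x X Y Z - cov_bilin h (q (D, \<psi>)) x Y X Z
                 = cotton_york V s x X Y Z) \<and>
        (\<forall>X Y. \<forall>u\<in>lorth (V x).
           q (D, \<psi>) x X (sff_transpose (V x) s x Y u) = q (D, \<psi>) x Y (sff_transpose (V x) s x X u)))"
      unfolding Let_def central_sphere_congruence_eq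
    proof (intro allI impI, clarify, intro conjI allI ballI)
      fix \<sigma> D \<psi> x assume \<sigma>: "positive_section A \<Lambda> UNIV \<sigma>" and D: "(D, \<psi>) \<in> A" and x: "x \<in> D"
      interpret s: spaceform_surface D "\<sigma> \<circ> \<psi>" "\<lambda>y. - lor v (\<sigma> (\<psi> y))" v k by (rule ss[OF \<sigma> D])
      have qs: "q (D, \<psi>) x = s.q x" if "x \<in> D" for x using q_eq[OF \<sigma> D that] by (simp add: fun_eq_iff)
      have Vs: "(V \<circ> \<psi>) y = central_span (\<sigma> \<circ> \<psi>) y" if "y \<in> D" for y using V_eq[OF \<sigma> D that] by simp
      show "mtrace (lift_metric (\<sigma> \<circ> \<psi>) x) (q (D, \<psi>) x) = 0" unfolding qs[OF x] by (rule s.mtrace_q[OF x])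
      show "cov_bilin (lift_metric (\<sigma> \<circ> \<psi>)) (q (D, \<psi>)) x X Y Z - cov_bilin (lift_metric (\<sigma> \<circ> \<psi>)) (q (D, \<psi>)) x Y X Z
         = cotton_york (V \<circ> \<psi>) (\<sigma> \<circ> \<psi>) x X Y Z" for X Y Z
        by (rule s.cotton_york_q[OF x Vs]) (simp_all add: qs)
      show "q (D, \<psi>) x X (sff_transpose ((V \<circ> \<psi>) x) (\<sigma> \<circ> \<psi>) x Y u) = q (D, \<psi>) x Y (sff_transpose ((V \<circ> \<psi>) x) (\<sigma> \<circ> \<psi>) x X u)"
        if "u \<in> lorth ((V \<circ> \<psi>) x)" for X Y u
        unfolding qs[OF x] Vs[OF x] by (rule s.q_commutes[OF D _ flatV x]) (use that V_eq[OF \<sigma> D] x in auto)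
    qed
  qed
qed

end

theorem corollary16p6:
  fixes A :: "('p::{t2_space, second_countable_topology}, 'm::finite) param set"
    and \<Lambda> :: "'p \<Rightarrow> ('e::euclidean_space \<times> real) set"
    and v :: "'e \<times> real"
    and K :: real
  assumes "smooth_atlas A"
    and "CARD('m) \<ge> 2"
    and "sphere_immersion A \<Lambda>"
    and "in_spaceform v \<Lambda>"
    and "weightless_normal_flat A \<Lambda>"
    and "constant_gaussian_curvature A v \<Lambda> K"
  shows "moebius_flat A \<Lambda> \<and> (\<exists>k. induced_metric_constant_curvature A v \<Lambda> k)"
proof
  interpret immersed_spaceform A \<Lambda> v K by unfold_locales (use assms in auto)
  show "\<exists>k. induced_metric_constant_curvature A v \<Lambda> k" using induced_metric_constant_curvature by blast
  show "moebius_flat A \<Lambda>"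
  proof (cases "CARD('m) = 2")
    case True
    then show ?thesis
      using commuting_cy_potential_exists[OF True assms(5)] assms(5) unfolding moebius_flat_def by simp
  next
    case False
    then have "CARD('m) \<ge> 3" using assms(2) by simp
    then show ?thesis using conformally_flat assms(5) unfolding moebius_flat_def by simp
  qed
qed

end
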